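(* Consider a supercritical branching random walk with $m(\gamma)\in(0,\infty)$ for some fixed $\gamma>0$, its intrinsic martingale $\{W_n:n\ge0\}$, the associated multiplicative random walk $\{\Pi_n:n\ge 0\}$ and the associated function $J$, all as described in the context. The martingale $\{W_n:n\ge0\}$ is uniformly integrable if and only if the following two conditions both hold: $$\lim_{n\to\infty}\Pi_n=0\quad\text{a.s.}$$ and $$\mathbb{E}\,W_1\,J(\log^+W_1)<\infty .$$
   Context: Branching random walk (BRW). Let $\mathcal{Z}=\sum_{i=1}^N\delta_{X_i}$ be a point process on $\mathbb{R}$ with $N=\mathcal{Z}(\mathbb{R})\in\{0,1,2,\dots\}\cup\{\infty\}$ (the value $\infty$ is allowed with positive probability) and $\mathbb{E}N>1$ (supercriticality). Let $\mathbf{V}=\bigcup_{n\ge0}\mathbb{N}^n$ be the Ulam–Harris tree with root $\varnothing$; $|v|$ denotes the length of $v\in\mathbf{V}$. To each $v$ attach an independent copy $\mathcal{Z}(v)=\sum_{i=1}^{N(v)}\delta_{X_i(v)}$ of $\mathcal{Z}$, giving the displacements of the children $vi$ of $v$ relative to $v$. The random tree is $\mathbf{T}=\{\varnothing\}\cup\{v=v_1\dots v_n\in\mathbf{V}\setminus\{\varnothing\}: v_i\le N(v_1\dots v_{i-1}),\ i=1,\dots,n\}$. The position of $v=v_1\dots v_n\in\mathbf{T}$ is $S(v)=\sum_{i=1}^nX_{v_i}(v_1\dots v_{i-1})$, $S(\varnothing)=0$. $\sum_{|v|=n}$ means summation over all $v\in\mathbf{T}$ with $|v|=n$. Martingale.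 Fix $\gamma>0$ with $m(\gamma)=\mathbb{E}\int_{\mathbb{R}}e^{\gamma x}\,\mathcal{Z}(dx)\in(0,\infty)$. Put $L(v)=e^{\gamma S(v)}/m(\gamma)^{|v|}$ and $W_n=\sum_{|v|=n}L(v)$. Then $(W_n)_{n\ge0}$ is a nonnegative mean-one martingale with respect to $\mathcal{F}_n=\sigma(\mathcal{Z}(v):|v|\le n-1)$ ($\mathcal{F}_0$ trivial). Associated multiplicative random walk. Let $M$ be a random variable with law $\mathbb{P}\{M\in B\}=\mathbb{E}\big[\sum_{|v|=1}L(v)\,\mathbf{1}_B(L(v))\big]$ for Borel $B\subset[0,\infty)$, let $M_1,M_2,\dots$ be i.i.d. copies of $M$, and $\Pi_0=1$, $\Pi_n=M_1\cdots M_n$. One has $\mathbb{P}\{M=0\}=0$. Function $J$. For $x>0$, $A(x)=\int_0^x\mathbb{P}\{-\log M>y\}\,dy$ and $J(x)=x/A(x)$; $J(0)=\lim_{x\downarrow0}J(x)=1/\mathbb{P}\{M<1\}$ (if $\mathbb{P}\{M<1\}=0$, $J$ is read as $+\infty$). $\log^+x=\max(\log x,0)$ with $\log^+0=0$. *)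

theory Defs
  imports "HOL-Probability.Probability"
begin

section \<open>Branching random walks\<close>

text \<open>
  Individuals are words over \<^typ>\<open>nat\<close>; the word \<open>v @ [i]\<close> is a child of \<open>v\<close>, the children of \<open>v\<close>
  being numbered from 0. \<open>N v \<omega>\<close> is the number of children of \<open>v\<close> and \<open>X v i \<omega>\<close> the displacement
  of the \<open>i\<close>-th child relative to \<open>v\<close>. The value \<open>X v i \<omega>\<close> has no meaning when \<open>i \<ge> N v \<omega>\<close>;
  \<open>reproduction\<close> erases it, so that nothing is assumed about it.
\<close>

definition reproduction ::
    "(nat list \<Rightarrow> 'a \<Rightarrow> enat) \<Rightarrow> (nat list \<Rightarrow> nat \<Rightarrow> 'a \<Rightarrow> real)
      \<Rightarrow> nat list \<Rightarrow> 'a \<Rightarrow> enat \<times> (nat \<Rightarrow> real)"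
  where "reproduction N X v \<omega> = (N v \<omega>, restrict (\<lambda>i. X v i \<omega>) {i. enat i < N v \<omega>})"

definition reproduction_space :: "(enat \<times> (nat \<Rightarrow> real)) measure"
  where "reproduction_space = count_space UNIV \<Otimes>\<^sub>M (\<Pi>\<^sub>M i\<in>UNIV. borel)"

text \<open>The counting measure \<open>\<Sum>i<N v \<omega>. \<delta>(X v i \<omega>)\<close> on the real line.\<close>

definition point_process ::
    "(nat list \<Rightarrow> 'a \<Rightarrow> enat) \<Rightarrow> (nat list \<Rightarrow> nat \<Rightarrow> 'a \<Rightarrow> real)
      \<Rightarrow> nat list \<Rightarrow> 'a \<Rightarrow> real measure"
  where "point_process N X v \<omega> = distr (count_space {i. enat i < N v \<omega>}) borel (\<lambda>i. X v i \<omega>)"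

text \<open>The generic point process is represented by its copy at the root \<open>[]\<close>.\<close>

locale branching_random_walk = prob_space P
  for P :: "'a measure" +
  fixes N :: "nat list \<Rightarrow> 'a \<Rightarrow> enat"
    and X :: "nat list \<Rightarrow> nat \<Rightarrow> 'a \<Rightarrow> real"
  assumes indep_reproduction:
      "indep_vars (\<lambda>_. reproduction_space) (reproduction N X) UNIV"
    and identically_distributed:
      "\<And>v. distr P reproduction_space (reproduction N X v)
            = distr P reproduction_space (reproduction N X [])"
    and supercritical: "(\<integral>\<^sup>+\<omega>. ennreal_of_enat (N [] \<omega>) \<partial>P) > 1"

definition tree :: "(nat list \<Rightarrow> 'a \<Rightarrow> enat) \<Rightarrow> 'a \<Rightarrow> nat list set"
  where "tree N \<omega> = {v. \<forall>k<length v. enat (v ! k) < N (take k v) \<omega>}"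

definition generation :: "(nat list \<Rightarrow> 'a \<Rightarrow> enat) \<Rightarrow> nat \<Rightarrow> 'a \<Rightarrow> nat list set"
  where "generation N n \<omega> = {v \<in> tree N \<omega>. length v = n}"

definition position :: "(nat list \<Rightarrow> nat \<Rightarrow> 'a \<Rightarrow> real) \<Rightarrow> nat list \<Rightarrow> 'a \<Rightarrow> real"
  where "position X v \<omega> = (\<Sum>k<length v. X (take k v) (v ! k) \<omega>)"

section \<open>The intrinsic martingale\<close>

definition m ::
    "'a measure \<Rightarrow> (nat list \<Rightarrow> 'a \<Rightarrow> enat) \<Rightarrow> (nat list \<Rightarrow> nat \<Rightarrow> 'a \<Rightarrow> real) \<Rightarrow> real \<Rightarrow> ennreal"
  where "m P N X \<gamma> = (\<integral>\<^sup>+\<omega>. (\<integral>\<^sup>+x. ennreal (exp (\<gamma> * x)) \<partial>point_process N X [] \<omega>) \<partial>P)"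

definition L ::
    "'a measure \<Rightarrow> (nat list \<Rightarrow> 'a \<Rightarrow> enat) \<Rightarrow> (nat list \<Rightarrow> nat \<Rightarrow> 'a \<Rightarrow> real)
      \<Rightarrow> real \<Rightarrow> nat list \<Rightarrow> 'a \<Rightarrow> real"
  where "L P N X \<gamma> v \<omega> = exp (\<gamma> * position X v \<omega>) / enn2real (m P N X \<gamma>) ^ length v"

text \<open>
  Sums over a generation have possibly infinitely many nonnegative terms and are written as
  integrals over the counting measure, with values in \<open>[0, \<infinity>]\<close>.
\<close>

definition W ::
    "'a measure \<Rightarrow> (nat list \<Rightarrow> 'a \<Rightarrow> enat) \<Rightarrow> (nat list \<Rightarrow> nat \<Rightarrow> 'a \<Rightarrow> real)
      \<Rightarrow> real \<Rightarrow> nat \<Rightarrow> 'a \<Rightarrow> ennreal"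
  where "W P N X \<gamma> n \<omega> = (\<integral>\<^sup>+v. ennreal (L P N X \<gamma> v \<omega>) \<partial>count_space (generation N n \<omega>))"

text \<open>Uniform integrability of a family of \<open>[0, \<infinity>]\<close>-valued random variables.\<close>

definition uniformly_integrable :: "'a measure \<Rightarrow> ('i \<Rightarrow> 'a \<Rightarrow> ennreal) \<Rightarrow> 'i set \<Rightarrow> bool"
  where "uniformly_integrable P Y I \<longleftrightarrow>
    (\<forall>i\<in>I. Y i \<in> borel_measurable P) \<and>
    ((\<lambda>K::real. SUP i\<in>I. \<integral>\<^sup>+\<omega>. Y i \<omega> * indicator {\<omega>. Y i \<omega> > ennreal K} \<omega> \<partial>P) \<longlongrightarrow> 0) at_top"

section \<open>The associated multiplicative random walk\<close>

text \<open>The mass \<open>E (\<Sum>|v|=1. L(v) 1\<^sub>B(L(v)))\<close> that the law of \<open>M\<close> gives to a Borel set \<open>B\<close>.\<close>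

definition associated_mass ::
    "'a measure \<Rightarrow> (nat list \<Rightarrow> 'a \<Rightarrow> enat) \<Rightarrow> (nat list \<Rightarrow> nat \<Rightarrow> 'a \<Rightarrow> real)
      \<Rightarrow> real \<Rightarrow> real set \<Rightarrow> ennreal"
  where "associated_mass P N X \<gamma> B =
    (\<integral>\<^sup>+\<omega>. (\<integral>\<^sup>+v. ennreal (L P N X \<gamma> v \<omega>) * indicator B (L P N X \<gamma> v \<omega>)
              \<partial>count_space (generation N 1 \<omega>)) \<partial>P)"

text \<open>
  \<open>M\<close> is a random variable on \<open>Q\<close> with the law given by \<open>associated_mass\<close>, and \<open>Ms 1, Ms 2, \<dots>\<close> are
  i.i.d. copies of it. The values \<open>associated_mass P N X \<gamma> B\<close> force \<open>M > 0\<close> almost surely.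
\<close>

locale associated_multiplicative_walk = prob_space Q
  for Q :: "'b measure" +
  fixes P :: "'a measure"
    and N :: "nat list \<Rightarrow> 'a \<Rightarrow> enat"
    and X :: "nat list \<Rightarrow> nat \<Rightarrow> 'a \<Rightarrow> real"
    and \<gamma> :: real
    and M :: "'b \<Rightarrow> real"
    and Ms :: "nat \<Rightarrow> 'b \<Rightarrow> real"
  assumes M_random_variable: "random_variable borel M"
    and M_law: "\<And>B. B \<in> sets borel \<Longrightarrow>
      emeasure Q {\<omega> \<in> space Q. M \<omega> \<in> B} = associated_mass P N X \<gamma> B"
    and Ms_indep: "indep_vars (\<lambda>_. borel) Ms {1..}"
    and Ms_copies: "\<And>n. n \<ge> 1 \<Longrightarrow> distr Q borel (Ms n) = distr Q borel M"

definition mult_walk :: "(nat \<Rightarrow> 'b \<Rightarrow> real) \<Rightarrow> nat \<Rightarrow> 'b \<Rightarrow> real"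
  where "mult_walk Ms n \<omega> = (\<Prod>k=1..n. Ms k \<omega>)"

section \<open>The function J\<close>

text \<open>In \<open>A\<close>, the library convention \<open>ln 0 = 0\<close> is harmless because \<open>M > 0\<close> almost surely.\<close>

definition A :: "'b measure \<Rightarrow> ('b \<Rightarrow> real) \<Rightarrow> real \<Rightarrow> ennreal"
  where "A Q M x = (\<integral>\<^sup>+y\<in>{0..x}. emeasure Q {\<omega> \<in> space Q. - ln (M \<omega>) > y} \<partial>lborel)"

text \<open>
  Division by 0 in \<^typ>\<open>ennreal\<close> of a nonzero element is \<open>\<infinity>\<close>, so \<open>J\<close> is constantly \<open>\<infinity>\<close> when
  \<open>M \<ge> 1\<close> almost surely. \<open>J\<close> is only used on \<open>[0, \<infinity>)\<close>.
\<close>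

definition J :: "'b measure \<Rightarrow> ('b \<Rightarrow> real) \<Rightarrow> real \<Rightarrow> ennreal"
  where "J Q M x =
    (if x > 0 then ennreal x / A Q M x else 1 / emeasure Q {\<omega> \<in> space Q. M \<omega> < 1})"

text \<open>
  The case \<open>w = 0\<close> is explicit for readability only. At \<open>w = \<infinity>\<close> the value is 0 instead of \<open>\<infinity>\<close>; it is
  only evaluated at \<open>W P N X \<gamma> 1 \<omega>\<close>, which has expectation 1 and so is finite almost surely.
\<close>

definition log_plus :: "ennreal \<Rightarrow> real"
  where "log_plus w = (if w = 0 then 0 else max (ln (enn2real w)) 0)"

end

theory Submission
  imports Defs
begin

text \<open>
  Under the size-biased law a distinguished line of descent, the spine, carries i.i.d. pairs
  \<open>(M, Q)\<close>, where \<open>M\<close> is the weight of the chosen child and \<open>Q\<close> the total weight of its generation,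
  and \<open>E (W\<^sub>n 1(W\<^sub>n > K))\<close> is the size-biased probability of \<open>W\<^sub>n > K\<close>. Given the spine and its
  siblings, \<open>W\<^sub>n\<close> has a mean of at most \<open>1 + \<Sum>k. \<Pi>\<^sub>k Q\<^sub>k\<^sub>+\<^sub>1\<close>, so uniform integrability follows once this
  perpetuity converges. Conversely, uniform integrability makes \<open>sup\<^sub>k \<Pi>\<^sub>k Q\<^sub>k\<^sub>+\<^sub>1\<close> finite, because the
  probability that some individual \<open>v\<close> has \<open>L(v)\<close> times the total weight of its children above \<open>K\<close> is
  at most \<open>1 / K\<close>.

  Both sides are then decided by the random walk \<open>S\<^sub>n = - ln \<Pi>\<^sub>n\<close>. If it is bounded below and
  nontrivial, it tends to infinity. If it tends to infinity, its ladder epoch has finite mean, and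
  comparing \<open>ln Q\<close> with the renewal functions of the ladder heights and of the sums of the positive
  parts of the steps, both of which are of order \<open>x / A x\<close>, gives the moment condition.
\<close>

section \<open>Random walks on the sequence space\<close>

text \<open>No moment of \<open>- ln M\<close> is assumed, so no law of large numbers supplies a
  rate at which the products decay in n. Rates are replaced by counts: the expected number of times
  that a nondecreasing walk spends below x. Wald's identity for increments truncated at x bounds
  such a count, and the truncated mean of the positive part of a step is exactly \<open>A x\<close>.
  Since a first ladder height dominates the positive part of the first step, the ladder walk (used
  for sufficiency) and the walk of positive parts (used for necessity) are measured by the same
  function up to constants.

  No size-biased measure on infinite trees is built. Tree and spine are compared at a fixed
  generation only: the ancestral line enters a weighted sum over the generation through a
  two-dimensional state, and a many-to-one formula integrates such sums. Uniform integrability is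
  used directly as a statement about tails, without a limit of the martingale. Supercriticality
  excludes the case M = 1 almost surely, in which the walk vanishes identically: it is bounded but
  does not drift.\<close>

lemma sum_min_upper:
  fixes r :: "nat \<Rightarrow> real"
  assumes r: "\<And>k. 0 \<le> r k" and x: "0 \<le> x"
  shows "(\<Sum>k<n. if (\<Sum>j<k. r j) \<le> x then min (r k) x else 0) \<le> min (\<Sum>j<n. r j) (2 * x)"
proof (induction n)
  case (Suc n)
  show ?case using Suc r[of n] x by (auto simp: min_def split: if_splits)
qed (use x in simp)

text \<open>Only increments that start below level \<open>x\<close> are counted. Until the sum
  passes \<open>x\<close>, the truncated increments add up to at least \<open>x\<close>; in the
  upper bound above, the increment that crosses the level adds at most another \<open>x\<close>.
  This overshoot is the origin of the factor 2.\<close>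

lemma sum_min_lower:
  fixes r :: "nat \<Rightarrow> real"
  assumes r: "\<And>k. 0 \<le> r k" and x: "0 \<le> x"
  shows "min (\<Sum>j<n. r j) x \<le> (\<Sum>k<n. if (\<Sum>j<k. r j) < x then min (r k) x else 0)"
proof (induction n)
  case (Suc n)
  have "0 \<le> (\<Sum>k<n. if (\<Sum>j<k. r j) < x then min (r k) x else 0)"
    using r x by (intro sum_nonneg) auto
  then show ?case using Suc r[of n] x by (auto simp: min_def split: if_splits)
qed (use x in simp)

lemma borel_measurable_pred_le [measurable (raw)]:
  fixes f g :: "'a \<Rightarrow> 'b::{second_countable_topology, linorder_topology}"
  shows "f \<in> borel_measurable M \<Longrightarrow> g \<in> borel_measurable M \<Longrightarrow> Measurable.pred M (\<lambda>w. f w \<le> g w)"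
  unfolding Measurable.pred_def by (rule borel_measurable_le)

text \<open>The step space stays abstract and the increment is a function \<open>f\<close> on it, so
  that the walk, the walk of its positive parts and sums of other functionals of the steps live on
  the same path.\<close>

definition psum :: "('e \<Rightarrow> real) \<Rightarrow> nat \<Rightarrow> (nat \<Rightarrow> 'e) \<Rightarrow> real"
  where "psum f n \<omega> = (\<Sum>k<n. f (\<omega> k))"

lemma psum_0 [simp]: "psum f 0 \<omega> = 0"
  and psum_Suc: "psum f (Suc n) \<omega> = psum f n \<omega> + f (\<omega> n)"
  by (simp_all add: psum_def)

lemma psum_add: "psum f (i + n) \<omega> = psum f i \<omega> + psum f n (\<lambda>k. \<omega> (i + k))"
  by (induction n) (simp_all add: psum_Suc)

lemma psum_comb_seq: "i \<le> n \<Longrightarrow> psum f i (comb_seq n \<omega> \<omega>') = psum f i \<omega>"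
  unfolding psum_def by (rule sum.cong) (auto simp: comb_seq_def)

lemma measurable_psum [measurable]:
  assumes [measurable]: "f \<in> borel_measurable M"
  shows "psum f n \<in> borel_measurable (\<Pi>\<^sub>M i\<in>UNIV. M)"
  unfolding psum_def[abs_def] by measurable

section \<open>Independence of past and future under an infinite product measure\<close>

context sequence_space
begin

lemma measurable_shift [measurable]: "(\<lambda>\<omega> k. \<omega> (n + k)) \<in> S \<rightarrow>\<^sub>M S"
  by (rule measurable_PiM_single') (auto simp: space_PiM)

text \<open>\<open>comb_seq n \<omega> \<omega>'\<close> takes its first \<open>n\<close>
  coordinates from \<open>\<omega>\<close> and continues with \<open>\<omega>'\<close>, so
  \<open>past\<close> says that \<open>F\<close> reads its first argument only before time
  \<open>n\<close>. Gluing two independent paths in this way reproduces the product measure, which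
  decouples the future from the past.\<close>

lemma nn_integral_past_future:
  assumes F [measurable]: "F \<in> borel_measurable (S \<Otimes>\<^sub>M S)"
    and past: "\<And>\<omega> \<omega>' \<eta>. F (comb_seq n \<omega> \<omega>', \<eta>) = F (\<omega>, \<eta>)"
  shows "(\<integral>\<^sup>+\<omega>. F (\<omega>, \<lambda>k. \<omega> (n + k)) \<partial>S) = (\<integral>\<^sup>+\<omega>. \<integral>\<^sup>+\<omega>'. F (\<omega>, \<omega>') \<partial>S \<partial>S)"
proof -
  have "(\<integral>\<^sup>+\<omega>. F (\<omega>, \<lambda>k. \<omega> (n + k)) \<partial>S)
      = (\<integral>\<^sup>+\<omega>. F (\<omega>, \<lambda>k. \<omega> (n + k)) \<partial>distr (S \<Otimes>\<^sub>M S) S (\<lambda>(\<omega>, \<omega>'). comb_seq n \<omega> \<omega>'))"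
    by (simp only: PiM_comb_seq)
  also have "\<dots> = (\<integral>\<^sup>+p. F p \<partial>(S \<Otimes>\<^sub>M S))"
    by (subst nn_integral_distr)
      (auto intro!: nn_integral_cong simp: past comb_seq_def)
  also have "\<dots> = (\<integral>\<^sup>+\<omega>. \<integral>\<^sup>+\<omega>'. F (\<omega>, \<omega>') \<partial>S \<partial>S)"
    by (simp add: P.nn_integral_fst)
  finally show ?thesis .
qed

lemma nn_integral_coordinate:
  assumes [measurable]: "f \<in> borel_measurable M"
  shows "(\<integral>\<^sup>+\<omega>. f (\<omega> n) \<partial>S) = (\<integral>\<^sup>+e. f e \<partial>M)"
proof -
  have "(\<integral>\<^sup>+\<omega>. f (\<omega> n) \<partial>S) = (\<integral>\<^sup>+e. f e \<partial>distr S M (\<lambda>\<omega>. \<omega> n))"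
    by (subst nn_integral_distr) auto
  then show ?thesis by (simp add: PiM_component)
qed

lemma nn_integral_past_coordinate:
  assumes F [measurable]: "F \<in> borel_measurable (S \<Otimes>\<^sub>M M)"
    and past: "\<And>\<omega> \<omega>' e. F (comb_seq n \<omega> \<omega>', e) = F (\<omega>, e)"
  shows "(\<integral>\<^sup>+\<omega>. F (\<omega>, \<omega> n) \<partial>S) = (\<integral>\<^sup>+\<omega>. \<integral>\<^sup>+e. F (\<omega>, e) \<partial>M \<partial>S)"
proof -
  have "(\<integral>\<^sup>+\<omega>. F (\<omega>, \<omega> n) \<partial>S) = (\<integral>\<^sup>+\<omega>. (\<lambda>(\<omega>, \<eta>). F (\<omega>, \<eta> 0)) (\<omega>, \<lambda>k. \<omega> (n + k)) \<partial>S)"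
    by simp
  also have "\<dots> = (\<integral>\<^sup>+\<omega>. \<integral>\<^sup>+\<omega>'. F (\<omega>, \<omega>' 0) \<partial>S \<partial>S)"
    by (subst nn_integral_past_future) (auto simp: past)
  also have "\<dots> = (\<integral>\<^sup>+\<omega>. \<integral>\<^sup>+e. F (\<omega>, e) \<partial>M \<partial>S)"
    by (intro nn_integral_cong nn_integral_coordinate) simp
  finally show ?thesis .
qed

lemma nn_integral_past_times_coordinate:
  assumes [measurable]: "f \<in> borel_measurable S" "g \<in> borel_measurable M"
    and past: "\<And>\<omega> \<omega>'. f (comb_seq n \<omega> \<omega>') = f \<omega>"
  shows "(\<integral>\<^sup>+\<omega>. f \<omega> * g (\<omega> n) \<partial>S) = (\<integral>\<^sup>+\<omega>. f \<omega> \<partial>S) * (\<integral>\<^sup>+e. g e \<partial>M)"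
  using nn_integral_past_coordinate[of "\<lambda>(\<omega>, e). f \<omega> * g e" n]
  by (simp add: past nn_integral_cmult nn_integral_multc)

lemma nn_integral_past_times_future:
  assumes [measurable]: "f \<in> borel_measurable S" "g \<in> borel_measurable S"
    and past: "\<And>\<omega> \<omega>'. f (comb_seq n \<omega> \<omega>') = f \<omega>"
  shows "(\<integral>\<^sup>+\<omega>. f \<omega> * g (\<lambda>k. \<omega> (n + k)) \<partial>S) = (\<integral>\<^sup>+\<omega>. f \<omega> \<partial>S) * (\<integral>\<^sup>+\<omega>. g \<omega> \<partial>S)"
  using nn_integral_past_future[of "\<lambda>(\<omega>, e). f \<omega> * g e" n]
  by (simp add: past nn_integral_cmult nn_integral_multc)

text \<open>Permuting finitely many coordinates preserves the product law; this is the duality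
  principle for random walks.\<close>

lemma nn_integral_reverse:
  assumes [measurable]: "f \<in> borel_measurable S"
  shows "(\<integral>\<^sup>+\<omega>. f (\<lambda>k. if k < n then \<omega> (n - Suc k) else \<omega> k) \<partial>S) = (\<integral>\<^sup>+\<omega>. f \<omega> \<partial>S)"
proof -
  let ?p = "\<lambda>k. if k < n then n - Suc k else k"
  have "inj ?p" by (auto simp: inj_on_def split: if_splits)
  then have "distr S S (\<lambda>\<omega>. \<lambda>k\<in>UNIV. \<omega> (?p k)) = S"
    by (intro distr_PiM_reindex[where K = UNIV and M = "\<lambda>_. M"]) (auto simp: M.prob_space_axioms)
  moreover have "(\<lambda>\<omega>. \<lambda>k\<in>UNIV. \<omega> (?p k)) = (\<lambda>\<omega> k. if k < n then \<omega> (n - Suc k) else \<omega> k :: 'a)"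
    by (auto simp: fun_eq_iff)
  moreover have "(\<lambda>\<omega> k. if k < n then \<omega> (n - Suc k) else \<omega> k) \<in> S \<rightarrow>\<^sub>M S"
    by (rule measurable_PiM_single') (auto simp: space_PiM PiE_def Pi_iff)
  ultimately show ?thesis
    using nn_integral_distr[of "\<lambda>\<omega> k. if k < n then \<omega> (n - Suc k) else \<omega> k" S S f] by simp
qed

end

section \<open>Ladder epochs\<close>

lemma psum_reverse:
  assumes "k \<le> n"
  shows "psum f k (\<lambda>k. if k < n then \<omega> (n - Suc k) else \<omega> k) = psum f n \<omega> - psum f (n - k) \<omega>"
  using assms
proof (induction k)
  case (Suc k)
  then have "n - k = Suc (n - Suc k)" by simp
  with Suc show ?case by (simp add: psum_Suc)
qed simp

lemma suminf_indicator_unique: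
  assumes "\<And>n. P n \<longleftrightarrow> n = i"
  shows "(\<Sum>n. if P n then c else 0 :: ennreal) = c"
  using sums_single[of i "\<lambda>_. c"] by (simp add: assms sums_iff)

lemma finite_if_suminf_finite:
  assumes "(\<Sum>n. if P n then 1 else 0 :: ennreal) \<noteq> \<infinity>"
  shows "finite {n. P n}"
proof (rule ccontr)
  assume inf: "infinite {n. P n}"
  have "of_nat k \<le> (\<Sum>n. if P n then 1 else 0 :: ennreal)" for k
  proof -
    obtain F where F: "F \<subseteq> {n. P n}" "finite F" "card F = k"
      using infinite_arbitrarily_large[OF inf] by blast
    have "of_nat k = (\<Sum>n\<in>F. if P n then 1 else 0 :: ennreal)"
      using F by (subst sum.cong[OF refl, of _ _ "\<lambda>_. 1"]) auto
    also have "\<dots> \<le> (\<Sum>n. if P n then 1 else 0 :: ennreal)"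
      using F by (intro sum_le_suminf) auto
    finally show ?thesis .
  qed
  then show False
    using assms ennreal_Ex_less_of_nat[of "\<Sum>n. if P n then 1 else 0 :: ennreal"]
    by (auto simp: less_top not_le[symmetric])
qed

text \<open>Borel-Cantelli: a finite expected number of occurrences leaves only finitely many of
  them almost surely.\<close>

lemma AE_finite_if_suminf_finite:
  assumes [measurable]: "\<And>n. Measurable.pred M (P n)"
    and fin: "(\<Sum>n. \<integral>\<^sup>+x. (if P n x then 1 else 0) \<partial>M) \<noteq> \<infinity>"
  shows "AE x in M. finite {n. P n x}"
proof -
  have "(\<integral>\<^sup>+x. (\<Sum>n. if P n x then 1 else 0) \<partial>M) = (\<Sum>n. \<integral>\<^sup>+x. (if P n x then 1 else 0) \<partial>M)"
    by (rule nn_integral_suminf) measurable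
  with fin have "AE x in M. (\<Sum>n. if P n x then 1 else 0 :: ennreal) \<noteq> \<infinity>"
    by (intro nn_integral_PInf_AE) auto
  then show ?thesis by eventually_elim (rule finite_if_suminf_finite)
qed

lemma (in prob_space) nn_integral_less_1:
  assumes [measurable]: "f \<in> borel_measurable M"
    and le: "AE x in M. f x \<le> 1" and lt: "\<not> (AE x in M. 1 \<le> f x)"
  shows "(\<integral>\<^sup>+x. f x \<partial>M) < 1"
proof -
  have "(\<integral>\<^sup>+x. f x \<partial>M) \<le> (\<integral>\<^sup>+x. 1 \<partial>M)"
    using le by (rule nn_integral_mono_AE)
  then have "(\<integral>\<^sup>+x. f x \<partial>M) \<noteq> \<infinity>" by (auto simp: emeasure_space_1 top_unique)
  then have "(\<integral>\<^sup>+x. f x \<partial>M) < (\<integral>\<^sup>+x. 1 \<partial>M)"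
    by (intro nn_integral_less le lt) auto
  then show ?thesis by (simp add: emeasure_space_1)
qed

lemma exp_uminus_tendsto_0_iff:
  fixes s :: "nat \<Rightarrow> real"
  shows "(\<lambda>n. exp (- s n)) \<longlonglongrightarrow> 0 \<longleftrightarrow> filterlim s at_top sequentially"
proof
  assume lim: "(\<lambda>n. exp (- s n)) \<longlonglongrightarrow> 0"
  show "filterlim s at_top sequentially"
    unfolding filterlim_at_top
  proof
    fix Z
    have "eventually (\<lambda>n. exp (- s n) < exp (- Z)) sequentially"
      using order_tendstoD(2)[OF lim, of "exp (- Z)"] by simp
    then show "eventually (\<lambda>n. Z \<le> s n) sequentially"
      by eventually_elim simp
  qed
next
  assume "filterlim s at_top sequentially"
  then show "(\<lambda>n. exp (- s n)) \<longlonglongrightarrow> 0"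
    by (intro filterlim_compose[OF exp_at_bot]) (simp add: filterlim_uminus_at_bot)
qed

locale random_walk = sequence_space M for M :: "'e measure" +
  fixes \<xi> :: "'e \<Rightarrow> real"
  assumes measurable_step [measurable]: "\<xi> \<in> borel_measurable M"
begin

abbreviation "diverges \<omega> \<equiv> filterlim (\<lambda>n. psum \<xi> n \<omega>) at_top sequentially"
abbreviation "drifts_to_infinity \<equiv> (AE \<omega> in S. diverges \<omega>)"

text \<open>
  A walk that tends to infinity attains its minimum for a last time \<open>n\<close>: before \<open>n\<close> it lies weakly
  above its value at \<open>n\<close>, afterwards strictly above. Reversing time turns the first condition into
  the event that the first strict ladder epoch exceeds \<open>n\<close>.
\<close>

lemma last_minimum_time:
  assumes "filterlim (\<lambda>n. s n) at_top sequentially"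
  shows "\<exists>!n. (\<forall>j<n. s n \<le> s j) \<and> (\<forall>k\<ge>1. s n < (s (n + k) :: real))"
proof (rule ex_ex1I)
  obtain N where N: "\<And>n. n \<ge> N \<Longrightarrow> s 0 < s n"
    using filterlim_at_top_dense[THEN iffD1, OF assms, rule_format, of "s 0"]
    unfolding eventually_sequentially by auto
  define m0 where "m0 = Min (s ` {..N})"
  define I where "I = {n. n \<le> N \<and> s n = m0}"
  have "m0 \<in> s ` {..N}" unfolding m0_def by (rule Min_in) auto
  then have I: "finite I" "I \<noteq> {}" unfolding I_def by auto
  define n where "n = Max I"
  have n: "n \<in> I" unfolding n_def using I by (rule Max_in)
  have le: "m0 \<le> s j" if "j \<le> N" for j
    unfolding m0_def using that by (intro Min_le) auto
  have lt: "m0 < s j" if "j > n" for j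
  proof (cases "j \<le> N")
    case True
    have "j \<notin> I" using that I unfolding n_def by (meson Max_ge not_le)
    with True le[of j] show ?thesis unfolding I_def by auto
  next
    case False
    then show ?thesis using N[of j] le[of 0] by simp
  qed
  show "\<exists>n. (\<forall>j<n. s n \<le> s j) \<and> (\<forall>k\<ge>1. s n < s (n + k))"
  proof (intro exI conjI allI impI)
    fix j assume "j < n"
    then show "s n \<le> s j" using n le[of j] unfolding I_def by auto
  next
    fix k :: nat assume "k \<ge> 1"
    then show "s n < s (n + k)" using n lt[of "n + k"] unfolding I_def by auto
  qed
next
  fix n n' :: nat
  assume 1: "(\<forall>j<n. s n \<le> s j) \<and> (\<forall>k\<ge>1. s n < s (n + k))"
    and 2: "(\<forall>j<n'. s n' \<le> s j) \<and> (\<forall>k\<ge>1. s n' < s (n' + k))"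
  have "\<not> n < n'"
  proof
    assume "n < n'"
    then have "s n < s (n + (n' - n))" using 1 by (intro conjunct2[OF 1, rule_format]) auto
    then show False using 2 \<open>n < n'\<close> by (auto simp: not_le[symmetric])
  qed
  moreover have "\<not> n' < n"
  proof
    assume "n' < n"
    then have "s n' < s (n' + (n - n'))" using 2 by (intro conjunct2[OF 2, rule_format]) auto
    then show False using 1 \<open>n' < n\<close> by (auto simp: not_le[symmetric])
  qed
  ultimately show "n = n'" by simp
qed

text \<open>The sum is the mean of the first strict ladder epoch, written through its tail
  probabilities. Decomposing at the last time of the minimum shows that this mean times
  \<open>q\<close>, the probability that the walk stays positive from time 1 on, equals 1.\<close>

lemma expected_ladder_epoch_finite:
  assumes drift: drifts_to_infinity
  shows "(\<Sum>n. \<integral>\<^sup>+\<omega>. (if \<forall>k\<le>n. psum \<xi> k \<omega> \<le> 0 then 1 else 0) \<partial>S) < \<infinity>"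
proof -
  define q where "q = (\<integral>\<^sup>+\<omega>. (if \<forall>k\<ge>1. 0 < psum \<xi> k \<omega> then 1 else 0) \<partial>S)"
  let ?f = "\<lambda>n \<omega>. if \<forall>j<n. psum \<xi> n \<omega> \<le> psum \<xi> j \<omega> then 1 else 0 :: ennreal"
  let ?g = "\<lambda>\<omega>. if \<forall>k\<ge>1. 0 < psum \<xi> k \<omega> then 1 else 0 :: ennreal"
  have rev: "(\<integral>\<^sup>+\<omega>. ?f n \<omega> \<partial>S) = (\<integral>\<^sup>+\<omega>. (if \<forall>k\<le>n. psum \<xi> k \<omega> \<le> 0 then 1 else 0) \<partial>S)" for n
  proof -
    \<comment> \<open>Reversal of the first \<open>n\<close> steps turns \<open>psum \<xi> k\<close>
      into the increment over the last \<open>k\<close> of them.\<close>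
    have "(\<forall>k\<le>n. psum \<xi> k (\<lambda>k. if k < n then \<omega> (n - Suc k) else \<omega> k) \<le> 0)
        \<longleftrightarrow> (\<forall>j<n. psum \<xi> n \<omega> \<le> psum \<xi> j \<omega>)" (is "?l \<longleftrightarrow> ?r") for \<omega>
    proof
      assume l: ?l
      show ?r
      proof (intro allI impI)
        fix j assume "j < n"
        then show "psum \<xi> n \<omega> \<le> psum \<xi> j \<omega>"
          using l[rule_format, of "n - j"] by (simp add: psum_reverse)
      qed
    next
      assume r: ?r
      show ?l
      proof (intro allI impI)
        fix k assume "k \<le> n"
        then show "psum \<xi> k (\<lambda>k. if k < n then \<omega> (n - Suc k) else \<omega> k) \<le> 0"
          using r[rule_format, of "n - k"] by (cases k) (auto simp: psum_reverse)
      qed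
    qed
    then show ?thesis
      using nn_integral_reverse[of "\<lambda>\<omega>. if \<forall>k\<le>n. psum \<xi> k \<omega> \<le> 0 then 1 else 0 :: ennreal" n]
      by (simp only:) simp
  qed
  have "(\<Sum>n. \<integral>\<^sup>+\<omega>. ?f n \<omega> \<partial>S) * q = (\<Sum>n. (\<integral>\<^sup>+\<omega>. ?f n \<omega> \<partial>S) * q)"
    by simp
  also have "\<dots> = (\<Sum>n. \<integral>\<^sup>+\<omega>. ?f n \<omega> * ?g (\<lambda>k. \<omega> (n + k)) \<partial>S)"
  proof (rule suminf_cong)
    fix n
    have "?f n (comb_seq n \<omega> \<omega>') = ?f n \<omega>" for \<omega> \<omega>'
      by (simp add: psum_comb_seq)
    moreover have "?f n \<in> borel_measurable S" "?g \<in> borel_measurable S"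
      by measurable
    ultimately show "(\<integral>\<^sup>+\<omega>. ?f n \<omega> \<partial>S) * q = (\<integral>\<^sup>+\<omega>. ?f n \<omega> * ?g (\<lambda>k. \<omega> (n + k)) \<partial>S)"
      unfolding q_def by (intro nn_integral_past_times_future[of "?f n" ?g n, symmetric])
  qed
  also have "\<dots> = (\<integral>\<^sup>+\<omega>. (\<Sum>n. ?f n \<omega> * ?g (\<lambda>k. \<omega> (n + k))) \<partial>S)"
    by (rule nn_integral_suminf[symmetric]) measurable
  also have "\<dots> = (\<integral>\<^sup>+\<omega>. 1 \<partial>S)"
  proof (rule nn_integral_cong_AE, use drift in eventually_elim)
    fix \<omega> assume "diverges \<omega>"
    from last_minimum_time[OF this] obtain i where
      i: "\<And>n. (\<forall>j<n. psum \<xi> n \<omega> \<le> psum \<xi> j \<omega>) \<and> (\<forall>k\<ge>1. psum \<xi> n \<omega> < psum \<xi> (n + k) \<omega>) \<longleftrightarrow> n = i"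
      by metis
    have "?f n \<omega> * ?g (\<lambda>k. \<omega> (n + k)) = (if n = i then 1 else 0)" for n
      using i[of n] by (auto simp: psum_add)
    then show "(\<Sum>n. ?f n \<omega> * ?g (\<lambda>k. \<omega> (n + k))) = 1"
      by (simp add: suminf_indicator_unique[of "\<lambda>n. n = i" i])
  qed
  also have "\<dots> = 1" by (simp add: P.emeasure_space_1)
  finally have eq: "(\<Sum>n. \<integral>\<^sup>+\<omega>. ?f n \<omega> \<partial>S) * q = 1" .
  \<comment> \<open>In \<open>ennreal\<close> the product \<open>\<infinity> * q\<close> is 0 or
    \<open>\<infinity>\<close>, but never 1.\<close>
  then have "(\<Sum>n. \<integral>\<^sup>+\<omega>. ?f n \<omega> \<partial>S) \<noteq> \<infinity>"
    by (auto simp: ennreal_top_mult split: if_splits)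
  then show ?thesis by (simp add: rev less_top)
qed

section \<open>The strong Markov property at ladder epochs\<close>

definition first_positive :: "nat \<Rightarrow> (nat \<Rightarrow> 'e) \<Rightarrow> bool"
  where "first_positive n \<omega> \<longleftrightarrow> 0 < psum \<xi> n \<omega> \<and> (\<forall>m<n. \<not> 0 < psum \<xi> m \<omega>)"

definition ladder_epoch :: "(nat \<Rightarrow> 'e) \<Rightarrow> nat"
  where "ladder_epoch \<omega> = (LEAST n. 0 < psum \<xi> n \<omega>)"

text \<open>On a path that never becomes positive, \<open>LEAST\<close> yields an unspecified
  number. The maximum with 0 keeps the heights nonnegative even there, so that pathwise bounds on
  sums of heights hold without an exceptional set.\<close>

definition ladder_height :: "(nat \<Rightarrow> 'e) \<Rightarrow> real"
  where "ladder_height \<omega> = max 0 (psum \<xi> (ladder_epoch \<omega>) \<omega>)"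

definition ladder_shift :: "(nat \<Rightarrow> 'e) \<Rightarrow> nat \<Rightarrow> 'e"
  where "ladder_shift \<omega> = (\<lambda>k. \<omega> (ladder_epoch \<omega> + k))"

text \<open>The recursion removes the first block rather than the last, so that inductions apply the
  strong Markov property only at the first ladder epoch.\<close>

fun ladder_walk :: "nat \<Rightarrow> (nat \<Rightarrow> 'e) \<Rightarrow> real" where
  "ladder_walk 0 \<omega> = 0"
| "ladder_walk (Suc n) \<omega> = ladder_height \<omega> + ladder_walk n (ladder_shift \<omega>)"

lemma measurable_ladder_epoch [measurable]: "ladder_epoch \<in> S \<rightarrow>\<^sub>M count_space UNIV"
  unfolding ladder_epoch_def[abs_def] by measurable

lemma measurable_psum_ladder_epoch [measurable]:
  assumes [measurable]: "f \<in> borel_measurable M"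
  shows "(\<lambda>\<omega>. psum f (ladder_epoch \<omega>) \<omega>) \<in> borel_measurable S"
  by measurable

lemma measurable_ladder_height [measurable]: "ladder_height \<in> borel_measurable S"
  unfolding ladder_height_def[abs_def] by measurable

lemma measurable_ladder_shift [measurable]: "ladder_shift \<in> S \<rightarrow>\<^sub>M S"
  unfolding ladder_shift_def[abs_def]
  by (rule measurable_compose_countable[where f = "\<lambda>n \<omega> k. \<omega> (n + k)"]) measurable

lemma measurable_ladder_walk [measurable]: "ladder_walk n \<in> borel_measurable S"
  by (induction n) auto

lemma measurable_ladder_shift_iterate [measurable]: "ladder_shift ^^ n \<in> S \<rightarrow>\<^sub>M S"
  by (induction n) (auto simp: measurable_ident)

lemma ladder_walk_eq_sum: "ladder_walk n \<omega> = (\<Sum>j<n. ladder_height ((ladder_shift ^^ j) \<omega>))"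
proof (induction n arbitrary: \<omega>)
  case (Suc n)
  then show ?case by (simp add: sum.lessThan_Suc_shift funpow_swap1 del: sum.lessThan_Suc)
qed simp

lemma ladder_walk_Suc_end: "ladder_walk (Suc n) \<omega> = ladder_walk n \<omega> + ladder_height ((ladder_shift ^^ n) \<omega>)"
  by (simp only: ladder_walk_eq_sum sum.lessThan_Suc)

lemma first_positive_ladder_epoch:
  "first_positive n \<omega> \<Longrightarrow> ladder_epoch \<omega> = n"
  unfolding first_positive_def ladder_epoch_def by (rule Least_equality) (auto simp: not_less[symmetric])

lemma ex_first_positive:
  assumes "diverges \<omega>"
  shows "first_positive (ladder_epoch \<omega>) \<omega>"
proof -
  have "\<forall>\<^sub>F n in sequentially. 0 < psum \<xi> n \<omega>"
    using assms by (simp add: filterlim_at_top_dense)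
  then obtain n where "0 < psum \<xi> n \<omega>" by (metis eventually_sequentially order_refl)
  then show ?thesis
    unfolding first_positive_def ladder_epoch_def by (auto intro: LeastI dest: not_less_Least)
qed

lemma first_positive_pos: "first_positive n \<omega> \<Longrightarrow> 0 < n"
  by (cases n) (auto simp: first_positive_def)

lemma first_positive_comb_seq: "first_positive n (comb_seq n \<omega> \<omega>') = first_positive n \<omega>"
  by (simp add: first_positive_def psum_comb_seq)

lemma measurable_first_positive [measurable]: "Measurable.pred S (first_positive n)"
  unfolding first_positive_def[abs_def] by measurable

lemma ladder_height_pos: "first_positive (ladder_epoch \<omega>) \<omega> \<Longrightarrow> 0 < ladder_height \<omega>"
  unfolding ladder_height_def first_positive_def by auto

lemma ladder_height_nonneg: "0 \<le> ladder_height \<omega>"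
  by (simp add: ladder_height_def)

text \<open>A positive first step is itself the first ladder height. This is how ladder heights
  inherit a lower bound in terms of the step distribution.\<close>

lemma ladder_height_ge_step:
  assumes "first_positive (ladder_epoch \<omega>) \<omega>"
  shows "max (\<xi> (\<omega> 0)) 0 \<le> ladder_height \<omega>"
proof (cases "\<xi> (\<omega> 0) > 0")
  case True
  then have "first_positive 1 \<omega>"
    by (auto simp: first_positive_def psum_def)
  then show ?thesis
    using first_positive_ladder_epoch[of 1] True by (simp add: ladder_height_def psum_def)
qed (simp add: ladder_height_def)

text \<open>Where the epoch equals \<open>n\<close>, the height is a function of the first
  \<open>n\<close> coordinates and the shift is by the constant \<open>n\<close>, so that
  independence at a fixed time applies. Summation over \<open>n\<close> gives the claim, since under
  the drift exactly one \<open>n\<close> contributes.\<close>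

lemma strong_Markov_ladder_epoch:
  assumes drift: drifts_to_infinity
    and F [measurable]: "F \<in> borel_measurable (borel \<Otimes>\<^sub>M S)"
  shows "(\<integral>\<^sup>+\<omega>. F (ladder_height \<omega>, ladder_shift \<omega>) \<partial>S)
    = (\<integral>\<^sup>+\<omega>. \<integral>\<^sup>+\<omega>'. F (ladder_height \<omega>, \<omega>') \<partial>S \<partial>S)"
proof -
  let ?G = "\<lambda>n (\<omega>, \<omega>'). if first_positive n \<omega> then F (psum \<xi> n \<omega>, \<omega>') else 0"
  have G [measurable]: "?G n \<in> borel_measurable (S \<Otimes>\<^sub>M S)" for n
    by measurable
  have decomp: "AE \<omega> in S. \<forall>\<omega>'. F (ladder_height \<omega>, \<omega>') = (\<Sum>n. ?G n (\<omega>, \<omega>'))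
      \<and> F (ladder_height \<omega>, ladder_shift \<omega>) = (\<Sum>n. ?G n (\<omega>, \<lambda>k. \<omega> (n + k)))"
    using drift
  proof eventually_elim
    fix \<omega> assume "diverges \<omega>"
    then have fp: "first_positive (ladder_epoch \<omega>) \<omega>" by (rule ex_first_positive)
    then have iff: "first_positive n \<omega> \<longleftrightarrow> n = ladder_epoch \<omega>" for n
      by (metis fp first_positive_ladder_epoch)
    have h: "ladder_height \<omega> = psum \<xi> (ladder_epoch \<omega>) \<omega>"
      using fp by (simp add: ladder_height_def first_positive_def)
    have "(\<Sum>n. ?G n (\<omega>, f n)) = F (ladder_height \<omega>, f (ladder_epoch \<omega>))" for f
      using sums_single[of "ladder_epoch \<omega>" "\<lambda>n. F (psum \<xi> n \<omega>, f n)"]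
      by (simp add: iff sums_iff h)
    then show "\<forall>\<omega>'. F (ladder_height \<omega>, \<omega>') = (\<Sum>n. ?G n (\<omega>, \<omega>'))
      \<and> F (ladder_height \<omega>, ladder_shift \<omega>) = (\<Sum>n. ?G n (\<omega>, \<lambda>k. \<omega> (n + k)))"
      by (simp add: ladder_shift_def)
  qed
  have "(\<integral>\<^sup>+\<omega>. F (ladder_height \<omega>, ladder_shift \<omega>) \<partial>S)
      = (\<integral>\<^sup>+\<omega>. (\<Sum>n. ?G n (\<omega>, \<lambda>k. \<omega> (n + k))) \<partial>S)"
    by (rule nn_integral_cong_AE, use decomp in eventually_elim) auto
  also have "\<dots> = (\<Sum>n. \<integral>\<^sup>+\<omega>. ?G n (\<omega>, \<lambda>k. \<omega> (n + k)) \<partial>S)"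
    by (rule nn_integral_suminf) measurable
  also have "\<dots> = (\<Sum>n. \<integral>\<^sup>+\<omega>. \<integral>\<^sup>+\<omega>'. ?G n (\<omega>, \<omega>') \<partial>S \<partial>S)"
    by (intro suminf_cong nn_integral_past_future G) (simp add: first_positive_comb_seq psum_comb_seq)
  also have "\<dots> = (\<integral>\<^sup>+\<omega>. (\<Sum>n. \<integral>\<^sup>+\<omega>'. ?G n (\<omega>, \<omega>') \<partial>S) \<partial>S)"
    by (rule nn_integral_suminf[symmetric]) measurable
  also have "\<dots> = (\<integral>\<^sup>+\<omega>. \<integral>\<^sup>+\<omega>'. (\<Sum>n. ?G n (\<omega>, \<omega>')) \<partial>S \<partial>S)"
    by (intro nn_integral_cong nn_integral_suminf[symmetric]) measurable
  also have "\<dots> = (\<integral>\<^sup>+\<omega>. \<integral>\<^sup>+\<omega>'. F (ladder_height \<omega>, \<omega>') \<partial>S \<partial>S)"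
    by (rule nn_integral_cong_AE, use decomp in eventually_elim) auto
  finally show ?thesis .
qed

text \<open>The path after the first block is a fresh copy, to which the induction hypothesis
  applies. \<open>F\<close> is arbitrary in the induction because the height of the first block
  moves into it.\<close>

lemma strong_Markov_ladder_walk:
  assumes drift: drifts_to_infinity
    and "F \<in> borel_measurable (borel \<Otimes>\<^sub>M S)"
  shows "(\<integral>\<^sup>+\<omega>. F (ladder_walk n \<omega>, (ladder_shift ^^ n) \<omega>) \<partial>S)
    = (\<integral>\<^sup>+\<omega>. \<integral>\<^sup>+\<omega>'. F (ladder_walk n \<omega>, \<omega>') \<partial>S \<partial>S)"
  using assms(2)
proof (induction n arbitrary: F)
  case 0
  then show ?case by (simp add: P.emeasure_space_1)
next
  case (Suc n)
  note [measurable] = Suc.prems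
  have "(\<integral>\<^sup>+\<omega>. F (ladder_walk (Suc n) \<omega>, (ladder_shift ^^ Suc n) \<omega>) \<partial>S)
      = (\<integral>\<^sup>+\<omega>. (\<lambda>(h, \<omega>'). F (h + ladder_walk n \<omega>', (ladder_shift ^^ n) \<omega>'))
          (ladder_height \<omega>, ladder_shift \<omega>) \<partial>S)"
    by (simp add: funpow_swap1)
  also have "\<dots> = (\<integral>\<^sup>+\<omega>. \<integral>\<^sup>+\<omega>'. F (ladder_height \<omega> + ladder_walk n \<omega>', (ladder_shift ^^ n) \<omega>') \<partial>S \<partial>S)"
    by (subst strong_Markov_ladder_epoch[OF drift]) auto
  also have "\<dots> = (\<integral>\<^sup>+\<omega>. \<integral>\<^sup>+\<omega>'. \<integral>\<^sup>+\<eta>. F (ladder_height \<omega> + ladder_walk n \<omega>', \<eta>) \<partial>S \<partial>S \<partial>S)"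
  proof (rule nn_integral_cong)
    fix \<omega>
    show "(\<integral>\<^sup>+\<omega>'. F (ladder_height \<omega> + ladder_walk n \<omega>', (ladder_shift ^^ n) \<omega>') \<partial>S)
      = (\<integral>\<^sup>+\<omega>'. \<integral>\<^sup>+\<eta>. F (ladder_height \<omega> + ladder_walk n \<omega>', \<eta>) \<partial>S \<partial>S)"
      using Suc.IH[of "\<lambda>(h, \<eta>). F (ladder_height \<omega> + h, \<eta>)"] by simp
  qed
  also have "\<dots> = (\<integral>\<^sup>+\<omega>. (\<lambda>(h, \<omega>'). \<integral>\<^sup>+\<eta>. F (h + ladder_walk n \<omega>', \<eta>) \<partial>S)
          (ladder_height \<omega>, ladder_shift \<omega>) \<partial>S)"
    by (subst strong_Markov_ladder_epoch[OF drift]) auto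
  finally show ?case by simp
qed

text \<open>The strong Markov property for a functional of the shifted path alone says that the
  shift preserves the law, so null sets stay null.\<close>

lemma AE_first_positive_iterate:
  assumes drift: drifts_to_infinity
  shows "AE \<omega> in S. \<forall>n. first_positive (ladder_epoch ((ladder_shift ^^ n) \<omega>)) ((ladder_shift ^^ n) \<omega>)"
proof (subst AE_all_countable, rule allI)
  fix n
  let ?f = "\<lambda>\<omega>. if first_positive (ladder_epoch \<omega>) \<omega> then 0 else 1 :: ennreal"
  have [measurable]: "?f \<in> borel_measurable S"
    by measurable
  have "(\<integral>\<^sup>+\<omega>. ?f \<omega> \<partial>S) = (\<integral>\<^sup>+\<omega>. 0 \<partial>S)"
    by (rule nn_integral_cong_AE, use drift in eventually_elim) (simp add: ex_first_positive)
  then have "(\<integral>\<^sup>+\<omega>. ?f ((ladder_shift ^^ n) \<omega>) \<partial>S) = 0"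
    using strong_Markov_ladder_walk[OF drift, of "\<lambda>(h, \<omega>). ?f \<omega>" n] by (simp only: case_prod_conv) simp
  then have "AE \<omega> in S. ?f ((ladder_shift ^^ n) \<omega>) = 0"
    by (subst (asm) nn_integral_0_iff_AE) measurable
  then show "AE \<omega> in S. first_positive (ladder_epoch ((ladder_shift ^^ n) \<omega>)) ((ladder_shift ^^ n) \<omega>)"
    by eventually_elim (metis zero_neq_one)
qed

end

section \<open>Renewal estimates\<close>

lemma ennreal_divide_left_antimono:
  fixes a b c :: ennreal
  assumes "b \<le> c"
  shows "a / c \<le> a / b"
proof -
  have "inverse c \<le> inverse b"
  proof (cases "b = 0 \<or> c = \<top>")
    case False
    then show ?thesis
      using assms by (cases rule: ennreal2_cases[of b c]) (auto simp: inverse_ennreal ennreal_eq_0_iff top_unique)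
  qed auto
  then show ?thesis unfolding divide_ennreal_def by (rule mult_left_mono) simp
qed

text \<open>The case \<open>a = 0\<close> is included: a nonzero \<open>b\<close> divided by 0 is
  \<open>\<infinity>\<close>.\<close>

lemma ennreal_le_divideI:
  fixes a b u :: ennreal
  assumes "u * a \<le> b" "a < \<infinity>" "b \<noteq> 0"
  shows "u \<le> b / a"
proof (cases "a = 0")
  case False
  then have "u = u * a / a" using assms(2) by (simp add: ennreal_mult_divide_eq)
  also have "\<dots> \<le> b / a" by (rule divide_right_mono_ennreal) fact
  finally show ?thesis .
qed (use assms(3) in simp)

lemma ennreal_sum_divide: "(\<Sum>i\<in>I. f i) / c = (\<Sum>i\<in>I. f i / (c :: ennreal))"
  by (simp add: divide_ennreal_def sum_distrib_right)

section \<open>The truncated mean and the renewal function of the ladder heights\<close>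

context random_walk
begin

text \<open>This is \<open>A\<close> in another form: Fubini's theorem turns the mean of the
  truncated positive part into the integral of the tail (\<open>A_eq\<close>).\<close>

definition trunc_mean :: "real \<Rightarrow> ennreal"
  where "trunc_mean x = (\<integral>\<^sup>+e. ennreal (min (max (\<xi> e) 0) x) \<partial>M)"

lemma measurable_trunc_mean [measurable]: "trunc_mean \<in> borel_measurable borel"
  unfolding trunc_mean_def[abs_def] by measurable

lemma trunc_mean_mono: "x \<le> y \<Longrightarrow> trunc_mean x \<le> trunc_mean y"
  unfolding trunc_mean_def by (intro nn_integral_mono ennreal_leI) auto

lemma trunc_mean_le: "trunc_mean x \<le> ennreal x"
proof -
  have "trunc_mean x \<le> (\<integral>\<^sup>+e. ennreal x \<partial>M)"
    unfolding trunc_mean_def by (intro nn_integral_mono ennreal_leI) auto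
  then show ?thesis by (simp add: M.emeasure_space_1)
qed

lemma trunc_mean_finite: "trunc_mean x < \<infinity>"
  using trunc_mean_le[of x] by (rule le_less_trans) simp

lemma trunc_mean_le_ladder_height:
  assumes drift: drifts_to_infinity
  shows "trunc_mean x \<le> (\<integral>\<^sup>+\<omega>. ennreal (min (ladder_height \<omega>) x) \<partial>S)"
proof -
  have "trunc_mean x = (\<integral>\<^sup>+\<omega>. ennreal (min (max (\<xi> (\<omega> 0)) 0) x) \<partial>S)"
    unfolding trunc_mean_def by (rule nn_integral_coordinate[symmetric]) measurable
  also have "\<dots> \<le> (\<integral>\<^sup>+\<omega>. ennreal (min (ladder_height \<omega>) x) \<partial>S)"
    by (rule nn_integral_mono_AE, use drift in eventually_elim)
      (intro ennreal_leI min.mono ladder_height_ge_step ex_first_positive order_refl)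
  finally show ?thesis .
qed

text \<open>Wald's identity: the renewal function at \<open>x\<close> times the mean of the ladder
  height truncated at \<open>x\<close> is the mean total of the truncated heights that start at or
  below \<open>x\<close>. Pathwise this total is at most \<open>2 * x\<close>, and the truncated
  ladder height has mean at least \<open>trunc_mean x\<close>.\<close>

lemma ladder_renewal_upper:
  assumes drift: drifts_to_infinity and x: "0 \<le> x"
  shows "(\<Sum>n. \<integral>\<^sup>+\<omega>. (if ladder_walk n \<omega> \<le> x then 1 else 0) \<partial>S) * trunc_mean x \<le> ennreal (2 * x)"
proof -
  let ?a = "\<lambda>n \<omega>. if ladder_walk n \<omega> \<le> x then 1 else 0 :: ennreal"
  let ?b = "\<lambda>\<omega>. ennreal (min (ladder_height \<omega>) x)"
  have "(\<Sum>n. \<integral>\<^sup>+\<omega>. ?a n \<omega> \<partial>S) * trunc_mean x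
      \<le> (\<Sum>n. \<integral>\<^sup>+\<omega>. ?a n \<omega> \<partial>S) * (\<integral>\<^sup>+\<omega>. ?b \<omega> \<partial>S)"
    by (intro mult_left_mono trunc_mean_le_ladder_height drift) simp
  also have "\<dots> = (\<Sum>n. \<integral>\<^sup>+\<omega>. \<integral>\<^sup>+\<omega>'. ?a n \<omega> * ?b \<omega>' \<partial>S \<partial>S)"
    by (simp add: nn_integral_cmult nn_integral_multc)
  also have "\<dots> = (\<Sum>n. \<integral>\<^sup>+\<omega>. ?a n \<omega> *
      ?b ((ladder_shift ^^ n) \<omega>) \<partial>S)"
  proof (rule suminf_cong)
    fix n
    show "(\<integral>\<^sup>+\<omega>. \<integral>\<^sup>+\<omega>'. ?a n \<omega> * ?b \<omega>' \<partial>S \<partial>S)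
      = (\<integral>\<^sup>+\<omega>. ?a n \<omega> * ?b ((ladder_shift ^^ n) \<omega>) \<partial>S)"
      using strong_Markov_ladder_walk[OF drift,
        of "\<lambda>(h, \<omega>). (if h \<le> x then 1 else 0) * ?b \<omega>" n]
      by simp
  qed
  also have "\<dots> = (\<integral>\<^sup>+\<omega>. (\<Sum>n. ?a n \<omega> *
      ?b ((ladder_shift ^^ n) \<omega>)) \<partial>S)"
    by (rule nn_integral_suminf[symmetric]) measurable
  also have "\<dots> \<le> (\<integral>\<^sup>+\<omega>. ennreal (2 * x) \<partial>S)"
  proof (rule nn_integral_mono, rule suminf_le_const)
    fix \<omega> n
    have "?a k \<omega> * ?b ((ladder_shift ^^ k) \<omega>)
        = ennreal (if ladder_walk k \<omega> \<le> x then min (ladder_height ((ladder_shift ^^ k) \<omega>)) x else 0)" for k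
      by simp
    then have "(\<Sum>k<n. ?a k \<omega> * ?b ((ladder_shift ^^ k) \<omega>))
        = ennreal (\<Sum>k<n. if ladder_walk k \<omega> \<le> x then min (ladder_height ((ladder_shift ^^ k) \<omega>)) x else 0)"
      using x by (simp only:) (intro sum_ennreal, simp add: ladder_height_nonneg)
    also have "\<dots> \<le> ennreal (2 * x)"
      unfolding ladder_walk_eq_sum
      using sum_min_upper[of "\<lambda>k. ladder_height ((ladder_shift ^^ k) \<omega>)" x n] x
      by (intro ennreal_leI) (auto simp: ladder_height_nonneg)
    finally show "(\<Sum>k<n. ?a k \<omega> * ?b ((ladder_shift ^^ k) \<omega>))
        \<le> ennreal (2 * x)" .
  qed simp
  also have "\<dots> = ennreal (2 * x)" by (simp add: P.emeasure_space_1)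
  finally show ?thesis .
qed

text \<open>Subadditivity of \<open>x / trunc_mean x\<close> and Wald's identity over one ladder block.\<close>

lemma ladder_block_moment:
  assumes drift: drifts_to_infinity
    and z [measurable]: "z \<in> borel_measurable M" and z_pos: "\<And>e. 0 < z e"
    and fin: "(\<integral>\<^sup>+e. ennreal (z e) / trunc_mean (z e) \<partial>M) < \<infinity>"
  shows "(\<integral>\<^sup>+\<omega>. ennreal (psum z (ladder_epoch \<omega>) \<omega>) / trunc_mean (psum z (ladder_epoch \<omega>) \<omega>) \<partial>S) < \<infinity>"
proof -
  let ?J = "\<lambda>x. ennreal x / trunc_mean x"
  let ?f = "\<lambda>k \<omega>. if \<forall>m\<le>k. psum \<xi> m \<omega> \<le> 0 then 1 else 0 :: ennreal"
  have "(\<integral>\<^sup>+\<omega>. ?J (psum z (ladder_epoch \<omega>) \<omega>) \<partial>S) \<le> (\<integral>\<^sup>+\<omega>. (\<Sum>k. ?f k \<omega> * ?J (z (\<omega> k))) \<partial>S)"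
  proof (rule nn_integral_mono_AE, use drift in eventually_elim)
    fix \<omega> assume "diverges \<omega>"
    then have fp: "first_positive (ladder_epoch \<omega>) \<omega>" by (rule ex_first_positive)
    define n where "n = ladder_epoch \<omega>"
    have "?J (psum z n \<omega>) = (\<Sum>k<n. ennreal (z (\<omega> k)) / trunc_mean (psum z n \<omega>))"
      unfolding ennreal_sum_divide[symmetric] psum_def using z_pos by (simp add: sum_ennreal less_imp_le)
    \<comment> \<open>No term exceeds the whole sum and \<open>trunc_mean\<close> is monotone, so
      each denominator can be lowered to the one of its own term.\<close>
    also have "\<dots> \<le> (\<Sum>k<n. ?J (z (\<omega> k)))"
      unfolding psum_def
      by (intro sum_mono ennreal_divide_left_antimono trunc_mean_mono member_le_sum) (auto simp: z_pos less_imp_le)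
    \<comment> \<open>For \<open>k\<close> below the ladder epoch the indicator \<open>?f k\<close>
      equals 1. It is decided by the first \<open>k\<close> steps and therefore independent of
      \<open>\<omega> k\<close>.\<close>
    also have "\<dots> = (\<Sum>k<n. ?f k \<omega> * ?J (z (\<omega> k)))"
      using fp unfolding first_positive_def n_def[symmetric] by (intro sum.cong) (auto simp: not_less)
    also have "\<dots> \<le> (\<Sum>k. ?f k \<omega> * ?J (z (\<omega> k)))"
      by (intro sum_le_suminf) auto
    finally show "?J (psum z (ladder_epoch \<omega>) \<omega>) \<le> (\<Sum>k. ?f k \<omega> * ?J (z (\<omega> k)))"
      by (simp add: n_def)
  qed
  also have "\<dots> = (\<Sum>k. \<integral>\<^sup>+\<omega>. ?f k \<omega> * ?J (z (\<omega> k)) \<partial>S)"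
    by (rule nn_integral_suminf) measurable
  also have "\<dots> = (\<Sum>k. (\<integral>\<^sup>+\<omega>. ?f k \<omega> \<partial>S) * (\<integral>\<^sup>+e. ?J (z e) \<partial>M))"
  proof (rule suminf_cong)
    fix k
    have past: "?f k (comb_seq k \<omega> \<omega>') = ?f k \<omega>" for \<omega> \<omega>'
      by (simp add: psum_comb_seq)
    have m: "?f k \<in> borel_measurable S" "(\<lambda>e. ?J (z e)) \<in> borel_measurable M"
      by measurable
    show "(\<integral>\<^sup>+\<omega>. ?f k \<omega> * ?J (z (\<omega> k)) \<partial>S) = (\<integral>\<^sup>+\<omega>. ?f k \<omega> \<partial>S) * (\<integral>\<^sup>+e. ?J (z e) \<partial>M)"
      by (rule nn_integral_past_times_coordinate[OF m past])
  qed
  also have "\<dots> = (\<Sum>k. \<integral>\<^sup>+\<omega>. ?f k \<omega> \<partial>S) * (\<integral>\<^sup>+e. ?J (z e) \<partial>M)"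
    by simp
  also have "\<dots> < \<infinity>"
    using expected_ladder_epoch_finite[OF drift] fin by (simp add: ennreal_mult_less_top)
  finally show ?thesis .
qed

text \<open>The block after the \<open>n\<close>-th ladder epoch is independent of the height
  reached there. The expected number of such \<open>n\<close> is thus the ladder renewal function
  averaged over twice a block sum, which \<open>ladder_renewal_upper\<close> and
  \<open>ladder_block_moment\<close> show to be finite. The factor 2 saves half of the ladder height
  as exponential damping in the perpetuity.\<close>

lemma AE_ladder_block_le:
  assumes drift: drifts_to_infinity
    and z [measurable]: "z \<in> borel_measurable M" and z_pos: "\<And>e. 0 < z e"
    and fin: "(\<integral>\<^sup>+e. ennreal (z e) / trunc_mean (z e) \<partial>M) < \<infinity>"
  shows "AE \<omega> in S. finite {n. ladder_walk n \<omega> \<le>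
    2 * psum z (ladder_epoch ((ladder_shift ^^ n) \<omega>)) ((ladder_shift ^^ n) \<omega>)}"
proof -
  define G where "G \<omega> = psum z (ladder_epoch \<omega>) \<omega>" for \<omega>
  have [measurable]: "G \<in> borel_measurable S" unfolding G_def[abs_def] by measurable
  have G_pos: "AE \<omega> in S. 0 < G \<omega>"
    using drift
  proof eventually_elim
    fix \<omega> assume "diverges \<omega>"
    then have "0 < ladder_epoch \<omega>" by (rule first_positive_pos[OF ex_first_positive])
    then show "0 < G \<omega>" unfolding G_def psum_def using z_pos by (intro sum_pos) auto
  qed
  let ?h = "\<lambda>n \<omega> \<omega>'. if ladder_walk n \<omega> \<le> 2 * G \<omega>' then 1 else 0 :: ennreal"
  have "(\<Sum>n. \<integral>\<^sup>+\<omega>. ?h n \<omega> ((ladder_shift ^^ n) \<omega>) \<partial>S)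
      = (\<Sum>n. \<integral>\<^sup>+\<omega>. \<integral>\<^sup>+\<omega>'. ?h n \<omega> \<omega>' \<partial>S \<partial>S)"
  proof (rule suminf_cong)
    fix n
    show "(\<integral>\<^sup>+\<omega>. ?h n \<omega> ((ladder_shift ^^ n) \<omega>) \<partial>S)
      = (\<integral>\<^sup>+\<omega>. \<integral>\<^sup>+\<omega>'. ?h n \<omega> \<omega>' \<partial>S \<partial>S)"
      using strong_Markov_ladder_walk[OF drift, of "\<lambda>(h, \<omega>). if h \<le> 2 * G \<omega> then 1 else 0" n]
      by simp
  qed
  also have "\<dots> = (\<Sum>n. \<integral>\<^sup>+\<omega>'. \<integral>\<^sup>+\<omega>. ?h n \<omega> \<omega>' \<partial>S \<partial>S)"
  proof (rule suminf_cong)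
    fix n
    interpret PS: pair_sigma_finite S S by unfold_locales
    show "(\<integral>\<^sup>+\<omega>. \<integral>\<^sup>+\<omega>'. ?h n \<omega> \<omega>' \<partial>S \<partial>S)
      = (\<integral>\<^sup>+\<omega>'. \<integral>\<^sup>+\<omega>. ?h n \<omega> \<omega>' \<partial>S \<partial>S)"
      by (rule PS.Fubini') measurable
  qed
  also have "\<dots> = (\<integral>\<^sup>+\<omega>'. (\<Sum>n. \<integral>\<^sup>+\<omega>. ?h n \<omega> \<omega>' \<partial>S) \<partial>S)"
    by (rule nn_integral_suminf[symmetric]) measurable
  also have "\<dots> \<le> (\<integral>\<^sup>+\<omega>'. 4 * (ennreal (G \<omega>') / trunc_mean (G \<omega>')) \<partial>S)"
  proof (rule nn_integral_mono_AE, use G_pos in eventually_elim)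
    fix \<omega>' assume pos: "0 < G \<omega>'"
    have "(\<Sum>n. \<integral>\<^sup>+\<omega>. ?h n \<omega> \<omega>' \<partial>S)
        \<le> ennreal (2 * (2 * G \<omega>')) / trunc_mean (2 * G \<omega>')"
      using pos by (intro ennreal_le_divideI ladder_renewal_upper drift trunc_mean_finite) auto
    also have "\<dots> \<le> ennreal (2 * (2 * G \<omega>')) / trunc_mean (G \<omega>')"
      using pos by (intro ennreal_divide_left_antimono trunc_mean_mono) auto
    also have "ennreal (2 * (2 * G \<omega>')) = 4 * ennreal (G \<omega>')"
      using pos by (simp add: ennreal_mult' flip: mult.assoc)
    finally show "(\<Sum>n. \<integral>\<^sup>+\<omega>. ?h n \<omega> \<omega>' \<partial>S)
        \<le> 4 * (ennreal (G \<omega>') / trunc_mean (G \<omega>'))"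
      by (simp add: ennreal_times_divide)
  qed
  also have "\<dots> = 4 * (\<integral>\<^sup>+\<omega>'. ennreal (G \<omega>') / trunc_mean (G \<omega>') \<partial>S)"
    by (rule nn_integral_cmult) measurable
  also have "\<dots> < \<infinity>"
    using ladder_block_moment[OF drift z z_pos fin] unfolding G_def by (simp add: ennreal_mult_less_top)
  finally have "AE \<omega> in S. finite {n. ladder_walk n \<omega> \<le> 2 * G ((ladder_shift ^^ n) \<omega>)}"
    by (intro AE_finite_if_suminf_finite) auto
  then show ?thesis unfolding G_def .
qed

lemma geometric_expectation_summable:
  assumes [measurable]: "\<And>n. g n \<in> borel_measurable S"
    and pow: "\<And>n. (\<integral>\<^sup>+\<omega>. g n \<omega> \<partial>S) = \<beta> ^ n" and \<beta>: "\<beta> < 1"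
  shows "AE \<omega> in S. (\<Sum>n. g n \<omega>) < \<infinity>"
proof -
  have "(\<integral>\<^sup>+\<omega>. (\<Sum>n. g n \<omega>) \<partial>S) = (\<Sum>n. \<integral>\<^sup>+\<omega>. g n \<omega> \<partial>S)"
    by (rule nn_integral_suminf) measurable
  also have "\<dots> = (\<Sum>n. \<beta> ^ n)"
    by (simp only: pow)
  also have "\<dots> < \<infinity>"
  proof -
    obtain b where b: "\<beta> = ennreal b" "0 \<le> b" "b < 1"
      using \<beta> by (cases \<beta>) auto
    have "(\<lambda>n. ennreal (b ^ n)) sums ennreal (1 / (1 - b))"
      using geometric_sums[of b] b by (subst sums_ennreal) auto
    then show ?thesis using b by (simp add: ennreal_power sums_iff)
  qed
  finally have "AE \<omega> in S. (\<Sum>n. g n \<omega>) \<noteq> \<infinity>"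
    by (intro nn_integral_PInf_AE) auto
  then show ?thesis by (simp add: less_top)
qed

text \<open>Heights of successive blocks are independent and almost surely positive, so the
  expectations are the powers of a Laplace transform \<open>\<beta> < 1\<close>. The exponent is
  halved because the other half is spent on the block sums.\<close>

lemma AE_summable_exp_ladder_walk:
  assumes drift: drifts_to_infinity
  shows "AE \<omega> in S. (\<Sum>n. ennreal (exp (- ladder_walk n \<omega> / 2))) < \<infinity>"
proof -
  define \<beta> where "\<beta> = (\<integral>\<^sup>+\<omega>. ennreal (exp (- ladder_height \<omega> / 2)) \<partial>S)"
  have \<beta>: "\<beta> < 1"
    unfolding \<beta>_def
  proof (rule P.nn_integral_less_1)
    have lt: "AE \<omega> in S. \<not> 1 \<le> ennreal (exp (- ladder_height \<omega> / 2))"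
      using drift
    proof eventually_elim
      fix \<omega> assume "diverges \<omega>"
      then have "0 < ladder_height \<omega>" by (intro ladder_height_pos ex_first_positive)
      then show "\<not> 1 \<le> ennreal (exp (- ladder_height \<omega> / 2))" by simp
    qed
    show "\<not> (AE \<omega> in S. 1 \<le> ennreal (exp (- ladder_height \<omega> / 2)))"
    proof
      assume "AE \<omega> in S. 1 \<le> ennreal (exp (- ladder_height \<omega> / 2))"
      with lt have "AE \<omega> in S. False" by eventually_elim simp
      then show False by (simp add: P.AE_False)
    qed
  qed (simp_all add: ladder_height_nonneg)
  have pow: "(\<integral>\<^sup>+\<omega>. ennreal (exp (- ladder_walk n \<omega> / 2)) \<partial>S) = \<beta> ^ n" for n
  proof (induction n)
    case (Suc n)
    have "(\<integral>\<^sup>+\<omega>. ennreal (exp (- ladder_walk (Suc n) \<omega> / 2)) \<partial>S)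
        = (\<integral>\<^sup>+\<omega>. ennreal (exp (- ladder_walk n \<omega> / 2)) * ennreal (exp (- ladder_height ((ladder_shift ^^ n) \<omega>) / 2)) \<partial>S)"
      unfolding ladder_walk_Suc_end by (simp add: ennreal_mult'[symmetric] exp_add[symmetric] add_divide_distrib diff_divide_distrib)
    also have "\<dots> = \<beta> ^ n * \<beta>"
      using strong_Markov_ladder_walk[OF drift,
        of "\<lambda>(h, \<omega>). ennreal (exp (- h / 2)) * ennreal (exp (- ladder_height \<omega> / 2))" n] Suc
      by (simp add: nn_integral_cmult nn_integral_multc \<beta>_def)
    finally show ?case by (simp add: mult.commute)
  qed (simp add: P.emeasure_space_1)
  show ?thesis by (rule geometric_expectation_summable[OF _ pow \<beta>]) measurable
qed

end

section \<open>Perpetuities\<close>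

lemma suminf_indicator_le_1:
  assumes "\<And>i j. P i \<Longrightarrow> P j \<Longrightarrow> i = j"
  shows "(\<Sum>n. if P n then 1 else 0 :: ennreal) \<le> 1"
proof (cases "\<exists>i. P i")
  case True
  then obtain i where "P i" by auto
  then have "P n \<longleftrightarrow> n = i" for n using assms by auto
  then have "(\<Sum>n. if P n then 1 else 0 :: ennreal) = 1" by (rule suminf_indicator_unique)
  then show ?thesis by simp
qed simp

lemma filterlim_at_top_if_finite_below:
  fixes s :: "nat \<Rightarrow> real"
  assumes "\<And>b :: nat. finite {n. s n \<le> real b}"
  shows "filterlim s at_top sequentially"
  unfolding filterlim_at_top
proof
  fix Z
  obtain b :: nat where b: "Z \<le> real b" using real_arch_simple by blast
  have "eventually (\<lambda>n. n \<notin> {n. s n \<le> real b}) sequentially"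
    using assms[of b] by (metis cofinite_eq_sequentially eventually_cofinite mem_Collect_eq not_not Collect_cong)
  then show "eventually (\<lambda>n. Z \<le> s n) sequentially"
    using b by (auto elim: eventually_mono)
qed

context random_walk
begin

lemma not_AE_nonpos_if_drifts:
  assumes drift: drifts_to_infinity
  shows "\<not> (AE e in M. \<xi> e \<le> 0)"
proof
  assume "AE e in M. \<xi> e \<le> 0"
  then have "AE \<omega> in S. \<forall>k. \<xi> (\<omega> k) \<le> 0"
    by (auto simp: AE_all_countable intro!: AE_component)
  with drift have "AE \<omega> in S. False"
  proof eventually_elim
    case (elim \<omega>)
    then have "\<forall>\<^sub>F n in sequentially. 0 < psum \<xi> n \<omega>" by (simp add: filterlim_at_top_dense)
    then obtain n where "0 < psum \<xi> n \<omega>" by (metis eventually_sequentially order_refl)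
    moreover have "psum \<xi> n \<omega> \<le> 0" unfolding psum_def using elim by (intro sum_nonpos) auto
    ultimately show False by simp
  qed
  then show False by (simp add: P.AE_False)
qed

lemma trunc_mean_pos:
  assumes "\<not> (AE e in M. \<xi> e \<le> 0)" and "0 < x"
  shows "trunc_mean x \<noteq> 0"
proof
  assume "trunc_mean x = 0"
  then have "AE e in M. ennreal (min (max (\<xi> e) 0) x) = 0"
    unfolding trunc_mean_def by (subst (asm) nn_integral_0_iff_AE) auto
  then have "AE e in M. \<xi> e \<le> 0"
    by eventually_elim (use \<open>0 < x\<close> in \<open>auto simp: ennreal_eq_0_iff min_def max_def split: if_splits\<close>)
  with assms show False by simp
qed

text \<open>For \<open>r \<ge> 0\<close> the function \<open>min r x\<close> is concave in
  \<open>x\<close> and vanishes at 0, so its quotient by \<open>x\<close> decreases; the mean over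
  the steps inherits this.\<close>

lemma divide_trunc_mean_mono:
  assumes "\<not> (AE e in M. \<xi> e \<le> 0)" and x: "0 < x" "x \<le> y"
  shows "ennreal x / trunc_mean x \<le> ennreal y / trunc_mean y"
proof (rule ennreal_le_divideI)
  have "ennreal x * trunc_mean y \<le> ennreal y * trunc_mean x"
  proof -
    have "x * min (max r 0) y \<le> y * min (max r 0) x" for r :: real
    proof -
      have "x * max r 0 \<le> y * max r 0" "x * y \<le> y * x" "min (max r 0) y = max r 0 \<or> min (max r 0) y = y"
        "min (max r 0) x = max r 0 \<or> min (max r 0) x = x" "x \<le> max r 0 \<Longrightarrow> x * y \<le> max r 0 * y" "y \<le> max r 0 \<Longrightarrow> x * y \<le> x * max r 0"
        using x by (auto intro!: mult_right_mono mult_left_mono)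
      then show ?thesis using x by (auto simp: min_def max_def mult.commute mult_left_mono split: if_splits)
    qed
    then show ?thesis
      unfolding trunc_mean_def using x
      by (subst (1 2) nn_integral_cmult[symmetric])
        (auto intro!: nn_integral_mono ennreal_leI simp: ennreal_mult'[symmetric])
  qed
  then have "ennreal x * trunc_mean y / trunc_mean x \<le> ennreal y * trunc_mean x / trunc_mean x"
    by (rule divide_right_mono_ennreal)
  also have "\<dots> = ennreal y"
    using trunc_mean_pos[OF assms(1) x(1)] trunc_mean_finite[of x] by (simp add: ennreal_mult_divide_eq)
  finally show "ennreal x / trunc_mean x * trunc_mean y \<le> ennreal y"
    by (simp add: ennreal_times_divide mult.commute)
qed (use x trunc_mean_finite in auto)

text \<open>Since \<open>exp (- \<xi>) \<le> w\<close>, every fall of the walk is paid for by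
  \<open>ln w\<close>: each term is at most the exponential of the sum of the positive parts of
  \<open>ln w\<close> over the block. The number of terms is at most \<open>l \<le> 2 ^ l\<close>,
  and this factor is spread over the block as one \<open>ln 2\<close> per step.\<close>

lemma ladder_block_sum_le:
  assumes w: "\<And>k. exp (- \<xi> (\<omega> k)) \<le> w (\<omega> k)" and "n \<le> l"
  shows "(\<Sum>k<n. exp (- psum \<xi> k \<omega>) * w (\<omega> k)) \<le> exp (psum (\<lambda>e. ln 2 + max 0 (ln (w e))) l \<omega>)"
proof -
  let ?s = "\<lambda>\<omega> k. exp (- psum \<xi> k \<omega>) * w (\<omega> k)"
  let ?p = "psum (\<lambda>e. max 0 (ln (w e))) l \<omega>"
  have w_pos: "0 < w (\<omega> k)" for k using w[of k] by (meson exp_gt_zero less_le_trans)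
  have ln: "- \<xi> (\<omega> k) \<le> max 0 (ln (w (\<omega> k)))" for k
    using w[of k] w_pos[of k] by (simp add: ln_ge_iff le_max_iff_disj)
  have le: "?s \<omega> k \<le> exp ?p" if "k < n" for k
  proof -
    have "- psum \<xi> k \<omega> \<le> psum (\<lambda>e. max 0 (ln (w e))) k \<omega>"
      unfolding psum_def sum_negf[symmetric] by (intro sum_mono ln)
    then have "- psum \<xi> k \<omega> + ln (w (\<omega> k)) \<le> psum (\<lambda>e. max 0 (ln (w e))) (Suc k) \<omega>"
      unfolding psum_Suc by linarith
    also have "\<dots> \<le> ?p"
      unfolding psum_def using that \<open>n \<le> l\<close> by (intro sum_mono2) auto
    finally have "exp (- psum \<xi> k \<omega> + ln (w (\<omega> k))) \<le> exp ?p" by simp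
    then show ?thesis using w_pos[of k] by (simp only: exp_add exp_ln)
  qed
  have "(\<Sum>k<n. ?s \<omega> k) \<le> real n * exp ?p"
    using sum_bounded_above[of "{..<n}" "\<lambda>k. ?s \<omega> k" "exp ?p"] le by simp
  also have "\<dots> \<le> 2 ^ l * exp ?p"
  proof (rule mult_right_mono)
    have "real n \<le> real l" using \<open>n \<le> l\<close> by simp
    also have "\<dots> \<le> 2 ^ l" using of_nat_less_two_power[of l, where 'a = real] by simp
    finally show "real n \<le> 2 ^ l" .
  qed simp
  also have "\<dots> = exp (psum (\<lambda>e. ln 2 + max 0 (ln (w e))) l \<omega>)"
    by (simp add: psum_def sum.distrib exp_add exp_of_nat_mult)
  finally show ?thesis .
qed

text \<open>The terms are grouped by ladder blocks: a block carries the factor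
  \<open>exp (- ladder_walk j \<omega>)\<close> from its starting level, and
  \<open>ladder_block_sum_le\<close> bounds the rest. Blocks are nonempty, so \<open>n\<close> terms
  lie in the first \<open>n\<close> blocks.\<close>

lemma perpetuity_le_ladder_sum:
  assumes "\<And>k. exp (- \<xi> (\<omega> k)) \<le> w (\<omega> k)"
    and "\<And>n. first_positive (ladder_epoch ((ladder_shift ^^ n) \<omega>)) ((ladder_shift ^^ n) \<omega>)"
  shows "(\<Sum>k<n. exp (- psum \<xi> k \<omega>) * w (\<omega> k)) \<le> (\<Sum>j<n. exp (- ladder_walk j \<omega>) *
    exp (psum (\<lambda>e. ln 2 + max 0 (ln (w e))) (ladder_epoch ((ladder_shift ^^ j) \<omega>)) ((ladder_shift ^^ j) \<omega>)))"
  using assms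
proof (induction n arbitrary: \<omega>)
  case (Suc n)
  let ?s = "\<lambda>\<omega> k. exp (- psum \<xi> k \<omega>) * w (\<omega> k)"
  define z where "z = (\<lambda>e. ln 2 + max 0 (ln (w e)))"
  define l where "l = ladder_epoch \<omega>"
  define \<theta> where "\<theta> = ladder_shift \<omega>"
  define B where "B j \<omega> = exp (- ladder_walk j \<omega>) * exp (psum z (ladder_epoch ((ladder_shift ^^ j) \<omega>)) ((ladder_shift ^^ j) \<omega>))" for j \<omega>
  have fp: "first_positive l \<omega>" using Suc.prems(2)[of 0] by (simp add: l_def)
  then have l: "0 < l" by (rule first_positive_pos)
  have H: "ladder_height \<omega> = psum \<xi> l \<omega>"
    using fp by (simp add: ladder_height_def l_def first_positive_def)
  have IH: "(\<Sum>k<n. ?s \<theta> k) \<le> (\<Sum>j<n. B j \<theta>)"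
    unfolding B_def z_def
  proof (rule Suc.IH)
    show "exp (- \<xi> (\<theta> k)) \<le> w (\<theta> k)" for k
      using Suc.prems(1) by (simp add: \<theta>_def ladder_shift_def)
    show "first_positive (ladder_epoch ((ladder_shift ^^ n) \<theta>)) ((ladder_shift ^^ n) \<theta>)" for n
      using Suc.prems(2)[of "Suc n"] by (simp only: \<theta>_def funpow_Suc_right o_apply)
  qed
  have w_pos: "0 \<le> w (\<omega> k)" for k using Suc.prems(1)[of k] by (meson exp_ge_zero order_trans)
  have B0: "B 0 \<omega> = exp (psum z l \<omega>)" by (simp add: B_def l_def)
  have BS: "B (Suc j) \<omega> = exp (- psum \<xi> l \<omega>) * B j \<theta>" for j
    by (simp add: B_def H \<theta>_def exp_diff exp_minus field_simps funpow_swap1 del: funpow.simps(2) add: funpow_Suc_right)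
  have B_nonneg: "0 \<le> B j \<omega>" for j \<omega> by (simp add: B_def)
  have Bsum: "(\<Sum>j<Suc n. B j \<omega>) = exp (psum z l \<omega>) + exp (- psum \<xi> l \<omega>) * (\<Sum>j<n. B j \<theta>)"
    by (simp add: sum.lessThan_Suc_shift B0 BS sum_distrib_left del: sum.lessThan_Suc)
  have "(\<Sum>k<Suc n. ?s \<omega> k) \<le> (\<Sum>j<Suc n. B j \<omega>)"
  proof (cases "Suc n \<le> l")
    case True
    have "(\<Sum>k<Suc n. ?s \<omega> k) \<le> exp (psum z l \<omega>)"
      unfolding z_def by (rule ladder_block_sum_le) (rule Suc.prems(1), rule True)
    also have "\<dots> \<le> (\<Sum>j<Suc n. B j \<omega>)"
      unfolding Bsum using B_nonneg by (simp add: sum_nonneg)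
    finally show ?thesis .
  next
    case False
    \<comment> \<open>The \<open>r\<close> terms behind the first block belong to the shifted path.
      They are at most \<open>n\<close> in number because \<open>l > 0\<close>, so the induction
      hypothesis covers them.\<close>
    then obtain r where r: "Suc n = l + r" by (metis le_add_diff_inverse nat_le_linear)
    then have rn: "r \<le> n" using l by simp
    have split: "(\<Sum>k<l + r. ?s \<omega> k)
        = (\<Sum>k<l. ?s \<omega> k) + exp (- psum \<xi> l \<omega>) * (\<Sum>k<r. ?s \<theta> k)"
      for r
    proof (induction r)
      case (Suc r)
      have "exp (- psum \<xi> (l + r) \<omega>) * w (\<omega> (l + r)) = exp (- psum \<xi> l \<omega>) * (exp (- psum \<xi> r \<theta>) * w (\<theta> r))"
      proof -
        have "psum \<xi> (l + r) \<omega> = psum \<xi> l \<omega> + psum \<xi> r \<theta>" "\<omega> (l + r) = \<theta> r"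
          by (simp_all add: psum_add \<theta>_def ladder_shift_def l_def)
        then show ?thesis by (simp add: exp_add[symmetric] mult.assoc[symmetric])
      qed
      then show ?case using Suc by (simp add: distrib_left)
    qed simp
    have "(\<Sum>k<r. ?s \<theta> k) \<le> (\<Sum>k<n. ?s \<theta> k)"
      using rn w_pos by (intro sum_mono2) (auto simp: \<theta>_def ladder_shift_def)
    also note IH
    finally show ?thesis
      unfolding Bsum unfolding r split using ladder_block_sum_le[where \<omega> = \<omega> and w = w, OF Suc.prems(1) order_refl, of l]
      by (intro add_mono mult_left_mono) (auto simp: z_def)
  qed
  then show ?case unfolding B_def z_def .
qed simp

text \<open>All but finitely many blocks have a block sum below half of the ladder height at their
  start and are dominated by the summable \<open>exp (- ladder_walk j \<omega> / 2)\<close>. The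
  finitely many others contribute at most \<open>C\<close>.\<close>

theorem AE_perpetuity_bounded:
  assumes drift: drifts_to_infinity
    and w [measurable]: "w \<in> borel_measurable M"
    and w_ge: "AE e in M. exp (- \<xi> e) \<le> w e"
    and fin: "(\<integral>\<^sup>+e. ennreal (max 0 (ln (w e))) / trunc_mean (max 0 (ln (w e))) \<partial>M) < \<infinity>"
  shows "AE \<omega> in S. \<exists>C. \<forall>n. (\<Sum>k<n. exp (- psum \<xi> k \<omega>) * w (\<omega> k)) \<le> C"
proof -
  let ?s = "\<lambda>\<omega> k. exp (- psum \<xi> k \<omega>) * w (\<omega> k)"
  define z where "z = (\<lambda>e. ln 2 + max 0 (ln (w e)))"
  have z [measurable]: "z \<in> borel_measurable M" unfolding z_def by measurable
  have z_pos: "0 < z e" for e by (simp add: z_def add_pos_nonneg)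
  \<comment> \<open>The additional \<open>ln 2\<close> costs only the constant
    \<open>ln 2 / trunc_mean (ln 2)\<close>, which is finite because a drifting walk has positive
    steps.\<close>
  have z_fin: "(\<integral>\<^sup>+e. ennreal (z e) / trunc_mean (z e) \<partial>M) < \<infinity>"
  proof -
    have "(\<integral>\<^sup>+e. ennreal (z e) / trunc_mean (z e) \<partial>M)
        \<le> (\<integral>\<^sup>+e. ennreal (ln 2) / trunc_mean (ln 2) + ennreal (max 0 (ln (w e))) / trunc_mean (max 0 (ln (w e))) \<partial>M)"
    proof (rule nn_integral_mono)
      fix e
      have "ennreal (z e) / trunc_mean (z e)
          = ennreal (ln 2) / trunc_mean (z e) + ennreal (max 0 (ln (w e))) / trunc_mean (z e)"
        unfolding z_def by (simp add: ennreal_plus add_divide_distrib_ennreal del: ennreal_plus[symmetric])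
      also have "\<dots> \<le> ennreal (ln 2) / trunc_mean (ln 2) + ennreal (max 0 (ln (w e))) / trunc_mean (max 0 (ln (w e)))"
        by (intro add_mono ennreal_divide_left_antimono trunc_mean_mono) (auto simp: z_def)
      finally show "ennreal (z e) / trunc_mean (z e) \<le> \<dots>" .
    qed
    also have "\<dots> = ennreal (ln 2) / trunc_mean (ln 2) +
        (\<integral>\<^sup>+e. ennreal (max 0 (ln (w e))) / trunc_mean (max 0 (ln (w e))) \<partial>M)"
      by (subst nn_integral_add) (auto simp: M.emeasure_space_1)
    also have "\<dots> < \<infinity>"
      using fin trunc_mean_pos[OF not_AE_nonpos_if_drifts[OF drift], of "ln 2"]
      by (simp add: less_top[symmetric] ennreal_divide_eq_top_iff)
    finally show ?thesis .
  qed
  have w_all: "AE \<omega> in S. \<forall>k. exp (- \<xi> (\<omega> k)) \<le> w (\<omega> k)"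
    using w_ge by (auto simp: AE_all_countable intro!: AE_component)
  show ?thesis
    using w_all AE_first_positive_iterate[OF drift] AE_summable_exp_ladder_walk[OF drift]
      AE_ladder_block_le[OF drift z z_pos z_fin]
  proof eventually_elim
    case (elim \<omega>)
    define G where "G j = psum z (ladder_epoch ((ladder_shift ^^ j) \<omega>)) ((ladder_shift ^^ j) \<omega>)" for j
    define F where "F = {j. ladder_walk j \<omega> \<le> 2 * G j}"
    have F: "finite F" using elim(4) by (simp add: F_def G_def)
    define C where "C = (\<Sum>j\<in>F. exp (- ladder_walk j \<omega>) * exp (G j))"
    define D where "D = (\<Sum>n. ennreal (exp (- ladder_walk n \<omega> / 2)))"
    have D: "D < \<infinity>" using elim(3) by (simp add: D_def)
    have "(\<Sum>k<n. ?s \<omega> k) \<le> C + enn2real D" for n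
    proof -
      have "(\<Sum>k<n. ?s \<omega> k) \<le> (\<Sum>j<n. exp (- ladder_walk j \<omega>) * exp (G j))"
        unfolding G_def z_def using elim(1,2) by (intro perpetuity_le_ladder_sum) auto
      also have "\<dots> \<le> (\<Sum>j<n. (if j \<in> F then exp (- ladder_walk j \<omega>) * exp (G j) else 0) + exp (- ladder_walk j \<omega> / 2))"
      proof (rule sum_mono)
        fix j
        have "exp (- ladder_walk j \<omega>) * exp (G j) \<le> exp (- ladder_walk j \<omega> / 2)" if "j \<notin> F"
          using that unfolding F_def by (simp add: exp_add[symmetric])
        then show "exp (- ladder_walk j \<omega>) * exp (G j)
            \<le> (if j \<in> F then exp (- ladder_walk j \<omega>) * exp (G j) else 0) + exp (- ladder_walk j \<omega> / 2)"
          by auto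
      qed
      also have "\<dots> = (\<Sum>j\<in>{..<n} \<inter> F. exp (- ladder_walk j \<omega>) * exp (G j)) + (\<Sum>j<n. exp (- ladder_walk j \<omega> / 2))"
        by (simp add: sum.distrib sum.inter_restrict)
      also have "\<dots> \<le> C + enn2real D"
      proof (rule add_mono)
        show "(\<Sum>j\<in>{..<n} \<inter> F. exp (- ladder_walk j \<omega>) * exp (G j)) \<le> C"
          unfolding C_def using F by (intro sum_mono2) auto
        have "(\<Sum>j<n. ennreal (exp (- ladder_walk j \<omega> / 2))) \<le> D"
          unfolding D_def by (rule sum_le_suminf) auto
        then have "ennreal (\<Sum>j<n. exp (- ladder_walk j \<omega> / 2)) \<le> D"
          by simp
        then have "enn2real (ennreal (\<Sum>j<n. exp (- ladder_walk j \<omega> / 2))) \<le> enn2real D"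
          using D by (intro enn2real_mono) auto
        then show "(\<Sum>j<n. exp (- ladder_walk j \<omega> / 2)) \<le> enn2real D"
          by (simp add: sum_nonneg)
      qed
      finally show ?thesis .
    qed
    then show ?case by blast
  qed
qed

section \<open>Walks bounded from below\<close>

text \<open>Each visit below \<open>b\<close> is followed, independently of the past, by a step of
  at most \<open>- \<epsilon>\<close> with probability \<open>\<delta> > 0\<close>. Hence infinitely
  many visits cannot all fail to be followed by such a step.\<close>

lemma infinitely_often_below_step:
  assumes \<epsilon>: "\<not> (AE e in M. - \<epsilon> < \<xi> e)"
  shows "AE \<omega> in S. infinite {n. psum \<xi> n \<omega> \<le> b} \<longrightarrow> infinite {n. psum \<xi> n \<omega> \<le> b - \<epsilon>}"
proof -
  define \<delta> where "\<delta> = (\<integral>\<^sup>+e. (if \<xi> e \<le> - \<epsilon> then 1 else 0) \<partial>M)"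
  have \<delta>: "\<delta> \<noteq> 0"
  proof
    assume "\<delta> = 0"
    then have "AE e in M. (if \<xi> e \<le> - \<epsilon> then 1 else 0 :: ennreal) = 0"
      unfolding \<delta>_def by (subst (asm) nn_integral_0_iff_AE) auto
    then have "AE e in M. - \<epsilon> < \<xi> e" by eventually_elim (auto split: if_splits)
    with \<epsilon> show False by simp
  qed
  \<comment> \<open>\<open>P m k\<close> marks the visits below \<open>b\<close> from time
    \<open>m\<close> on, up to and including the first one followed by a large downward step. Such a
    step follows at most one marked visit, so the expected number of marked visits times
    \<open>\<delta>\<close> is at most 1.\<close>
  define P where "P m k \<omega> \<longleftrightarrow> m \<le> k \<and> psum \<xi> k \<omega> \<le> b \<and>
    (\<forall>j<k. \<not> (m \<le> j \<and> psum \<xi> j \<omega> \<le> b \<and> \<xi> (\<omega> j) \<le> - \<epsilon>))" for m k \<omega>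
  have [measurable]: "Measurable.pred S (P m k)" for m k
    unfolding P_def[abs_def] by measurable
  have "AE \<omega> in S. finite {k. P m k \<omega>}" for m
  proof -
    let ?p = "\<lambda>k \<omega>. if P m k \<omega> then 1 else 0 :: ennreal"
    let ?q = "\<lambda>e. if \<xi> e \<le> - \<epsilon> then 1 else 0 :: ennreal"
    have "(\<Sum>k. \<integral>\<^sup>+\<omega>. ?p k \<omega> \<partial>S) * \<delta>
        = (\<Sum>k. (\<integral>\<^sup>+\<omega>. ?p k \<omega> \<partial>S) * \<delta>)"
      by simp
    also have "\<dots> = (\<Sum>k. \<integral>\<^sup>+\<omega>. ?p k \<omega> * ?q (\<omega> k) \<partial>S)"
    proof (rule suminf_cong)
      fix k
      have past: "?p k (comb_seq k \<omega> \<omega>') = ?p k \<omega>" for \<omega> \<omega>'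
      proof -
        have "comb_seq k \<omega> \<omega>' j = \<omega> j" if "j < k" for j using that by (simp add: comb_seq_def)
        then show ?thesis unfolding P_def by (simp add: psum_comb_seq cong: conj_cong)
      qed
      show "(\<integral>\<^sup>+\<omega>. ?p k \<omega> \<partial>S) * \<delta>
        = (\<integral>\<^sup>+\<omega>. ?p k \<omega> * ?q (\<omega> k) \<partial>S)"
        unfolding \<delta>_def
        using nn_integral_past_times_coordinate[of "\<lambda>\<omega>. if P m k \<omega> then 1 else 0"
            "\<lambda>e. if \<xi> e \<le> - \<epsilon> then 1 else 0" k] past
        by simp
    qed
    also have "\<dots> = (\<integral>\<^sup>+\<omega>. (\<Sum>k. ?p k \<omega> * ?q (\<omega> k)) \<partial>S)"
      by (rule nn_integral_suminf[symmetric]) measurable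
    also have "\<dots> \<le> (\<integral>\<^sup>+\<omega>. 1 \<partial>S)"
    proof (rule nn_integral_mono)
      fix \<omega>
      have "?p k \<omega> * ?q (\<omega> k)
          = (if P m k \<omega> \<and> \<xi> (\<omega> k) \<le> - \<epsilon> then 1 else 0)" for k
        by simp
      moreover have "i = j" if "P m i \<omega> \<and> \<xi> (\<omega> i) \<le> - \<epsilon>" "P m j \<omega> \<and> \<xi> (\<omega> j) \<le> - \<epsilon>" for i j
        using that unfolding P_def by (meson linorder_neqE_nat)
      ultimately show "(\<Sum>k. ?p k \<omega> * ?q (\<omega> k)) \<le> 1"
        using suminf_indicator_le_1[of "\<lambda>k. P m k \<omega> \<and> \<xi> (\<omega> k) \<le> - \<epsilon>"] by (simp only:)
    qed
    also have "\<dots> = 1" by (simp add: P.emeasure_space_1)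
    finally have "(\<Sum>k. \<integral>\<^sup>+\<omega>. ?p k \<omega> \<partial>S) \<noteq> \<infinity>"
      using \<delta> by (auto simp: ennreal_top_mult top_unique)
    then show ?thesis by (intro AE_finite_if_suminf_finite) auto
  qed
  then have "AE \<omega> in S. \<forall>m. finite {k. P m k \<omega>}" by (simp add: AE_all_countable)
  then show ?thesis
  proof eventually_elim
    case (elim \<omega>)
    show ?case
    proof (intro impI notI)
      assume inf: "infinite {n. psum \<xi> n \<omega> \<le> b}" and "finite {n. psum \<xi> n \<omega> \<le> b - \<epsilon>}"
      then obtain m where m: "\<And>n. psum \<xi> n \<omega> \<le> b - \<epsilon> \<Longrightarrow> n \<le> m"
        unfolding finite_nat_set_iff_bounded_le by auto
      \<comment> \<open>Such a step at a time \<open>j \<ge> m\<close> would put the walk at or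
        below \<open>b - \<epsilon>\<close> at time \<open>Suc j > m\<close>. Hence
        \<open>P m\<close> marks every visit below \<open>b\<close> from \<open>m\<close>
        on.\<close>
      have no: "\<not> (m \<le> j \<and> psum \<xi> j \<omega> \<le> b \<and> \<xi> (\<omega> j) \<le> - \<epsilon>)" for j
        using m[of "Suc j"] by (auto simp: psum_Suc)
      have "{n. psum \<xi> n \<omega> \<le> b} \<subseteq> {..<m} \<union> {k. P m k \<omega>}"
        using no unfolding P_def by auto
      then have "finite {n. psum \<xi> n \<omega> \<le> b}"
        using elim finite_subset by blast
      with inf show False by simp
    qed
  qed
qed

text \<open>If steps of at most \<open>- \<epsilon>\<close> have positive probability, infinitely
  many visits below some level would entail infinitely many below every lower level, against the
  bound. If the steps are nonnegative, nontriviality makes the mean of \<open>exp (- \<xi>)\<close>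
  less than 1, and \<open>exp (- psum \<xi> n \<omega>)\<close> is summable in
  \<open>n\<close>.\<close>

theorem drifts_if_bounded_below:
  assumes bdd: "AE \<omega> in S. \<exists>c. \<forall>n. c \<le> psum \<xi> n \<omega>"
    and nontrivial: "\<not> (AE e in M. \<xi> e = 0)"
  shows drifts_to_infinity
proof (cases "AE e in M. 0 \<le> \<xi> e")
  case False
  obtain \<epsilon> where \<epsilon>: "\<epsilon> > 0" "\<not> (AE e in M. - \<epsilon> < \<xi> e)"
  proof (rule ccontr)
    assume "\<not> thesis"
    then have "AE e in M. - (1 / real (Suc n)) < \<xi> e" for n
      using that[of "1 / real (Suc n)"] by auto
    then have "AE e in M. \<forall>n. - (1 / real (Suc n)) < \<xi> e" by (simp add: AE_all_countable)
    then have "AE e in M. 0 \<le> \<xi> e"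
    proof eventually_elim
      case (elim e)
      show ?case
      proof (rule ccontr)
        assume "\<not> 0 \<le> \<xi> e"
        then obtain n where "inverse (real (Suc n)) < - \<xi> e"
          using reals_Archimedean[of "- \<xi> e"] by auto
        then show False using elim[rule_format, of n] by (simp add: inverse_eq_divide)
      qed
    qed
    with False show False by simp
  qed
  have step: "AE \<omega> in S. infinite {n. psum \<xi> n \<omega> \<le> b} \<longrightarrow> infinite {n. psum \<xi> n \<omega> \<le> b - real j * \<epsilon>}" for b j
  proof (induction j)
    case (Suc j)
    then show ?case
      using infinitely_often_below_step[OF \<epsilon>(2), of "b - real j * \<epsilon>"]
      by eventually_elim (simp add: algebra_simps)
  qed simp
  have "AE \<omega> in S. \<forall>b :: nat. \<forall>j. infinite {n. psum \<xi> n \<omega> \<le> real b} \<longrightarrow> infinite {n. psum \<xi> n \<omega> \<le> real b - real j * \<epsilon>}"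
    by (simp only: AE_all_countable) (intro allI step)
  with bdd show ?thesis
  proof eventually_elim
    case (elim \<omega>)
    then obtain c where c: "\<And>n. c \<le> psum \<xi> n \<omega>" by auto
    show ?case
    proof (rule filterlim_at_top_if_finite_below, rule ccontr)
      fix b :: nat assume inf: "infinite {n. psum \<xi> n \<omega> \<le> real b}"
      obtain j :: nat where j: "(real b - c) / \<epsilon> < real j" using reals_Archimedean2 by blast
      then have "real b - real j * \<epsilon> < c" using \<epsilon>(1) by (simp add: divide_less_eq)
      moreover have "infinite {n. psum \<xi> n \<omega> \<le> real b - real j * \<epsilon>}" using elim(2) inf by blast
      then obtain n where "psum \<xi> n \<omega> \<le> real b - real j * \<epsilon>"
        by (metis (mono_tags, lifting) Collect_empty_eq finite.emptyI)
      ultimately show False using c[of n] by linarith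
    qed
  qed
next
  case True
  define \<beta> where "\<beta> = (\<integral>\<^sup>+e. ennreal (exp (- \<xi> e)) \<partial>M)"
  have \<beta>: "\<beta> < 1"
    unfolding \<beta>_def
  proof (rule M.nn_integral_less_1)
    show "AE e in M. ennreal (exp (- \<xi> e)) \<le> 1"
      using True by eventually_elim simp
    show "\<not> (AE e in M. 1 \<le> ennreal (exp (- \<xi> e)))"
    proof
      assume "AE e in M. 1 \<le> ennreal (exp (- \<xi> e))"
      with True have "AE e in M. \<xi> e = 0" by eventually_elim simp
      with nontrivial show False by simp
    qed
  qed simp
  have "(\<integral>\<^sup>+\<omega>. ennreal (exp (- psum \<xi> n \<omega>)) \<partial>S) = \<beta> ^ n" for n
  proof (induction n)
    case (Suc n)
    have "(\<integral>\<^sup>+\<omega>. ennreal (exp (- psum \<xi> (Suc n) \<omega>)) \<partial>S)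
        = (\<integral>\<^sup>+\<omega>. ennreal (exp (- psum \<xi> n \<omega>)) * ennreal (exp (- \<xi> (\<omega> n))) \<partial>S)"
      by (simp add: psum_Suc ennreal_mult'[symmetric] exp_add[symmetric])
    also have "\<dots> = \<beta> ^ n * \<beta>"
      unfolding \<beta>_def Suc[symmetric, unfolded \<beta>_def]
      by (rule nn_integral_past_times_coordinate) (auto simp: psum_comb_seq)
    finally show ?case by (simp add: mult.commute)
  qed (simp add: P.emeasure_space_1)
  then have "AE \<omega> in S. (\<Sum>n. ennreal (exp (- psum \<xi> n \<omega>))) < \<infinity>"
    by (rule geometric_expectation_summable[OF _ _ \<beta>, rotated]) measurable
  then show ?thesis
  proof eventually_elim
    case (elim \<omega>)
    then have "summable (\<lambda>n. exp (- psum \<xi> n \<omega>))"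
      by (intro summable_suminf_not_top) (auto simp: less_top)
    then have "(\<lambda>n. exp (- psum \<xi> n \<omega>)) \<longlonglongrightarrow> 0" by (rule summable_LIMSEQ_zero)
    then show ?case by (simp only: exp_uminus_tendsto_0_iff)
  qed
qed

section \<open>Necessity of the moment condition\<close>

text \<open>This walk never decreases, which the restart argument requires. It dominates the
  original walk, so its exceedances are fewer, and it has the same
  \<open>trunc_mean\<close>.\<close>

abbreviation "pos_walk \<equiv> psum (\<lambda>e. max 0 (\<xi> e))"

text \<open>
  By monotonicity of \<open>pos_walk\<close>, once an exceedance has occurred, the later ones are stochastically
  fewer than the exceedances of a fresh copy of the process. Hence \<open>u \<le> p (1 + u)\<close> for the expected
  number \<open>u\<close> of exceedances and the probability \<open>p\<close> that there is one.
\<close>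

lemma expected_exceedances_finite:
  assumes \<zeta> [measurable]: "\<zeta> \<in> borel_measurable M"
    and p: "(\<integral>\<^sup>+\<omega>. (if \<exists>n. pos_walk n \<omega> + c < \<zeta> (\<omega> n) then 1 else 0) \<partial>S) < 1"
  shows "(\<Sum>n. \<integral>\<^sup>+\<omega>. (if pos_walk n \<omega> + c < \<zeta> (\<omega> n) then 1 else 0) \<partial>S) < \<infinity>"
proof -
  define p' where "p' = (\<integral>\<^sup>+\<omega>. (if \<exists>n. pos_walk n \<omega> + c < \<zeta> (\<omega> n) then 1 else 0) \<partial>S)"
  define E where "E n \<omega> \<longleftrightarrow> pos_walk n \<omega> + c < \<zeta> (\<omega> n)" for n \<omega>
  define F where "F n \<omega> \<longleftrightarrow> E n \<omega> \<and> (\<forall>j<n. \<not> E j \<omega>)" for n \<omega>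
  let ?f = "\<lambda>n \<omega>. if F n \<omega> then 1 else 0 :: ennreal"
  let ?e = "\<lambda>n \<omega>. if E n \<omega> then 1 else 0 :: ennreal"
  have [measurable]: "Measurable.pred S (E n)" for n unfolding E_def[abs_def] by measurable
  have [measurable]: "Measurable.pred S (F n)" for n unfolding F_def[abs_def] by measurable
  define PE where "PE n = (\<integral>\<^sup>+\<omega>. ?e n \<omega> \<partial>S)" for n
  define PF where "PF n = (\<integral>\<^sup>+\<omega>. ?f n \<omega> \<partial>S)" for n
  have PE_le: "PE n \<le> 1" for n
  proof -
    have "PE n \<le> (\<integral>\<^sup>+\<omega>. 1 \<partial>S)" unfolding PE_def by (intro nn_integral_mono) auto
    then show ?thesis by (simp add: P.emeasure_space_1)
  qed
  have PF_sum: "(\<Sum>n. PF n) \<le> p'"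
  proof -
    have "(\<Sum>n. PF n) = (\<integral>\<^sup>+\<omega>. (\<Sum>n. if F n \<omega> then 1 else 0) \<partial>S)"
      unfolding PF_def by (rule nn_integral_suminf[symmetric]) measurable
    also have "\<dots> \<le> p'"
      unfolding p'_def
    proof (rule nn_integral_mono)
      fix \<omega>
      have "(\<Sum>n. ?f n \<omega>) \<le> 1"
        by (rule suminf_indicator_le_1) (meson F_def linorder_neqE_nat)
      moreover have "(\<Sum>n. ?f n \<omega>) = 0" if "\<not> (\<exists>n. E n \<omega>)"
        using that by (simp add: F_def)
      ultimately show "(\<Sum>n. ?f n \<omega>)
          \<le> (if \<exists>n. pos_walk n \<omega> + c < \<zeta> (\<omega> n) then 1 else 0)"
        unfolding E_def[symmetric] by auto
    qed
    finally show ?thesis .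
  qed
  have joint: "(\<integral>\<^sup>+\<omega>. ?f j \<omega> * ?e k \<omega> \<partial>S) \<le> PF j * PE (k - Suc j)" if "j < k" for j k
  proof -
    have "(\<integral>\<^sup>+\<omega>. ?f j \<omega> * ?e k \<omega> \<partial>S)
        \<le> (\<integral>\<^sup>+\<omega>. ?f j \<omega> * ?e (k - Suc j) (\<lambda>i. \<omega> (Suc j + i)) \<partial>S)"
    proof (rule nn_integral_mono)
      fix \<omega>
      have k: "Suc j + (k - Suc j) = k" using that by simp
      have "pos_walk k \<omega> = pos_walk (Suc j) \<omega> + pos_walk (k - Suc j) (\<lambda>i. \<omega> (Suc j + i))"
        using psum_add[of "\<lambda>e. max 0 (\<xi> e)" "Suc j" "k - Suc j" \<omega>] unfolding k .
      moreover have "0 \<le> pos_walk (Suc j) \<omega>" unfolding psum_def by (intro sum_nonneg) auto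
      \<comment> \<open>Forgetting the nonnegative height reached by time \<open>Suc j\<close> only
        lowers the barrier for the fresh copy.\<close>
      ultimately have "E (k - Suc j) (\<lambda>i. \<omega> (Suc j + i))" if "E k \<omega>"
        using that unfolding E_def k by linarith
      then show "?f j \<omega> * ?e k \<omega>
          \<le> ?f j \<omega> * ?e (k - Suc j) (\<lambda>i. \<omega> (Suc j + i))"
        by auto
    qed
    also have "\<dots> = PF j * PE (k - Suc j)"
    proof -
      have past: "(if F j (comb_seq (Suc j) \<omega> \<omega>') then 1 else 0 :: ennreal) = ?f j \<omega>" for \<omega> \<omega>'
      proof -
        have "E i (comb_seq (Suc j) \<omega> \<omega>') = E i \<omega>" if "i \<le> j" for i
          using that unfolding E_def by (simp add: psum_comb_seq comb_seq_def)
        then show ?thesis unfolding F_def by simp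
      qed
      have m: "(\<lambda>\<omega>. ?f j \<omega>) \<in> borel_measurable S"
        "(\<lambda>\<omega>. if E (k - Suc j) \<omega> then 1 else 0 :: ennreal) \<in> borel_measurable S"
        by measurable
      show ?thesis
        unfolding PF_def PE_def by (rule nn_integral_past_times_future[OF m past])
    qed
    finally show ?thesis .
  qed
  have bound: "(\<Sum>k<n. PE k) \<le> p' * (1 + (\<Sum>k<n. PE k))" for n
  proof -
    \<comment> \<open>An exceedance at \<open>k\<close> is the first one, or the first one occurs at
      some \<open>j < k\<close>.\<close>
    have PE_split: "PE k \<le> PF k + (\<Sum>j<k. PF j * PE (k - Suc j))" for k
    proof -
      have "?e k \<omega>
          \<le> ?f k \<omega> + (\<Sum>j<k. ?f j \<omega> * ?e k \<omega>)" for \<omega>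
      proof (cases "E k \<omega> \<and> \<not> F k \<omega>")
        case True
        then have ex: "\<exists>j. E j \<omega>" and lt: "\<exists>j<k. E j \<omega>" unfolding F_def by auto
        define j where "j = (LEAST j. E j \<omega>)"
        have "F j \<omega>" unfolding F_def j_def using ex by (auto intro: LeastI dest: not_less_Least)
        moreover have "j < k" using lt unfolding j_def by (meson Least_le le_less_trans)
        ultimately have "1 \<le> (\<Sum>j<k. ?f j \<omega> * ?e k \<omega>)"
          using True member_le_sum[of j "{..<k}" "\<lambda>j. ?f j \<omega> * ?e k \<omega>"]
          by auto
        then show ?thesis using True by simp
      qed auto
      then have "PE k \<le> (\<integral>\<^sup>+\<omega>. ?f k \<omega> + (\<Sum>j<k. ?f j \<omega> * ?e k \<omega>) \<partial>S)"
        unfolding PE_def by (intro nn_integral_mono)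
      also have "\<dots> = PF k + (\<Sum>j<k. \<integral>\<^sup>+\<omega>. ?f j \<omega> * ?e k \<omega> \<partial>S)"
        unfolding PF_def by (subst nn_integral_add) (auto simp: nn_integral_sum)
      also have "\<dots> \<le> PF k + (\<Sum>j<k. PF j * PE (k - Suc j))"
        by (intro add_left_mono sum_mono joint) auto
      finally show ?thesis .
    qed
    have "(\<Sum>k<n. PE k) \<le> (\<Sum>k<n. PF k) + (\<Sum>k<n. \<Sum>j<k. PF j * PE (k - Suc j))"
      using sum_mono[of "{..<n}" PE, OF PE_split] by (simp add: sum.distrib)
    also have "(\<Sum>k<n. \<Sum>j<k. PF j * PE (k - Suc j)) \<le> (\<Sum>j<n. PF j) * (\<Sum>k<n. PE k)"
    proof (cases n)
      case (Suc m)
      \<comment> \<open>The index shift produces a convolution, that is, a sum over the triangle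
        \<open>i + j < m\<close>, which the full square dominates.\<close>
      have "(\<Sum>k<n. \<Sum>j<k. PF j * PE (k - Suc j)) = (\<Sum>k<m. \<Sum>j\<le>k. PF j * PE (k - j))"
        unfolding Suc by (subst sum.lessThan_Suc_shift) (simp add: lessThan_Suc_atMost del: sum.lessThan_Suc)
      also have "\<dots> = (\<Sum>(i, j)\<in>{(i, j). i + j < m}. PF i * PE j)"
        by (rule sum.triangle_reindex[symmetric])
      also have "\<dots> \<le> (\<Sum>(i, j)\<in>{..<n} \<times> {..<n}. PF i * PE j)"
        by (intro sum_mono2) (auto simp: Suc)
      also have "\<dots> = (\<Sum>j<n. PF j) * (\<Sum>k<n. PE k)"
        by (simp add: sum_product sum.cartesian_product)
      finally show ?thesis .
    qed simp
    also have "(\<Sum>k<n. PF k) + (\<Sum>j<n. PF j) * (\<Sum>k<n. PE k) = (\<Sum>j<n. PF j) * (1 + (\<Sum>k<n. PE k))"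
      by (simp add: distrib_left)
    also have "\<dots> \<le> p' * (1 + (\<Sum>k<n. PE k))"
      by (intro mult_right_mono order_trans[OF sum_le_suminf PF_sum]) auto
    finally show ?thesis by simp
  qed
  obtain q where q: "p' = ennreal q" "0 \<le> q" "q < 1"
    using p unfolding p'_def[symmetric] by (cases p') auto
  \<comment> \<open>The inequality \<open>s \<le> q * (1 + s)\<close> can be solved for
    \<open>s\<close> only if \<open>s\<close> is finite, hence the detour through partial
    sums.\<close>
  have "(\<Sum>k<n. PE k) \<le> ennreal (q / (1 - q))" for n
  proof -
    have "PE k < \<infinity>" for k using PE_le[of k] by (rule le_less_trans) simp
    then have "(\<Sum>k<n. PE k) < \<infinity>" by simp
    then obtain s where s: "(\<Sum>k<n. PE k) = ennreal s" "0 \<le> s"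
      by (cases "\<Sum>k<n. PE k") auto
    have "ennreal s \<le> ennreal (q * (1 + s))"
      using bound[of n] s q by (simp add: ennreal_mult' ennreal_plus)
    then have "s \<le> q * (1 + s)" using s q by (subst (asm) ennreal_le_iff) auto
    then have "s * (1 - q) \<le> q" by (simp add: algebra_simps)
    then show ?thesis using s q by (auto intro!: ennreal_leI simp: pos_le_divide_eq)
  qed
  then have "(\<Sum>n. PE n) \<le> ennreal (q / (1 - q))" by (intro suminf_le_const) auto
  then show ?thesis unfolding PE_def E_def by (rule le_less_trans) simp
qed

text \<open>Wald's identity in the opposite direction: the drift carries the positive parts past
  \<open>x\<close>, and those that start below \<open>x\<close>, truncated at \<open>x\<close>,
  already add up to at least \<open>x\<close>.\<close>

lemma renewal_lower:
  assumes drift: drifts_to_infinity and x: "0 < x"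
  shows "ennreal x \<le> (\<Sum>n. \<integral>\<^sup>+\<omega>. (if pos_walk n \<omega> < x then 1 else 0) \<partial>S) * trunc_mean x"
proof -
  let ?u = "\<lambda>n \<omega>. if pos_walk n \<omega> < x then 1 else 0 :: ennreal"
  let ?v = "\<lambda>e. ennreal (min (max (\<xi> e) 0) x)"
  have "(\<Sum>n. \<integral>\<^sup>+\<omega>. ?u n \<omega> \<partial>S) * trunc_mean x
      = (\<Sum>n. (\<integral>\<^sup>+\<omega>. ?u n \<omega> \<partial>S) * trunc_mean x)"
    by simp
  also have "\<dots> = (\<Sum>n. \<integral>\<^sup>+\<omega>. ?u n \<omega> * ?v (\<omega> n) \<partial>S)"
  proof (rule suminf_cong)
    fix n
    have m: "(\<lambda>\<omega>. if pos_walk n \<omega> < x then 1 else 0 :: ennreal) \<in> borel_measurable S"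
      "(\<lambda>e. ennreal (min (max (\<xi> e) 0) x)) \<in> borel_measurable M"
      by measurable
    show "(\<integral>\<^sup>+\<omega>. ?u n \<omega> \<partial>S) * trunc_mean x
      = (\<integral>\<^sup>+\<omega>. ?u n \<omega> * ?v (\<omega> n) \<partial>S)"
      unfolding trunc_mean_def
      by (rule nn_integral_past_times_coordinate[OF m, symmetric]) (simp add: psum_comb_seq)
  qed
  also have "\<dots> = (\<integral>\<^sup>+\<omega>. (\<Sum>n. ?u n \<omega> * ?v (\<omega> n)) \<partial>S)"
    by (rule nn_integral_suminf[symmetric]) measurable
  finally have eq: "(\<Sum>n. \<integral>\<^sup>+\<omega>. ?u n \<omega> \<partial>S) * trunc_mean x = \<dots>" .
  have "ennreal x = (\<integral>\<^sup>+\<omega>. ennreal x \<partial>S)" by (simp add: P.emeasure_space_1)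
  also have "\<dots> \<le> (\<integral>\<^sup>+\<omega>. (\<Sum>n. ?u n \<omega> * ?v (\<omega> n)) \<partial>S)"
  proof (rule nn_integral_mono_AE, use drift in eventually_elim)
    fix \<omega> assume "diverges \<omega>"
    then have "\<forall>\<^sub>F n in sequentially. x \<le> psum \<xi> n \<omega>" by (simp add: filterlim_at_top)
    then obtain n where "x \<le> psum \<xi> n \<omega>" by (metis eventually_sequentially order_refl)
    also have "\<dots> \<le> pos_walk n \<omega>" unfolding psum_def by (intro sum_mono) auto
    finally have n: "x \<le> pos_walk n \<omega>" .
    define r where "r k = max 0 (\<xi> (\<omega> k))" for k
    have "x = min (\<Sum>j<n. r j) x" using n by (simp add: r_def psum_def)
    also have "\<dots> \<le> (\<Sum>k<n. if (\<Sum>j<k. r j) < x then min (r k) x else 0)"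
      by (rule sum_min_lower) (use x in \<open>auto simp: r_def\<close>)
    finally have "ennreal x \<le> ennreal (\<Sum>k<n. if (\<Sum>j<k. r j) < x then min (r k) x else 0)"
      by (rule ennreal_leI)
    also have "\<dots> = (\<Sum>k<n. ennreal (if (\<Sum>j<k. r j) < x then min (r k) x else 0))"
      using x by (intro sum_ennreal[symmetric]) (auto simp: r_def)
    also have "\<dots> = (\<Sum>k<n. ?u k \<omega> * ?v (\<omega> k))"
      by (intro sum.cong) (auto simp: r_def psum_def max.commute)
    also have "\<dots> \<le> (\<Sum>n. ?u n \<omega> * ?v (\<omega> n))"
      by (rule sum_le_suminf) auto
    finally show "ennreal x \<le> (\<Sum>n. ?u n \<omega> * ?v (\<omega> n))" .
  qed
  finally show ?thesis by (simp only: eq)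
qed

text \<open>\<open>\<omega> n\<close> is independent of the first \<open>n\<close> steps, so the
  expected number of exceedances over \<open>pos_walk\<close> is the renewal function of
  \<open>pos_walk\<close> at \<open>\<zeta> - c\<close>, averaged over \<open>\<zeta>\<close>.
  \<open>expected_exceedances_finite\<close> makes it finite, and \<open>renewal_lower\<close>
  bounds the renewal function from below.\<close>

lemma excess_moment_finite:
  assumes drift: drifts_to_infinity
    and \<zeta> [measurable]: "\<zeta> \<in> borel_measurable M"
    and p: "(\<integral>\<^sup>+\<omega>. (if \<exists>n. psum \<xi> n \<omega> + c < \<zeta> (\<omega> n) then 1 else 0) \<partial>S) < 1"
  shows "(\<integral>\<^sup>+e. (if c < \<zeta> e then ennreal (\<zeta> e - c) / trunc_mean (\<zeta> e - c) else 0) \<partial>M) < \<infinity>"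
proof -
  let ?h = "\<lambda>n \<omega> e. if pos_walk n \<omega> < \<zeta> e - c then 1 else 0 :: ennreal"
  have le: "psum \<xi> n \<omega> \<le> pos_walk n \<omega>" for n \<omega> unfolding psum_def by (intro sum_mono) auto
  have "(\<integral>\<^sup>+\<omega>. (if \<exists>n. pos_walk n \<omega> + c < \<zeta> (\<omega> n) then 1 else 0) \<partial>S)
      \<le> (\<integral>\<^sup>+\<omega>. (if \<exists>n. psum \<xi> n \<omega> + c < \<zeta> (\<omega> n) then 1 else 0) \<partial>S)"
  proof (rule nn_integral_mono)
    fix \<omega>
    show "(if \<exists>n. pos_walk n \<omega> + c < \<zeta> (\<omega> n) then 1 else 0)
        \<le> (if \<exists>n. psum \<xi> n \<omega> + c < \<zeta> (\<omega> n) then 1 else 0 :: ennreal)"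
      using le[of _ \<omega>] by (auto simp: not_less) (smt (verit))
  qed
  from le_less_trans[OF this p]
  have fin: "(\<Sum>n. \<integral>\<^sup>+\<omega>. (if pos_walk n \<omega> + c < \<zeta> (\<omega> n) then 1 else 0) \<partial>S) < \<infinity>"
    by (rule expected_exceedances_finite[OF \<zeta>])
  have "(\<integral>\<^sup>+\<omega>. (if pos_walk n \<omega> + c < \<zeta> (\<omega> n) then 1 else 0) \<partial>S)
      = (\<integral>\<^sup>+e. \<integral>\<^sup>+\<omega>. ?h n \<omega> e \<partial>S \<partial>M)" for n
  proof -
    interpret PS: pair_sigma_finite S M by unfold_locales
    have "(\<integral>\<^sup>+\<omega>. (if pos_walk n \<omega> + c < \<zeta> (\<omega> n) then 1 else 0) \<partial>S)
        = (\<integral>\<^sup>+\<omega>. \<integral>\<^sup>+e. ?h n \<omega> e \<partial>M \<partial>S)"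
      using nn_integral_past_coordinate[of "\<lambda>(\<omega>, e). if pos_walk n \<omega> < \<zeta> e - c then 1 else 0" n]
      by (simp add: psum_comb_seq less_diff_eq)
    also have "\<dots> = (\<integral>\<^sup>+e. \<integral>\<^sup>+\<omega>. ?h n \<omega> e \<partial>S \<partial>M)"
      by (rule PS.Fubini'[symmetric]) measurable
    finally show ?thesis .
  qed
  then have "(\<Sum>n. \<integral>\<^sup>+\<omega>. (if pos_walk n \<omega> + c < \<zeta> (\<omega> n) then 1 else 0) \<partial>S)
      = (\<Sum>n. \<integral>\<^sup>+e. \<integral>\<^sup>+\<omega>. ?h n \<omega> e \<partial>S \<partial>M)"
    by (simp only:)
  also have "\<dots> = (\<integral>\<^sup>+e. (\<Sum>n. \<integral>\<^sup>+\<omega>. ?h n \<omega> e \<partial>S) \<partial>M)"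
    by (rule nn_integral_suminf[symmetric]) measurable
  finally have eq: "(\<Sum>n. \<integral>\<^sup>+\<omega>. (if pos_walk n \<omega> + c < \<zeta> (\<omega> n) then 1 else 0) \<partial>S) = \<dots>" .
  have "(\<integral>\<^sup>+e. (if c < \<zeta> e then ennreal (\<zeta> e - c) / trunc_mean (\<zeta> e - c) else 0) \<partial>M)
      \<le> (\<integral>\<^sup>+e. (\<Sum>n. \<integral>\<^sup>+\<omega>. ?h n \<omega> e \<partial>S) \<partial>M)"
  proof (rule nn_integral_mono)
    fix e
    have "ennreal x / trunc_mean x \<le> (\<Sum>n. \<integral>\<^sup>+\<omega>. (if pos_walk n \<omega> < x then 1 else 0 :: ennreal) \<partial>S)" if "0 < x" for x
    proof -
      have "ennreal x / trunc_mean x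
          \<le> (\<Sum>n. \<integral>\<^sup>+\<omega>. (if pos_walk n \<omega> < x then 1 else 0) \<partial>S) * trunc_mean x / trunc_mean x"
        by (intro divide_right_mono_ennreal renewal_lower drift that)
      also have "\<dots> = (\<Sum>n. \<integral>\<^sup>+\<omega>. (if pos_walk n \<omega> < x then 1 else 0 :: ennreal) \<partial>S)"
        using trunc_mean_pos[OF not_AE_nonpos_if_drifts[OF drift] that] trunc_mean_finite[of x]
        by (intro ennreal_mult_divide_eq) auto
      finally show ?thesis .
    qed
    from this[of "\<zeta> e - c"]
    show "(if c < \<zeta> e then ennreal (\<zeta> e - c) / trunc_mean (\<zeta> e - c) else 0)
        \<le> (\<Sum>n. \<integral>\<^sup>+\<omega>. ?h n \<omega> e \<partial>S)"
      by auto
  qed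
  also have "\<dots> < \<infinity>" using fin by (simp only: eq)
  finally show ?thesis .
qed

text \<open>The shift by \<open>c\<close> is harmless: above \<open>2 * c\<close> one has
  \<open>\<zeta> \<le> 2 * (\<zeta> - c)\<close>, and up to \<open>2 * c\<close> monotonicity bounds
  the quotient by its value \<open>?K\<close> at \<open>2 * c\<close>.\<close>

theorem positive_part_moment_finite:
  assumes drift: drifts_to_infinity
    and \<zeta> [measurable]: "\<zeta> \<in> borel_measurable M" and c: "0 < c"
    and p: "(\<integral>\<^sup>+\<omega>. (if \<exists>n. psum \<xi> n \<omega> + c < \<zeta> (\<omega> n) then 1 else 0) \<partial>S) < 1"
  shows "(\<integral>\<^sup>+e. ennreal (max 0 (\<zeta> e)) / trunc_mean (max 0 (\<zeta> e)) \<partial>M) < \<infinity>"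
proof -
  note nt = not_AE_nonpos_if_drifts[OF drift]
  let ?g = "\<lambda>e. if c < \<zeta> e then ennreal (\<zeta> e - c) / trunc_mean (\<zeta> e - c) else 0"
  let ?K = "ennreal (2 * c) / trunc_mean (2 * c)"
  have "(\<integral>\<^sup>+e. ennreal (max 0 (\<zeta> e)) / trunc_mean (max 0 (\<zeta> e)) \<partial>M) \<le> (\<integral>\<^sup>+e. ?K + 2 * ?g e \<partial>M)"
  proof (rule nn_integral_mono)
    fix e
    consider "\<zeta> e \<le> 0" | "0 < \<zeta> e" "\<zeta> e \<le> 2 * c" | "2 * c < \<zeta> e" by linarith
    then show "ennreal (max 0 (\<zeta> e)) / trunc_mean (max 0 (\<zeta> e)) \<le> ?K + 2 * ?g e"
    proof cases
      case 2
      then have "ennreal (\<zeta> e) / trunc_mean (\<zeta> e) \<le> ?K" by (intro divide_trunc_mean_mono nt)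
      also have "\<dots> \<le> ?K + 2 * ?g e" by (rule add_increasing2) (rule zero_le, rule order_refl)
      finally show ?thesis using 2 by (simp only: max_absorb2 less_imp_le)
    next
      case 3
      have "ennreal (\<zeta> e) / trunc_mean (\<zeta> e) \<le> ennreal (2 * (\<zeta> e - c)) / trunc_mean (\<zeta> e - c)"
        using 3 c by (intro order_trans[OF ennreal_divide_left_antimono divide_right_mono_ennreal]
            trunc_mean_mono ennreal_leI) auto
      also have "\<dots> = 2 * ?g e"
      proof -
        have "ennreal (2 * (\<zeta> e - c)) = 2 * ennreal (\<zeta> e - c)"
          using 3 c by (subst ennreal_mult') simp_all
        then show ?thesis using 3 c by (simp add: ennreal_times_divide)
      qed
      also have "\<dots> \<le> ?K + 2 * ?g e" by (rule add_increasing) (rule zero_le, rule order_refl)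
      finally have "ennreal (\<zeta> e) / trunc_mean (\<zeta> e) \<le> ?K + 2 * ?g e" .
      moreover have "max 0 (\<zeta> e) = \<zeta> e" using 3 c by simp
      ultimately show ?thesis by (simp only:)
    qed simp
  qed
  also have "\<dots> = ?K + 2 * (\<integral>\<^sup>+e. ?g e \<partial>M)"
    by (subst nn_integral_add) (auto simp: M.emeasure_space_1 nn_integral_cmult)
  also have "\<dots> < \<infinity>"
    using excess_moment_finite[OF drift \<zeta> p] trunc_mean_pos[OF nt, of "2 * c"] c
    by (simp add: less_top[symmetric] ennreal_divide_eq_top_iff ennreal_mult_eq_top_iff)
  finally show ?thesis .
qed

end

section \<open>Weighted branching processes\<close>

definition subtree :: "nat \<Rightarrow> (nat list \<Rightarrow> 'r) \<Rightarrow> nat list \<Rightarrow> 'r"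
  where "subtree i t = (\<lambda>v. t (i # v))"

definition graft :: "'r \<Rightarrow> (nat \<Rightarrow> nat list \<Rightarrow> 'r) \<Rightarrow> nat list \<Rightarrow> 'r"
  where "graft r s = (\<lambda>v. case v of [] \<Rightarrow> r | i # v' \<Rightarrow> s i v')"

lemma graft_simps [simp]: "graft r s [] = r" "subtree i (graft r s) = s i"
  by (simp_all add: graft_def subtree_def)

text \<open>The label \<open>r\<close> of an individual determines the weights \<open>l i r\<close>
  of all its potential children. Absent children get weight 0, so that sums run over the full tree
  of words and no random index set remains.\<close>

locale weighted_branching = prob_space R for R :: "'r measure" +
  fixes l :: "nat \<Rightarrow> 'r \<Rightarrow> real"
  assumes measurable_l [measurable]: "\<And>i. l i \<in> borel_measurable R"
    and l_nonneg: "\<And>i r. 0 \<le> l i r"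
    and mean_one: "(\<integral>\<^sup>+r. (\<Sum>i. ennreal (l i r)) \<partial>R) = 1"
begin

abbreviation T :: "(nat list \<Rightarrow> 'r) measure" where "T \<equiv> \<Pi>\<^sub>M v\<in>UNIV. R"
abbreviation Ts :: "(nat \<Rightarrow> nat list \<Rightarrow> 'r) measure" where "Ts \<equiv> \<Pi>\<^sub>M i\<in>UNIV. T"

sublocale T: prob_space T
  by (intro prob_space_PiM prob_space_axioms)

sublocale Ts: product_prob_space "\<lambda>_. T" "UNIV :: nat set"
  by unfold_locales

lemma measurable_subtree [measurable]: "subtree i \<in> T \<rightarrow>\<^sub>M T"
  unfolding subtree_def[abs_def] by (rule measurable_PiM_single') (auto simp: space_PiM PiE_def Pi_iff)

lemma measurable_graft [measurable]: "(\<lambda>(r, s). graft r s) \<in> R \<Otimes>\<^sub>M Ts \<rightarrow>\<^sub>M T"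
proof (rule measurable_PiM_single')
  show "(\<lambda>p. (case p of (r, s) \<Rightarrow> graft r s) v) \<in> R \<Otimes>\<^sub>M Ts \<rightarrow>\<^sub>M R" for v
  proof (cases v)
    case (Cons i v')
    have "(\<lambda>p. snd p i v') \<in> R \<Otimes>\<^sub>M Ts \<rightarrow>\<^sub>M R"
      using measurable_compose[OF measurable_compose[OF measurable_snd
          measurable_component_singleton[of i UNIV "\<lambda>_. T"]] measurable_component_singleton[of v' UNIV "\<lambda>_. R"]]
      by simp
    then show ?thesis using Cons by (simp add: graft_def split_beta)
  qed (simp add: graft_def split_beta)
  show "(\<lambda>p v. (case p of (r, s) \<Rightarrow> graft r s) v) \<in> space (R \<Otimes>\<^sub>M Ts) \<rightarrow> UNIV \<rightarrow>\<^sub>E space R"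
    by (auto simp: space_pair_measure space_PiM graft_def PiE_def Pi_iff split: list.split)
qed

text \<open>The branching property: the root label and the subtrees are independent, and each
  subtree is distributed as the whole tree. On a cylinder over \<open>J\<close> this follows by
  sorting the words other than the root by their first letter; \<open>K i\<close> collects the
  remainders after the letter \<open>i\<close>.\<close>

lemma distr_graft: "distr (R \<Otimes>\<^sub>M Ts) T (\<lambda>(r, s). graft r s) = T"
proof (rule measure_eqI_PiM_infinite[symmetric, OF refl])
  show "finite_measure T" by unfold_locales
  fix A :: "nat list \<Rightarrow> 'r set" and J :: "nat list set"
  assume J: "finite J" "J \<subseteq> UNIV" and A: "\<And>v. v \<in> J \<Longrightarrow> A v \<in> sets R"
  define I where "I = hd ` (J - {[]})"
  define K where "K i = {v. i # v \<in> J}" for i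
  let ?D = "prod_emb UNIV (\<lambda>_. R) J (Pi\<^sub>E J A)"
  let ?B = "if [] \<in> J then A [] else space R"
  let ?E = "\<lambda>i. prod_emb UNIV (\<lambda>_. R) (K i) (\<Pi>\<^sub>E v\<in>K i. A (i # v))"
  let ?F = "prod_emb UNIV (\<lambda>_. T) I (Pi\<^sub>E I ?E)"
  have I: "finite I" using J by (simp add: I_def)
  have K: "finite (K i)" for i
  proof -
    have "K i \<subseteq> tl ` J" unfolding K_def by force
    then show ?thesis using J finite_subset by blast
  qed
  have A_sub: "x \<in> space R" if "v \<in> J" "x \<in> A v" for v x
    using A[OF that(1)] that(2) sets.sets_into_space by blast
  have "emeasure T (?D) = (\<Prod>v\<in>J. emeasure R (A v))"
    using J A by (intro emeasure_PiM_emb prob_space_axioms) auto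
  also have "\<dots> = emeasure R ?B * (\<Prod>v\<in>J - {[]}. emeasure R (A v))"
    using J by (cases "[] \<in> J") (simp_all add: prod.remove emeasure_space_1)
  also have "J - {[]} = (\<lambda>(i, v). i # v) ` (SIGMA i:I. K i)"
  proof (intro set_eqI iffI)
    fix v assume "v \<in> J - {[]}"
    then show "v \<in> (\<lambda>(i, v). i # v) ` (SIGMA i:I. K i)"
      by (cases v) (auto simp: I_def K_def image_iff intro!: bexI[of _ v])
  qed (auto simp: K_def)
  also have "(\<Prod>v\<in>(\<lambda>(i, v). i # v) ` (SIGMA i:I. K i). emeasure R (A v))
      = (\<Prod>i\<in>I. \<Prod>v\<in>K i. emeasure R (A (i # v)))"
    by (subst prod.reindex) (auto simp: inj_on_def prod.Sigma I K split_beta)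
  also have "\<dots> = (\<Prod>i\<in>I. emeasure T (?E i))"
    using A K by (intro prod.cong refl emeasure_PiM_emb[symmetric] prob_space_axioms) (auto simp: K_def)
  also have "\<dots> = emeasure Ts (?F)"
    using A I K by (intro Ts.emeasure_PiM_emb[symmetric] sets_PiM_I) (auto simp: K_def)
  also have "emeasure R ?B * \<dots> = emeasure (R \<Otimes>\<^sub>M Ts) (?B \<times> ?F)"
    using A I K by (intro Ts.P.emeasure_pair_measure_Times[symmetric] sets_PiM_I) (auto simp: K_def intro!: sets_PiM_I)
  also have "?B \<times> ?F
      = (\<lambda>(r, s). graft r s) -` ?D \<inter> space (R \<Otimes>\<^sub>M Ts)"
  proof (intro set_eqI)
    fix p :: "'r \<times> (nat \<Rightarrow> nat list \<Rightarrow> 'r)"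
    obtain r s where p: "p = (r, s)" by (cases p)
    have g: "(\<forall>v\<in>J. graft r s v \<in> A v) \<longleftrightarrow> ([] \<in> J \<longrightarrow> r \<in> A []) \<and> (\<forall>i\<in>I. \<forall>v\<in>K i. s i v \<in> A (i # v))" (is "?l \<longleftrightarrow> ?r")
    proof
      assume ?l
      then show ?r by (force simp: K_def graft_def)
    next
      assume r: ?r
      show ?l
      proof
        fix v assume "v \<in> J"
        then show "graft r s v \<in> A v"
          using r by (cases v) (force simp: graft_def I_def K_def image_iff)+
      qed
    qed
    show "p \<in> ?B \<times> ?F \<longleftrightarrow>
        p \<in> (\<lambda>(r, s). graft r s) -` ?D \<inter> space (R \<Otimes>\<^sub>M Ts)"
    proof (cases "r \<in> space R \<and> s \<in> space Ts")
      case True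
      then have gs: "graft r s v \<in> space R" for v
        by (auto simp: graft_def space_PiM PiE_def Pi_iff split: list.split)
      have "s i v \<in> space R" for i v using True by (auto simp: space_PiM PiE_def Pi_iff)
      then show ?thesis
        using True g gs unfolding p
        by (auto simp: prod_emb_def space_pair_measure space_PiM PiE_def Pi_iff)
    next
      case False
      then show ?thesis
        unfolding p using A_sub
        by (auto simp: prod_emb_def space_pair_measure space_PiM PiE_def Pi_iff split: if_splits)
    qed
  qed
  also have "emeasure (R \<Otimes>\<^sub>M Ts) \<dots> = emeasure (distr (R \<Otimes>\<^sub>M Ts) T (\<lambda>(r, s). graft r s)) (?D)"
    using J A by (intro emeasure_distr[symmetric] measurable_graft sets_PiM_I) auto
  finally show "emeasure T (?D) = \<dots>" .
qed simp

lemma nn_integral_graft: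
  assumes [measurable]: "f \<in> borel_measurable T"
  shows "(\<integral>\<^sup>+t. f t \<partial>T) = (\<integral>\<^sup>+r. \<integral>\<^sup>+s. f (graft r s) \<partial>Ts \<partial>R)"
proof -
  have "(\<integral>\<^sup>+t. f t \<partial>T) = (\<integral>\<^sup>+t. f t \<partial>distr (R \<Otimes>\<^sub>M Ts) T (\<lambda>(r, s). graft r s))"
    by (simp only: distr_graft)
  also have "\<dots> = (\<integral>\<^sup>+p. f (case p of (r, s) \<Rightarrow> graft r s) \<partial>(R \<Otimes>\<^sub>M Ts))"
    by (rule nn_integral_distr) measurable
  also have "\<dots> = (\<integral>\<^sup>+r. \<integral>\<^sup>+s. f (graft r s) \<partial>Ts \<partial>R)"
    by (subst Ts.P.nn_integral_fst[symmetric]) simp_all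
  finally show ?thesis .
qed

lemma nn_integral_component:
  assumes [measurable]: "f \<in> borel_measurable T"
  shows "(\<integral>\<^sup>+s. f (s i) \<partial>Ts) = (\<integral>\<^sup>+t. f t \<partial>T)"
proof -
  have "(\<integral>\<^sup>+s. f (s i) \<partial>Ts) = (\<integral>\<^sup>+e. f e \<partial>distr Ts T (\<lambda>s. s i))"
    by (subst nn_integral_distr) auto
  then show ?thesis by (simp add: Ts.PiM_component)
qed

text \<open>Independence of different subtrees, obtained by splitting coordinate \<open>i\<close>
  off the product. It serves the cross terms between the subtree that contains an individual and the
  subtrees of its ancestors' siblings.\<close>

lemma nn_integral_two_components:
  assumes [measurable]: "f \<in> borel_measurable T" "g \<in> borel_measurable T" and "i \<noteq> j"
  shows "(\<integral>\<^sup>+s. f (s i) * g (s j) \<partial>Ts) = (\<integral>\<^sup>+t. f t \<partial>T) * (\<integral>\<^sup>+t. g t \<partial>T)"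
proof -
  have "distr (T \<Otimes>\<^sub>M (\<Pi>\<^sub>M k\<in>UNIV - {i}. T)) (\<Pi>\<^sub>M k\<in>insert i (UNIV - {i}). T) (\<lambda>(x, X). X(i := x))
      = (\<Pi>\<^sub>M k\<in>insert i (UNIV - {i}). T)"
    by (rule distr_pair_PiM_eq_PiM) (auto intro: T.prob_space_axioms)
  then have D: "distr (T \<Otimes>\<^sub>M (\<Pi>\<^sub>M k\<in>UNIV - {i}. T)) Ts (\<lambda>(x, X). X(i := x)) = Ts"
    by (simp add: insert_UNIV)
  interpret X: prob_space "\<Pi>\<^sub>M k\<in>UNIV - {i}. T"
    by (intro prob_space_PiM T.prob_space_axioms)
  have m: "(\<lambda>(x, X). X(i := x)) \<in> T \<Otimes>\<^sub>M (\<Pi>\<^sub>M k\<in>UNIV - {i}. T) \<rightarrow>\<^sub>M Ts"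
    unfolding split_beta by (rule measurable_fun_upd[where J = "UNIV - {i}"]) auto
  have j: "j \<in> UNIV - {i}" using assms by auto
  have "(\<integral>\<^sup>+s. f (s i) * g (s j) \<partial>Ts) = (\<integral>\<^sup>+p. f (fst p) * g (snd p j) \<partial>(T \<Otimes>\<^sub>M (\<Pi>\<^sub>M k\<in>UNIV - {i}. T)))"
    by (subst D[symmetric], subst nn_integral_distr[OF m]) (use \<open>i \<noteq> j\<close> in \<open>auto simp: split_beta\<close>)
  also have "\<dots> = (\<integral>\<^sup>+x. \<integral>\<^sup>+X. f x * g (X j) \<partial>(\<Pi>\<^sub>M k\<in>UNIV - {i}. T) \<partial>T)"
    using j by (subst X.nn_integral_fst[symmetric]) auto
  also have "\<dots> = (\<integral>\<^sup>+t. f t \<partial>T) * (\<integral>\<^sup>+X. g (X j) \<partial>(\<Pi>\<^sub>M k\<in>UNIV - {i}. T))"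
    using j by (simp add: nn_integral_cmult nn_integral_multc)
  also have "(\<integral>\<^sup>+X. g (X j) \<partial>(\<Pi>\<^sub>M k\<in>UNIV - {i}. T)) = (\<integral>\<^sup>+t. g t \<partial>distr (\<Pi>\<^sub>M k\<in>UNIV - {i}. T) T (\<lambda>X. X j))"
    using j by (subst nn_integral_distr) auto
  also have "distr (\<Pi>\<^sub>M k\<in>UNIV - {i}. T) T (\<lambda>X. X j) = T"
    using j by (intro distr_PiM_component T.prob_space_axioms)
  finally show ?thesis .
qed

end

primrec fold_path :: "('c \<Rightarrow> 'e \<Rightarrow> 'c) \<Rightarrow> nat \<Rightarrow> 'c \<Rightarrow> (nat \<Rightarrow> 'e) \<Rightarrow> 'c" where
  "fold_path u 0 c \<omega> = c"
| "fold_path u (Suc n) c \<omega> = u (fold_path u n c \<omega>) (\<omega> n)"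

lemma fold_path_Suc_shift: "fold_path u (Suc n) c \<omega> = fold_path u n (u c (\<omega> 0)) (\<lambda>k. \<omega> (Suc k))"
  by (induction n) simp_all

section \<open>The size-biased law and the many-to-one formula\<close>

context weighted_branching
begin

definition total_weight :: "'r \<Rightarrow> ennreal"
  where "total_weight r = (\<Sum>i. ennreal (l i r))"

text \<open>One step of the spine: the label has density \<open>total_weight\<close> with respect to
  \<open>R\<close>, and given the label the child \<open>i\<close> is chosen with probability
  proportional to \<open>l i\<close>.\<close>

definition size_biased :: "('r \<times> nat) measure"
  where "size_biased = density (R \<Otimes>\<^sub>M count_space UNIV) (\<lambda>(r, i). ennreal (l i r))"

text \<open>The recursion at the root fits \<open>nn_integral_graft\<close>;
  \<open>W_eq_generation_sum\<close> recovers the sum over a generation.\<close>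

primrec W :: "nat \<Rightarrow> (nat list \<Rightarrow> 'r) \<Rightarrow> ennreal" where
  "W 0 t = 1"
| "W (Suc n) t = (\<Sum>i. ennreal (l i (t [])) * W n (subtree i t))"

text \<open>
  The sum over the \<open>n\<close>-th generation of the weights of the individuals, each multiplied by a
  functional of its ancestral line; the line is summarised by a state updated by \<open>u\<close> in every step.
\<close>

primrec path_sum :: "('c \<Rightarrow> 'r \<times> nat \<Rightarrow> 'c) \<Rightarrow> ('c \<Rightarrow> ennreal) \<Rightarrow> nat \<Rightarrow> 'c \<Rightarrow> (nat list \<Rightarrow> 'r) \<Rightarrow> ennreal" where
  "path_sum u \<phi> 0 c t = \<phi> c"
| "path_sum u \<phi> (Suc n) c t = (\<Sum>i. ennreal (l i (t [])) * path_sum u \<phi> n (u c (t [], i)) (subtree i t))"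

lemma measurable_total_weight [measurable]: "total_weight \<in> borel_measurable R"
  unfolding total_weight_def[abs_def] by measurable

lemma measurable_l_pair [measurable]: "(\<lambda>(r, i). l i r) \<in> borel_measurable (R \<Otimes>\<^sub>M count_space UNIV)"
proof -
  have "(\<lambda>p. l (snd p) (fst p)) \<in> borel_measurable (R \<Otimes>\<^sub>M count_space UNIV)"
    by (rule measurable_compose_countable[where f = "\<lambda>i p. l i (fst p)"]) measurable
  then show ?thesis by (simp add: split_beta)
qed

lemma sets_size_biased [measurable_cong]: "sets size_biased = sets (R \<Otimes>\<^sub>M count_space UNIV)"
  by (simp add: size_biased_def)

lemma nn_integral_size_biased:
  assumes [measurable]: "f \<in> borel_measurable (R \<Otimes>\<^sub>M count_space UNIV)"
  shows "(\<integral>\<^sup>+e. f e \<partial>size_biased) = (\<integral>\<^sup>+r. (\<Sum>i. ennreal (l i r) * f (r, i)) \<partial>R)"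
proof -
  interpret C: sigma_finite_measure "count_space (UNIV :: nat set)"
    by (rule sigma_finite_measure_count_space)
  have "(\<integral>\<^sup>+e. f e \<partial>size_biased)
      = (\<integral>\<^sup>+p. (case p of (r, i) \<Rightarrow> ennreal (l i r)) * f p \<partial>(R \<Otimes>\<^sub>M count_space UNIV))"
    unfolding size_biased_def by (rule nn_integral_density) measurable
  also have "\<dots> = (\<integral>\<^sup>+r. \<integral>\<^sup>+i. ennreal (l i r) * f (r, i) \<partial>count_space UNIV \<partial>R)"
    by (subst C.nn_integral_fst[symmetric]) simp_all
  finally show ?thesis by (simp add: nn_integral_count_space_nat)
qed

lemma prob_space_size_biased: "prob_space size_biased"
proof
  have "emeasure size_biased (space size_biased) = (\<integral>\<^sup>+e. 1 \<partial>size_biased)" by simp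
  also have "\<dots> = 1" by (subst nn_integral_size_biased) (simp_all add: mean_one)
  finally show "emeasure size_biased (space size_biased) = 1" .
qed

lemma AE_size_biased_root:
  assumes "AE r in R. P r" and "{r \<in> space R. P r} \<in> sets R"
  shows "AE e in size_biased. P (fst e)"
proof -
  have [measurable]: "Measurable.pred R P" using assms(2) by (simp add: pred_def)
  have "(\<integral>\<^sup>+e. (if P (fst e) then 0 else 1) \<partial>size_biased)
      = (\<integral>\<^sup>+r. (\<Sum>i. ennreal (l i r) * (if P r then 0 else 1)) \<partial>R)"
    by (subst nn_integral_size_biased) simp_all
  also have "\<dots> = (\<integral>\<^sup>+r. 0 \<partial>R)"
    by (rule nn_integral_cong_AE, use assms(1) in eventually_elim) simp
  finally have "(\<integral>\<^sup>+e. (if P (fst e) then 0 else 1) \<partial>size_biased) = 0"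
    by simp
  then have "AE e in size_biased. (if P (fst e) then 0 else 1 :: ennreal) = 0"
    by (subst (asm) nn_integral_0_iff_AE) simp_all
  then show ?thesis by eventually_elim (auto split: if_splits)
qed

lemma AE_size_biased_pos: "AE e in size_biased. 0 < l (snd e) (fst e)"
  unfolding size_biased_def
  by (subst AE_density) (auto simp: ennreal_eq_0_iff intro!: AE_I2)

lemma AE_total_weight_finite: "AE r in R. total_weight r < \<infinity>"
proof -
  have "AE r in R. total_weight r \<noteq> \<infinity>"
    unfolding total_weight_def by (rule nn_integral_PInf_AE) (simp_all add: mean_one)
  then show ?thesis by (simp add: less_top)
qed

lemma nn_integral_total_weight: "(\<integral>\<^sup>+r. total_weight r \<partial>R) = 1"
  by (simp add: total_weight_def mean_one)

lemma measurable_W [measurable]: "W n \<in> borel_measurable T"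
  by (induction n) (simp_all)

lemma measurable_path_sum:
  fixes C :: "'c measure"
  assumes [measurable]: "(\<lambda>(c, e). u c e) \<in> C \<Otimes>\<^sub>M (R \<Otimes>\<^sub>M count_space UNIV) \<rightarrow>\<^sub>M C"
    and [measurable]: "\<phi> \<in> borel_measurable C"
  shows "(\<lambda>(c, t). path_sum u \<phi> n c t) \<in> borel_measurable (C \<Otimes>\<^sub>M T)"
proof (induction n)
  case 0
  then show ?case by simp
next
  case (Suc n)
  note [measurable] = Suc
  have u: "(\<lambda>p. u (fst p) (snd p [], i)) \<in> C \<Otimes>\<^sub>M T \<rightarrow>\<^sub>M C" for i
  proof -
    have "(\<lambda>p. (fst p, (snd p [], i))) \<in> C \<Otimes>\<^sub>M T \<rightarrow>\<^sub>M C \<Otimes>\<^sub>M (R \<Otimes>\<^sub>M count_space UNIV)"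
      by measurable
    from measurable_compose[OF this assms(1)] show ?thesis by simp
  qed
  have "(\<lambda>p. path_sum u \<phi> n (u (fst p) (snd p [], i)) (subtree i (snd p))) \<in> borel_measurable (C \<Otimes>\<^sub>M T)" for i
  proof -
    have "(\<lambda>p. (u (fst p) (snd p [], i), subtree i (snd p))) \<in> C \<Otimes>\<^sub>M T \<rightarrow>\<^sub>M C \<Otimes>\<^sub>M T"
      using u[of i] by measurable
    from measurable_compose[OF this Suc] show ?thesis by simp
  qed
  note [measurable] = this
  show ?case by (simp add: split_beta)
qed

lemma measurable_fold_path:
  assumes [measurable]: "(\<lambda>(c, e). u c e) \<in> C \<Otimes>\<^sub>M E \<rightarrow>\<^sub>M C"
  shows "(\<lambda>(c, \<omega>). fold_path u n c \<omega>) \<in> C \<Otimes>\<^sub>M (\<Pi>\<^sub>M k\<in>UNIV. E) \<rightarrow>\<^sub>M C"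
proof (induction n)
  case 0
  then show ?case by (simp add: split_beta)
next
  case (Suc n)
  then have "(\<lambda>p. (fold_path u n (fst p) (snd p), snd p n)) \<in> C \<Otimes>\<^sub>M (\<Pi>\<^sub>M k\<in>UNIV. E) \<rightarrow>\<^sub>M C \<Otimes>\<^sub>M E"
    by (auto simp: split_beta)
  from measurable_compose[OF this assms] show ?case by (simp add: split_beta)
qed

abbreviation Spine :: "(nat \<Rightarrow> 'r \<times> nat) measure"
  where "Spine \<equiv> \<Pi>\<^sub>M k\<in>UNIV. size_biased"

sublocale spine: sequence_space size_biased
  by (intro sequence_space.intro product_prob_space.intro product_sigma_finite.intro
      product_prob_space_axioms.intro prob_space_size_biased prob_space_imp_sigma_finite)

text \<open>Conditioning on the root label leaves independent subtrees, each started from an updated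
  state; weighting child \<open>i\<close> by \<open>l i\<close> is integration against the first
  size-biased step. The initial state is arbitrary in the induction because that step changes
  it.\<close>

lemma many_to_one:
  fixes C :: "'c measure"
  assumes u [measurable]: "(\<lambda>(c, e). u c e) \<in> C \<Otimes>\<^sub>M (R \<Otimes>\<^sub>M count_space UNIV) \<rightarrow>\<^sub>M C"
    and \<phi> [measurable]: "\<phi> \<in> borel_measurable C" and c: "c \<in> space C"
  shows "(\<integral>\<^sup>+t. path_sum u \<phi> n c t \<partial>T) = (\<integral>\<^sup>+\<omega>. \<phi> (fold_path u n c \<omega>) \<partial>Spine)"
  using c
proof (induction n arbitrary: c)
  case 0
  then show ?case by (simp add: T.emeasure_space_1 spine.P.emeasure_space_1)
next
  case (Suc n)
  note c = Suc.prems
  have uc: "(\<lambda>e. u c e) \<in> R \<Otimes>\<^sub>M count_space UNIV \<rightarrow>\<^sub>M C"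
    using measurable_compose[OF measurable_Pair1'[OF c] u] by simp
  have ps [measurable]: "(\<lambda>(c, t). path_sum u \<phi> n c t) \<in> borel_measurable (C \<Otimes>\<^sub>M T)" for n
    by (rule measurable_path_sum[OF u \<phi>])
  have ps_c [measurable]: "(\<lambda>t. path_sum u \<phi> n c t) \<in> borel_measurable T" if "c \<in> space C" for n c
    using measurable_compose[OF measurable_Pair1'[OF that] ps] by simp
  have u' [measurable]: "(\<lambda>(c, e). u c e) \<in> C \<Otimes>\<^sub>M size_biased \<rightarrow>\<^sub>M C"
    by measurable
  have fp: "(\<lambda>(c, \<omega>). fold_path u n c \<omega>) \<in> C \<Otimes>\<^sub>M Spine \<rightarrow>\<^sub>M C" for n
    by (rule measurable_fold_path[OF u'])
  have fp_c: "(\<lambda>\<omega>. fold_path u n c \<omega>) \<in> Spine \<rightarrow>\<^sub>M C" if "c \<in> space C" for n c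
    using measurable_compose[OF measurable_Pair1'[OF that] fp] by simp
  have inC: "u c (r, i) \<in> space C" if "r \<in> space R" for r i
    using measurable_space[OF uc, of "(r, i)"] that by (simp add: space_pair_measure)
  let ?I = "\<lambda>e. \<integral>\<^sup>+\<omega>. \<phi> (fold_path u n (u c e) \<omega>) \<partial>Spine"
  have m2: "(\<lambda>(e, \<omega>). \<phi> (fold_path u n (u c e) \<omega>)) \<in> borel_measurable (size_biased \<Otimes>\<^sub>M Spine)"
  proof -
    have "(\<lambda>p. (u c (fst p), snd p)) \<in> size_biased \<Otimes>\<^sub>M Spine \<rightarrow>\<^sub>M C \<Otimes>\<^sub>M Spine"
      using uc by measurable
    from measurable_compose[OF measurable_compose[OF this fp] \<phi>] show ?thesis by (simp add: split_beta)
  qed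
  then have mI: "?I \<in> borel_measurable (R \<Otimes>\<^sub>M count_space UNIV)"
    using spine.P.borel_measurable_nn_integral_fst[OF m2] by (simp cong: measurable_cong_sets add: sets_size_biased)
  have "(\<integral>\<^sup>+t. path_sum u \<phi> (Suc n) c t \<partial>T)
      = (\<integral>\<^sup>+r. \<integral>\<^sup>+s. path_sum u \<phi> (Suc n) c (graft r s) \<partial>Ts \<partial>R)"
    by (rule nn_integral_graft[OF ps_c[OF c]])
  also have "\<dots> = (\<integral>\<^sup>+r. (\<Sum>i. ennreal (l i r) * ?I (r, i)) \<partial>R)"
  proof (rule nn_integral_cong)
    fix r assume r: "r \<in> space R"
    note [measurable] = ps_c[OF inC[OF r]]
    have "(\<integral>\<^sup>+s. path_sum u \<phi> (Suc n) c (graft r s) \<partial>Ts)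
        = (\<integral>\<^sup>+s. (\<Sum>i. ennreal (l i r) * path_sum u \<phi> n (u c (r, i)) (s i)) \<partial>Ts)"
      by simp
    also have "\<dots> = (\<Sum>i. \<integral>\<^sup>+s. ennreal (l i r) * path_sum u \<phi> n (u c (r, i)) (s i) \<partial>Ts)"
      by (rule nn_integral_suminf) measurable
    also have "\<dots> = (\<Sum>i. ennreal (l i r) * ?I (r, i))"
    proof (rule suminf_cong)
      fix i
      have "(\<integral>\<^sup>+s. ennreal (l i r) * path_sum u \<phi> n (u c (r, i)) (s i) \<partial>Ts)
          = ennreal (l i r) * (\<integral>\<^sup>+t. path_sum u \<phi> n (u c (r, i)) t \<partial>T)"
        by (subst nn_integral_cmult) (auto simp: nn_integral_component)
      then show "(\<integral>\<^sup>+s. ennreal (l i r) * path_sum u \<phi> n (u c (r, i)) (s i) \<partial>Ts) = ennreal (l i r) * ?I (r, i)"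
        by (simp add: Suc.IH[OF inC[OF r]])
    qed
    finally show "(\<integral>\<^sup>+s. path_sum u \<phi> (Suc n) c (graft r s) \<partial>Ts) = (\<Sum>i. ennreal (l i r) * ?I (r, i))" .
  qed
  also have "\<dots> = (\<integral>\<^sup>+e. ?I e \<partial>size_biased)"
    by (rule nn_integral_size_biased[OF mI, symmetric])
  also have "\<dots> = (\<integral>\<^sup>+p. \<phi> (fold_path u n (u c (fst p)) (snd p)) \<partial>(size_biased \<Otimes>\<^sub>M Spine))"
    using spine.P.nn_integral_fst[OF m2] by (simp add: split_beta')
  \<comment> \<open>Putting an independent first step in front of a spine yields a spine
    again.\<close>
  also have "\<dots> = (\<integral>\<^sup>+p. \<phi> (fold_path u (Suc n) c (case p of (e, \<omega>) \<Rightarrow> case_nat e \<omega>)) \<partial>(size_biased \<Otimes>\<^sub>M Spine))"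
    by (simp add: fold_path_Suc_shift split_beta del: fold_path.simps)
  also have "\<dots> = (\<integral>\<^sup>+\<omega>. \<phi> (fold_path u (Suc n) c \<omega>) \<partial>distr (size_biased \<Otimes>\<^sub>M Spine) Spine (\<lambda>(e, \<omega>). case_nat e \<omega>))"
    by (rule nn_integral_distr[symmetric]) (auto intro!: measurable_compose[OF fp_c[OF c] \<phi>] simp del: fold_path.simps)
  also have "\<dots> = (\<integral>\<^sup>+\<omega>. \<phi> (fold_path u (Suc n) c \<omega>) \<partial>Spine)"
    by (simp only: spine.PiM_iter)
  finally show ?case .
qed

lemma path_sum_add:
  "path_sum u (\<lambda>c. \<phi> c + \<psi> c) n c t = path_sum u \<phi> n c t + path_sum u \<psi> n c t"
  by (induction n arbitrary: c t) (simp_all add: distrib_left suminf_add[symmetric])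

lemma path_sum_one: "path_sum u (\<lambda>c. 1) n c t = W n t"
  by (induction n arbitrary: c t) simp_all

lemma path_sum_le_W: "(\<And>c. \<phi> c \<le> 1) \<Longrightarrow> path_sum u \<phi> n c t \<le> W n t"
  by (induction n arbitrary: c t) (auto intro!: suminf_le mult_left_mono)

lemma nn_integral_W: "(\<integral>\<^sup>+t. W n t \<partial>T) = 1"
proof -
  have "(\<integral>\<^sup>+t. path_sum (\<lambda>c e. c) (\<lambda>c. 1) n () t \<partial>T)
      = (\<integral>\<^sup>+\<omega>. 1 \<partial>Spine)"
    by (rule many_to_one[where C = "count_space UNIV"]) auto
  then show ?thesis by (simp add: path_sum_one spine.P.emeasure_space_1)
qed

section \<open>States carried along the ancestral line\<close>

definition root_weight :: "'r \<Rightarrow> real"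
  where "root_weight r = enn2real (total_weight r)"

lemma measurable_root_weight [measurable]: "root_weight \<in> borel_measurable R"
  unfolding root_weight_def[abs_def] by measurable

lemma root_weight_nonneg: "0 \<le> root_weight r"
  by (simp add: root_weight_def)

lemma ennreal_root_weight: "total_weight r < \<infinity> \<Longrightarrow> ennreal (root_weight r) = total_weight r"
  by (simp add: root_weight_def)

lemma l_le_root_weight:
  assumes "total_weight r < \<infinity>"
  shows "l i r \<le> root_weight r"
proof -
  have "ennreal (l i r) \<le> total_weight r"
    unfolding total_weight_def using sum_le_suminf[of "\<lambda>i. ennreal (l i r)" "{i}"] by simp
  then show ?thesis
    using assms by (simp add: ennreal_root_weight[symmetric] root_weight_nonneg)
qed

text \<open>
  With the state \<open>(y, s)\<close> started at \<open>(0, 1)\<close>, \<open>s\<close> is the weight of the current individual and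
  \<open>y\<close> the total weight of the siblings of its ancestors and of itself, so that \<open>y + s\<close> is the
  conditional expectation of \<open>W\<close> given the ancestral line under the size-biased law.
\<close>

definition sibling_update :: "real \<times> real \<Rightarrow> 'r \<times> nat \<Rightarrow> real \<times> real"
  where "sibling_update = (\<lambda>(y, s) (r, i). (y + s * (root_weight r - l i r), s * l i r))"

text \<open>Here \<open>s\<close> is again the weight of the current individual, while
  \<open>y\<close> is the largest total weight of a generation of siblings met so far, scaled by the
  weight of their parent.\<close>

definition max_update :: "real \<times> real \<Rightarrow> 'r \<times> nat \<Rightarrow> real \<times> real"
  where "max_update = (\<lambda>(y, s) (r, i). (max y (s * root_weight r), s * l i r))"

abbreviation "state_space \<equiv> borel \<Otimes>\<^sub>M borel :: (real \<times> real) measure"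

lemma measurable_l_comp [measurable (raw)]:
  assumes "f \<in> N \<rightarrow>\<^sub>M R" "g \<in> N \<rightarrow>\<^sub>M count_space UNIV"
  shows "(\<lambda>x. l (g x) (f x)) \<in> borel_measurable N"
  using measurable_compose[OF measurable_Pair[OF assms] measurable_l_pair] by simp

lemma measurable_sibling_update:
  "(\<lambda>(c, e). sibling_update c e) \<in> state_space \<Otimes>\<^sub>M (R \<Otimes>\<^sub>M count_space UNIV) \<rightarrow>\<^sub>M state_space"
  unfolding sibling_update_def split_beta' by measurable

lemma measurable_max_update:
  "(\<lambda>(c, e). max_update c e) \<in> state_space \<Otimes>\<^sub>M (R \<Otimes>\<^sub>M count_space UNIV) \<rightarrow>\<^sub>M state_space"
  unfolding max_update_def split_beta' by measurable

lemma measurable_path_sum_state: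
  assumes "(\<lambda>(c, e). u c e) \<in> state_space \<Otimes>\<^sub>M (R \<Otimes>\<^sub>M count_space UNIV) \<rightarrow>\<^sub>M state_space"
    and "\<phi> \<in> borel_measurable state_space"
  shows "path_sum u \<phi> n c \<in> borel_measurable T"
proof -
  have "c \<in> space state_space" by (simp add: space_pair_measure)
  from measurable_compose[OF measurable_Pair1'[OF this] measurable_path_sum[OF assms]]
  show ?thesis by simp
qed

section \<open>Tightness from the ancestral line\<close>

text \<open>Multiplying by \<open>path_sum\<close> amounts to size-biasing, under which
  \<open>W n\<close>, given the ancestral line, has mean \<open>y + s\<close> in the final state;
  the truncation keeps this mean below \<open>a\<close>. For the induction the tree is a subtree of
  weight \<open>s\<close>, and \<open>y\<close> is the mean of what has been left outside
  it.\<close>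

lemma second_moment_bound:
  assumes a: "0 \<le> a" and "0 \<le> y" "0 \<le> s"
  shows "(\<integral>\<^sup>+t. path_sum sibling_update (\<lambda>(y, s). if y + s \<le> a then 1 else 0) n (y, s) t *
    (ennreal y + ennreal s * W n t) \<partial>T) \<le> ennreal a"
  using assms(2,3)
proof (induction n arbitrary: y s)
  case 0
  have "(\<integral>\<^sup>+t. path_sum sibling_update (\<lambda>(y, s). if y + s \<le> a then 1 else 0) 0 (y, s) t *
      (ennreal y + ennreal s * W 0 t) \<partial>T) = (if y + s \<le> a then 1 else 0) * (ennreal y + ennreal s)"
    by (simp add: T.emeasure_space_1)
  also have "\<dots> \<le> ennreal a"
    using 0 by (auto simp: ennreal_plus[symmetric] simp del: ennreal_plus intro: ennreal_leI)
  finally show ?case .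
next
  case (Suc n)
  let ?\<phi> = "\<lambda>(y, s). if y + s \<le> a then 1 else 0 :: ennreal"
  let ?G = "path_sum sibling_update ?\<phi>"
  have \<phi>: "?\<phi> \<in> borel_measurable state_space" by measurable
  have G [measurable]: "?G n c \<in> borel_measurable T" for n c
    by (rule measurable_path_sum_state[OF measurable_sibling_update \<phi>])
  have "(\<integral>\<^sup>+t. ?G (Suc n) (y, s) t * (ennreal y + ennreal s * W (Suc n) t) \<partial>T)
      = (\<integral>\<^sup>+r. \<integral>\<^sup>+z. ?G (Suc n) (y, s) (graft r z) * (ennreal y + ennreal s * W (Suc n) (graft r z)) \<partial>Ts \<partial>R)"
    by (rule nn_integral_graft) measurable
  also have "\<dots> \<le> (\<integral>\<^sup>+r. total_weight r * ennreal a \<partial>R)"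
  proof (rule nn_integral_mono_AE, use AE_total_weight_finite in eventually_elim)
    fix r assume fin: "total_weight r < \<infinity>"
    define c where "c i = sibling_update (y, s) (r, i)" for i
    let ?H = "\<lambda>i z. ?G n (c i) (z i) * (ennreal y + ennreal s * (\<Sum>j. ennreal (l j r) * W n (z j)))"
    let ?h = "\<lambda>i j z. ennreal s * (if j = i then 0 else ennreal (l j r)) * (?G n (c i) (z i) * W n (z j))"
    have c: "c i = (y + s * (root_weight r - l i r), s * l i r)" for i
      by (simp add: c_def sibling_update_def)
    have rest: "(\<Sum>j. if j = i then 0 else ennreal (l j r)) = ennreal (root_weight r - l i r)" for i
    proof -
      have "total_weight r = (\<Sum>j. (if j = i then ennreal (l i r) else 0) + (if j = i then 0 else ennreal (l j r)))"
        unfolding total_weight_def by (intro suminf_cong) auto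
      also have "\<dots> = (\<Sum>j. if j = i then ennreal (l i r) else 0) + (\<Sum>j. if j = i then 0 else ennreal (l j r))"
        by (rule suminf_add[symmetric]) auto
      also have "(\<Sum>j. if j = i then ennreal (l i r) else 0) = ennreal (l i r)"
        by (rule suminf_indicator_unique) simp
      finally have "total_weight r - ennreal (l i r) = (\<Sum>j. if j = i then 0 else ennreal (l j r))"
        by simp
      then show ?thesis
        using fin l_nonneg by (simp add: ennreal_root_weight[symmetric] ennreal_minus)
    qed
    have inner: "(\<integral>\<^sup>+z. ?H i z \<partial>Ts) \<le> ennreal a" for i
    proof -
      let ?b = "ennreal s * ennreal (l i r)"
      \<comment> \<open>Child \<open>i\<close> lies on the ancestral line, and its own subtree is
        separated from those of its siblings.\<close>
      have "?H i z
          = ?G n (c i) (z i) * (ennreal y + ?b * W n (z i)) +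
            (\<Sum>j. ?h i j z)" for z
      proof -
        have "(\<Sum>j. ennreal (l j r) * W n (z j))
            = (\<Sum>j. (if j = i then ennreal (l i r) * W n (z i) else 0) + (if j = i then 0 else ennreal (l j r)) * W n (z j))"
          by (intro suminf_cong) auto
        also have "\<dots> = (\<Sum>j. if j = i then ennreal (l i r) * W n (z i) else 0) + (\<Sum>j. (if j = i then 0 else ennreal (l j r)) * W n (z j))"
          by (rule suminf_add[symmetric]) auto
        also have "(\<Sum>j. if j = i then ennreal (l i r) * W n (z i) else 0) = ennreal (l i r) * W n (z i)"
          by (rule suminf_indicator_unique) simp
        finally show ?thesis
          by (simp add: distrib_left mult.assoc mult.left_commute flip: ennreal_suminf_cmult)
      qed
      then have "(\<integral>\<^sup>+z. ?H i z \<partial>Ts)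
          = (\<integral>\<^sup>+z. ?G n (c i) (z i) * (ennreal y + ?b * W n (z i)) +
            (\<Sum>j. ?h i j z) \<partial>Ts)"
        by (simp only:)
      also have "\<dots> = (\<integral>\<^sup>+z. ?G n (c i) (z i) * (ennreal y + ?b * W n (z i)) \<partial>Ts) +
            (\<Sum>j. \<integral>\<^sup>+z. ?h i j z \<partial>Ts)"
        by (simp add: nn_integral_add nn_integral_suminf)
      also have "(\<integral>\<^sup>+z. ?G n (c i) (z i) * (ennreal y + ?b * W n (z i)) \<partial>Ts)
          = (\<integral>\<^sup>+t. ?G n (c i) t * (ennreal y + ?b * W n t) \<partial>T)"
        by (rule nn_integral_component) measurable
      also have "(\<Sum>j. \<integral>\<^sup>+z. ?h i j z \<partial>Ts)
          = (\<Sum>j. ennreal s * (if j = i then 0 else ennreal (l j r)) * (\<integral>\<^sup>+t. ?G n (c i) t \<partial>T))"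
      \<comment> \<open>For \<open>j \<noteq> i\<close> the two subtrees are independent and
        \<open>W n\<close> has mean 1, so a sibling contributes its weight alone.\<close>
      proof (rule suminf_cong)
        fix j
        have "(\<integral>\<^sup>+z. ?G n (c i) (z i) * W n (z j) \<partial>Ts) = (\<integral>\<^sup>+t. ?G n (c i) t \<partial>T)" if "j \<noteq> i"
          using that by (subst nn_integral_two_components) (auto simp: nn_integral_W)
        then show "(\<integral>\<^sup>+z. ?h i j z \<partial>Ts)
            = ennreal s * (if j = i then 0 else ennreal (l j r)) * (\<integral>\<^sup>+t. ?G n (c i) t \<partial>T)"
          by (simp add: nn_integral_cmult)
      qed
      also have "\<dots> = ennreal s * ennreal (root_weight r - l i r) * (\<integral>\<^sup>+t. ?G n (c i) t \<partial>T)"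
        unfolding rest[symmetric] by (simp only: ennreal_suminf_cmult ennreal_suminf_multc)
      also have "(\<integral>\<^sup>+t. ?G n (c i) t * (ennreal y + ?b * W n t) \<partial>T) + \<dots>
          = (\<integral>\<^sup>+t. ?G n (c i) t * (ennreal y + ?b * W n t) + ennreal s * ennreal (root_weight r - l i r) * ?G n (c i) t \<partial>T)"
        by (subst nn_integral_cmult[OF G, symmetric], rule nn_integral_add[symmetric]) measurable
      \<comment> \<open>The collected sibling weights are what \<open>sibling_update\<close> adds to
        \<open>y\<close>, so the integrand is the one of the induction hypothesis at the state
        \<open>c i\<close>.\<close>
      also have "\<dots> = (\<integral>\<^sup>+t. ?G n (c i) t * (ennreal (fst (c i)) + ennreal (snd (c i)) * W n t) \<partial>T)"
        using Suc.prems l_le_root_weight[OF fin, of i] l_nonneg[of i r]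
        by (intro nn_integral_cong) (simp add: c ennreal_plus ennreal_mult distrib_left distrib_right ac_simps)
      also have "\<dots> \<le> ennreal a"
        using Suc.IH[of "fst (c i)" "snd (c i)"] Suc.prems l_le_root_weight[OF fin, of i] l_nonneg[of i r]
        by (simp add: c)
      finally show ?thesis .
    qed
    have "(\<integral>\<^sup>+z. ?G (Suc n) (y, s) (graft r z) * (ennreal y + ennreal s * W (Suc n) (graft r z)) \<partial>Ts)
        = (\<integral>\<^sup>+z. (\<Sum>i. ennreal (l i r) * (?H i z)) \<partial>Ts)"
      by (simp add: c_def mult.assoc flip: ennreal_suminf_multc)
    also have "\<dots> = (\<Sum>i. ennreal (l i r) * (\<integral>\<^sup>+z. ?H i z \<partial>Ts))"
      by (simp add: nn_integral_suminf nn_integral_cmult)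
    also have "\<dots> \<le> (\<Sum>i. ennreal (l i r) * ennreal a)"
      by (intro suminf_le mult_left_mono inner) auto
    also have "\<dots> = total_weight r * ennreal a"
      by (simp add: total_weight_def)
    finally show "(\<integral>\<^sup>+z. ?G (Suc n) (y, s) (graft r z) * (ennreal y + ennreal s * W (Suc n) (graft r z)) \<partial>Ts)
        \<le> total_weight r * ennreal a" .
  qed
  also have "\<dots> = ennreal a"
    by (simp add: nn_integral_multc nn_integral_total_weight)
  finally show ?case .
qed

text \<open>\<open>W n\<close> splits according to whether the final state exceeds \<open>a\<close>.
  By \<open>many_to_one\<close> the first part has as mean the spine probability of exceeding
  \<open>a\<close>. Where \<open>W n > K\<close>, the second part is at most itself times
  \<open>W n / K\<close>, and \<open>second_moment_bound\<close> applies.\<close>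

lemma truncated_W_le:
  assumes a: "0 \<le> a" and K: "0 < K"
  shows "(\<integral>\<^sup>+t. W n t * (if ennreal K < W n t then 1 else 0) \<partial>T)
    \<le> (\<integral>\<^sup>+\<omega>. (if a < fst (fold_path sibling_update n (0, 1) \<omega>) + snd (fold_path sibling_update n (0, 1) \<omega>) then 1 else 0) \<partial>Spine)
      + ennreal (a / K)"
proof -
  let ?w = "\<lambda>t. W n t * (if ennreal K < W n t then 1 else 0)"
  let ?\<phi> = "\<lambda>(y, s). if y + s \<le> a then 1 else 0 :: ennreal"
  let ?\<psi> = "\<lambda>(y, s). if a < y + s then 1 else 0 :: ennreal"
  let ?G = "\<lambda>\<phi>. path_sum sibling_update \<phi> n (0, 1)"
  have \<phi>: "?\<phi> \<in> borel_measurable state_space" and \<psi>: "?\<psi> \<in> borel_measurable state_space" by measurable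
  have [measurable]: "?G ?\<phi> \<in> borel_measurable T" "?G ?\<psi> \<in> borel_measurable T"
    by (rule measurable_path_sum_state[OF measurable_sibling_update \<phi>] measurable_path_sum_state[OF measurable_sibling_update \<psi>])+
  have "(\<lambda>c. ?\<psi> c + ?\<phi> c) = (\<lambda>c. 1)" by (auto simp: fun_eq_iff)
  then have W: "W n t = ?G ?\<psi> t + ?G ?\<phi> t" for t
    by (simp only: path_sum_add[symmetric] path_sum_one)
  have "?w t \<le> ?G ?\<psi> t + ?G ?\<phi> t * W n t * inverse (ennreal K)" for t
  proof (cases "ennreal K < W n t")
    case True
    have "1 = ennreal K * inverse (ennreal K)"
      using K by (simp add: inverse_ennreal ennreal_mult'[symmetric])
    also have "\<dots> \<le> W n t * inverse (ennreal K)" using True by (intro mult_right_mono) auto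
    finally have "?G ?\<phi> t * 1 \<le> ?G ?\<phi> t * (W n t * inverse (ennreal K))" by (rule mult_left_mono) simp
    then show ?thesis using True by (subst (1) W) (simp add: mult.assoc add_left_mono)
  qed simp
  then have "(\<integral>\<^sup>+t. ?w t \<partial>T)
      \<le> (\<integral>\<^sup>+t. ?G ?\<psi> t + ?G ?\<phi> t * W n t * inverse (ennreal K) \<partial>T)"
    by (intro nn_integral_mono)
  also have "\<dots> = (\<integral>\<^sup>+t. ?G ?\<psi> t \<partial>T) + (\<integral>\<^sup>+t. ?G ?\<phi> t * W n t \<partial>T) * inverse (ennreal K)"
    by (simp add: nn_integral_add nn_integral_multc)
  also have "\<dots> \<le> (\<integral>\<^sup>+t. ?G ?\<psi> t \<partial>T) + ennreal a * inverse (ennreal K)"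
    using second_moment_bound[OF a, of 0 1 n] by (intro add_left_mono mult_right_mono) auto
  also have "ennreal a * inverse (ennreal K) = ennreal (a / K)"
    using K a by (simp add: inverse_ennreal ennreal_mult'[symmetric] divide_inverse)
  also have "(\<integral>\<^sup>+t. ?G ?\<psi> t \<partial>T) = (\<integral>\<^sup>+\<omega>. ?\<psi> (fold_path sibling_update n (0, 1) \<omega>) \<partial>Spine)"
    by (rule many_to_one[OF measurable_sibling_update \<psi>]) (simp add: space_pair_measure)
  finally show ?thesis
    by (simp add: split_beta)
qed

section \<open>A maximal inequality along ancestral lines\<close>

text \<open>Given the root label, the probability is at most \<open>s / K\<close> times the total
  weight of the children: if the root already exceeds \<open>K\<close>, this bound is at least 1;
  otherwise it is the union bound over the children. The total weight has mean one.\<close>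

lemma exceedance_probability_le:
  assumes K: "0 < K" and "0 \<le> y" "0 \<le> s"
  shows "(\<integral>\<^sup>+t. (if path_sum max_update (\<lambda>(y, s). if K < y then 1 else 0) n (y, s) t \<noteq> 0 then 1 else 0) \<partial>T)
    \<le> (if K < y then 1 else ennreal (s / K))"
  using assms(2,3)
proof (induction n arbitrary: y s)
  case 0
  then show ?case by (auto simp: T.emeasure_space_1)
next
  case (Suc n)
  let ?\<phi> = "\<lambda>(y, s). if K < y then 1 else 0 :: ennreal"
  let ?G = "path_sum max_update ?\<phi>"
  let ?one = "\<lambda>x :: ennreal. if x \<noteq> 0 then 1 else 0 :: ennreal"
  have \<phi>: "?\<phi> \<in> borel_measurable state_space" by measurable
  have G [measurable]: "?G n c \<in> borel_measurable T" for n c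
    by (rule measurable_path_sum_state[OF measurable_max_update \<phi>])
  show ?case
  proof (cases "K < y")
    case True
    have "(\<integral>\<^sup>+t. ?one (?G (Suc n) (y, s) t) \<partial>T) \<le> (\<integral>\<^sup>+t. 1 \<partial>T)" by (intro nn_integral_mono) auto
    then show ?thesis using True by (simp add: T.emeasure_space_1)
  next
    case False
    have "(\<integral>\<^sup>+t. ?one (?G (Suc n) (y, s) t) \<partial>T) = (\<integral>\<^sup>+r. \<integral>\<^sup>+z. ?one (?G (Suc n) (y, s) (graft r z)) \<partial>Ts \<partial>R)"
      by (rule nn_integral_graft) measurable
    also have "\<dots> \<le> (\<integral>\<^sup>+r. ennreal (s / K) * total_weight r \<partial>R)"
    proof (rule nn_integral_mono_AE, use AE_total_weight_finite in eventually_elim)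
      fix r assume fin: "total_weight r < \<infinity>"
      define c where "c i = max_update (y, s) (r, i)" for i
      have c: "c i = (max y (s * root_weight r), s * l i r)" for i
        by (simp add: c_def max_update_def)
      show "(\<integral>\<^sup>+z. ?one (?G (Suc n) (y, s) (graft r z)) \<partial>Ts) \<le> ennreal (s / K) * total_weight r"
      proof (cases "K < s * root_weight r")
        case True
        have "(\<integral>\<^sup>+z. ?one (?G (Suc n) (y, s) (graft r z)) \<partial>Ts) \<le> (\<integral>\<^sup>+z. 1 \<partial>Ts)" by (intro nn_integral_mono) auto
        also have "\<dots> = ennreal 1" by (simp add: Ts.P.emeasure_space_1)
        also have "\<dots> \<le> ennreal (s / K * root_weight r)"
          using True K by (intro ennreal_leI) (simp add: field_simps)
        also have "\<dots> = ennreal (s / K) * total_weight r"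
          unfolding ennreal_root_weight[OF fin, symmetric]
          using Suc.prems K by (intro ennreal_mult) (auto simp: root_weight_nonneg)
        finally show ?thesis .
      next
        case small: False
        have "?one (?G (Suc n) (y, s) (graft r z)) \<le> (\<Sum>i. (if l i r = 0 then 0 else 1) * ?one (?G n (c i) (z i)))" for z
        proof (cases "?G (Suc n) (y, s) (graft r z) = 0")
          case False
          have "\<exists>i. ennreal (l i r) * ?G n (c i) (z i) \<noteq> 0"
          proof (rule ccontr)
            assume "\<not> (\<exists>i. ennreal (l i r) * ?G n (c i) (z i) \<noteq> 0)"
            then have "ennreal (l i r) * ?G n (c i) (z i) = 0" for i by blast
            then have "(\<Sum>i. ennreal (l i r) * ?G n (c i) (z i)) = 0" by (simp only: suminf_zero)
            then show False using False by (simp add: c_def)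
          qed
          then obtain i where "ennreal (l i r) \<noteq> 0" and "?G n (c i) (z i) \<noteq> 0"
            unfolding mult_eq_0_iff by blast
          moreover from this(1) have "l i r \<noteq> 0" by (intro notI) simp
          ultimately have "1 = (\<Sum>i\<in>{i}. (if l i r = 0 then 0 else 1) * ?one (?G n (c i) (z i)))" by simp
          also have "\<dots> \<le> (\<Sum>i. (if l i r = 0 then 0 else 1) * ?one (?G n (c i) (z i)))"
            by (rule sum_le_suminf) auto
          finally show ?thesis using False by simp
        qed simp
        then have "(\<integral>\<^sup>+z. ?one (?G (Suc n) (y, s) (graft r z)) \<partial>Ts)
            \<le> (\<integral>\<^sup>+z. (\<Sum>i. (if l i r = 0 then 0 else 1) * ?one (?G n (c i) (z i))) \<partial>Ts)"
          by (intro nn_integral_mono)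
        also have "\<dots> = (\<Sum>i. (if l i r = 0 then 0 else 1) * (\<integral>\<^sup>+z. ?one (?G n (c i) (z i)) \<partial>Ts))"
          by (subst nn_integral_suminf) (auto simp: nn_integral_cmult)
        also have "\<dots> = (\<Sum>i. (if l i r = 0 then 0 else 1) * (\<integral>\<^sup>+t. ?one (?G n (c i) t) \<partial>T))"
        proof (rule suminf_cong)
          fix i
          have "(\<integral>\<^sup>+z. ?one (?G n (c i) (z i)) \<partial>Ts) = (\<integral>\<^sup>+t. ?one (?G n (c i) t) \<partial>T)"
            by (rule nn_integral_component[of "\<lambda>t. ?one (?G n (c i) t)"]) measurable
          then show "(if l i r = 0 then 0 else 1) * (\<integral>\<^sup>+z. ?one (?G n (c i) (z i)) \<partial>Ts)
            = (if l i r = 0 then 0 else 1) * (\<integral>\<^sup>+t. ?one (?G n (c i) t) \<partial>T)" by (simp only:)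
        qed
        also have "\<dots> \<le> (\<Sum>i. ennreal (s / K) * ennreal (l i r))"
        proof (intro suminf_le)
          fix i
          have "0 \<le> max y (s * root_weight r)" "0 \<le> s * l i r" "\<not> K < max y (s * root_weight r)"
            using Suc.prems False small l_nonneg[of i r] by auto
          then have "(\<integral>\<^sup>+t. ?one (?G n (c i) t) \<partial>T) \<le> ennreal (s * l i r / K)"
            using Suc.IH[of "max y (s * root_weight r)" "s * l i r"] by (simp only: c if_False)
          also have "\<dots> = ennreal (s / K) * ennreal (l i r)"
            using Suc.prems K l_nonneg[of i r] by (simp add: ennreal_mult''[symmetric])
          finally show "(if l i r = 0 then 0 else 1) * (\<integral>\<^sup>+t. ?one (?G n (c i) t) \<partial>T) \<le> ennreal (s / K) * ennreal (l i r)"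
            by auto
        qed auto
        also have "\<dots> = ennreal (s / K) * total_weight r"
          by (simp add: total_weight_def)
        finally show ?thesis .
      qed
    qed
    also have "\<dots> = ennreal (s / K)"
      by (simp add: nn_integral_cmult nn_integral_total_weight)
    finally show ?thesis using False by simp
  qed
qed

text \<open>By \<open>many_to_one\<close> the spine probability is the mean of a sum
  \<open>?G \<le> W n\<close>. Where \<open>W n > K'\<close>, it is charged to the tail of
  \<open>W n\<close>; elsewhere it is at most \<open>K'\<close> and nonzero with probability at most
  \<open>1 / K\<close>.\<close>

lemma spine_maximum_le:
  assumes K: "0 < K" and K': "0 \<le> K'"
  shows "(\<integral>\<^sup>+\<omega>. (if K < fst (fold_path max_update n (0, 1) \<omega>) then 1 else 0) \<partial>Spine)
    \<le> (\<integral>\<^sup>+t. W n t * (if ennreal K' < W n t then 1 else 0) \<partial>T) + ennreal (K' / K)"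
proof -
  let ?w = "\<lambda>t. W n t * (if ennreal K' < W n t then 1 else 0)"
  let ?\<phi> = "\<lambda>(y, s). if K < y then 1 else 0 :: ennreal"
  let ?G = "path_sum max_update ?\<phi> n (0, 1)"
  have \<phi>: "?\<phi> \<in> borel_measurable state_space" by measurable
  have G [measurable]: "?G \<in> borel_measurable T"
    by (rule measurable_path_sum_state[OF measurable_max_update \<phi>])
  have "(\<integral>\<^sup>+\<omega>. (if K < fst (fold_path max_update n (0, 1) \<omega>) then 1 else 0) \<partial>Spine)
      = (\<integral>\<^sup>+\<omega>. ?\<phi> (fold_path max_update n (0, 1) \<omega>) \<partial>Spine)"
    by (simp add: split_beta)
  also have "\<dots> = (\<integral>\<^sup>+t. ?G t \<partial>T)"
    by (rule many_to_one[OF measurable_max_update \<phi>, symmetric]) (simp add: space_pair_measure)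
  also have "\<dots> \<le> (\<integral>\<^sup>+t. ?w t + ennreal K' * (if ?G t \<noteq> 0 then 1 else 0) \<partial>T)"
  proof (rule nn_integral_mono)
    fix t
    have "?G t \<le> W n t" by (rule path_sum_le_W) auto
    then show "?G t \<le> ?w t + ennreal K' * (if ?G t \<noteq> 0 then 1 else 0)"
      by (auto simp: not_less add_increasing2)
  qed
  also have "\<dots> = (\<integral>\<^sup>+t. ?w t \<partial>T) + ennreal K' * (\<integral>\<^sup>+t. (if ?G t \<noteq> 0 then 1 else 0) \<partial>T)"
    by (simp add: nn_integral_add nn_integral_cmult)
  also have "\<dots> \<le> (\<integral>\<^sup>+t. ?w t \<partial>T) + ennreal K' * ennreal (1 / K)"
    using exceedance_probability_le[OF K, of 0 1 n] K by (intro add_left_mono mult_left_mono) auto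
  also have "ennreal K' * ennreal (1 / K) = ennreal (K' / K)"
    using K K' by (simp add: ennreal_mult'[symmetric])
  finally show ?thesis .
qed

end

section \<open>Uniform integrability of the weighted branching martingale\<close>

context weighted_branching
begin

text \<open>Size-biased picks have positive weight almost surely, so the value of \<open>ln\<close>
  at 0 does not matter.\<close>

definition step :: "'r \<times> nat \<Rightarrow> real"
  where "step e = - ln (l (snd e) (fst e))"

definition W_tail :: "real \<Rightarrow> ennreal"
  where "W_tail K = (SUP n. \<integral>\<^sup>+t. W n t * (if ennreal K < W n t then 1 else 0) \<partial>T)"

lemma measurable_step [measurable]: "step \<in> borel_measurable size_biased"
  unfolding step_def[abs_def] by measurable

sublocale spine: random_walk size_biased step
  by unfold_locales (rule measurable_step)

text \<open>A child weighs at most as much as its whole generation. The second part is the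
  hypothesis on \<open>w\<close> in \<open>AE_perpetuity_bounded\<close>.\<close>

lemma AE_spine_step:
  "AE e in size_biased. exp (- step e) = l (snd e) (fst e) \<and> exp (- step e) \<le> root_weight (fst e)"
proof -
  have "AE e in size_biased. total_weight (fst e) < \<infinity>"
    by (rule AE_size_biased_root[OF AE_total_weight_finite]) measurable
  with AE_size_biased_pos show ?thesis
  proof eventually_elim
    case (elim e)
    then show ?case using l_le_root_weight[of "fst e" "snd e"] by (simp add: step_def)
  qed
qed

abbreviation "spine_sum n \<omega> \<equiv> fold_path sibling_update n (0, 1) \<omega>"
abbreviation "spine_max n \<omega> \<equiv> fold_path max_update n (0, 1) \<omega>"
abbreviation "spine_term k \<omega> \<equiv> exp (- psum step k \<omega>) * root_weight (fst (\<omega> k))"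
abbreviation "step_consistent \<omega> \<equiv>
  \<forall>k. exp (- step (\<omega> k)) = l (snd (\<omega> k)) (fst (\<omega> k)) \<and> exp (- step (\<omega> k)) \<le> root_weight (fst (\<omega> k))"
abbreviation "log_moment \<equiv> \<integral>\<^sup>+e. ennreal (max 0 (ln (root_weight (fst e)))) /
  spine.trunc_mean (max 0 (ln (root_weight (fst e)))) \<partial>size_biased"

lemma AE_spine_steps:
  "AE \<omega> in Spine. step_consistent \<omega>"
  by (subst AE_all_countable, rule allI, rule spine.AE_component[OF UNIV_I AE_spine_step])

lemma fold_path_weight:
  assumes "\<And>k. exp (- step (\<omega> k)) = l (snd (\<omega> k)) (fst (\<omega> k))"
  shows "snd (spine_sum n \<omega>) = exp (- psum step n \<omega>)"
    and "snd (spine_max n \<omega>) = exp (- psum step n \<omega>)"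
  by (induction n)
    (auto simp: sibling_update_def max_update_def split_beta assms[symmetric] psum_Suc exp_add[symmetric])

lemma fold_path_sibling_le:
  assumes l: "\<And>k. exp (- step (\<omega> k)) = l (snd (\<omega> k)) (fst (\<omega> k))"
  shows "fst (spine_sum n \<omega>) + snd (spine_sum n \<omega>)
    \<le> 1 + (\<Sum>k<n. spine_term k \<omega>)"
proof -
  have fst: "fst (spine_sum n \<omega>) \<le> (\<Sum>k<n. spine_term k \<omega>)" for n
  proof (induction n)
    case (Suc n)
    have "fst (spine_sum (Suc n) \<omega>)
        = fst (spine_sum n \<omega>) + exp (- psum step n \<omega>) * (root_weight (fst (\<omega> n)) - l (snd (\<omega> n)) (fst (\<omega> n)))"
      using fold_path_weight(1)[OF l, of n] by (simp add: sibling_update_def split_beta)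
    also have "exp (- psum step n \<omega>) * (root_weight (fst (\<omega> n)) - l (snd (\<omega> n)) (fst (\<omega> n)))
        \<le> spine_term n \<omega>"
      by (intro mult_left_mono) (auto simp: l_nonneg)
    finally show ?case using Suc by simp
  qed simp
  show ?thesis
  proof (cases n)
    case (Suc m)
    \<comment> \<open>In the last generation the weight of the spine child and that of its siblings
      recombine to the full \<open>spine_term m\<close>.\<close>
    have "fst (spine_sum (Suc m) \<omega>) + snd (spine_sum (Suc m) \<omega>)
        = fst (spine_sum m \<omega>) + spine_term m \<omega>"
      using fold_path_weight(1)[OF l, of m] by (simp add: sibling_update_def split_beta algebra_simps)
    then show ?thesis using fst[of m] Suc by simp
  qed simp
qed

lemma fold_path_max_iff:
  assumes l: "\<And>k. exp (- step (\<omega> k)) = l (snd (\<omega> k)) (fst (\<omega> k))" and K: "0 \<le> K"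
  shows "K < fst (spine_max n \<omega>) \<longleftrightarrow>
    (\<exists>k<n. K < spine_term k \<omega>)"
proof (induction n)
  case (Suc n)
  have "fst (spine_max (Suc n) \<omega>)
      = max (fst (spine_max n \<omega>)) (spine_term n \<omega>)"
    using fold_path_weight(2)[OF l, of n] by (simp add: max_update_def split_beta)
  then show ?case using Suc by (auto simp: less_max_iff_disj less_Suc_eq)
qed (use K in auto)

text \<open>The partial sums of the perpetuity are almost surely bounded, so the probability
  \<open>h j\<close> that one of them exceeds \<open>j - 1\<close> is small for large
  \<open>j\<close>. With \<open>j\<close> fixed, the remaining term \<open>j / K\<close> vanishes as
  \<open>K\<close> grows.\<close>

lemma W_tail_tendsto_0:
  assumes drift: "spine.drifts_to_infinity"
    and fin: "log_moment < \<infinity>"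
  shows "(W_tail \<longlongrightarrow> 0) at_top"
proof (rule order_tendstoI)
  define Y where "Y n \<omega> = (\<Sum>k<n. spine_term k \<omega>)" for n \<omega>
  have [measurable]: "Y n \<in> borel_measurable Spine" for n unfolding Y_def[abs_def] by measurable
  define h where "h j = (\<integral>\<^sup>+\<omega>. (if \<exists>n. real j < 1 + Y n \<omega> then 1 else 0) \<partial>Spine)" for j :: nat
  have "h \<longlonglongrightarrow> (\<integral>\<^sup>+\<omega>. 0 \<partial>Spine)"
    unfolding h_def
  proof (rule nn_integral_dominated_convergence[where w = "\<lambda>_. 1"])
    have "AE \<omega> in Spine. \<exists>C. \<forall>n. Y n \<omega> \<le> C"
      unfolding Y_def
      using AE_spine_step by (intro spine.AE_perpetuity_bounded[OF drift _ _ fin]) auto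
    then show "AE \<omega> in Spine. (\<lambda>j. if \<exists>n. real j < 1 + Y n \<omega> then 1 else 0 :: ennreal) \<longlonglongrightarrow> 0"
    proof eventually_elim
      case (elim \<omega>)
      then obtain C where C: "\<And>n. Y n \<omega> \<le> C" by auto
      obtain j0 :: nat where j0: "1 + C \<le> real j0" using real_arch_simple by blast
      have "(if \<exists>n. real j < 1 + Y n \<omega> then 1 else 0 :: ennreal) = 0" if "j \<ge> j0" for j
      proof -
        have "\<not> real j < 1 + Y n \<omega>" for n
          using C[of n] j0 of_nat_mono[OF that, where 'a = real] by linarith
        then show ?thesis by simp
      qed
      then have "\<forall>\<^sub>F j in sequentially. (if \<exists>n. real j < 1 + Y n \<omega> then 1 else 0 :: ennreal) = 0"
        unfolding eventually_sequentially by blast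
      then show ?case by (rule tendsto_eventually)
    qed
  qed (auto simp: spine.P.emeasure_space_1)
  then have h: "h \<longlonglongrightarrow> 0" by simp
  have tail: "W_tail K \<le> h j + ennreal (real j / K)" if "0 < K" for K j
    unfolding W_tail_def
  proof (rule SUP_least)
    fix n
    have "(\<integral>\<^sup>+\<omega>. (if real j < fst (spine_sum n \<omega>) + snd (spine_sum n \<omega>) then 1 else 0) \<partial>Spine) \<le> h j"
      unfolding h_def
    proof (rule nn_integral_mono_AE, use AE_spine_steps in eventually_elim)
      fix \<omega> :: "nat \<Rightarrow> 'r \<times> nat" assume "step_consistent \<omega>"
      then have "fst (spine_sum n \<omega>) + snd (spine_sum n \<omega>) \<le> 1 + Y n \<omega>"
        unfolding Y_def by (intro fold_path_sibling_le) auto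
      then show "(if real j < fst (spine_sum n \<omega>) + snd (spine_sum n \<omega>) then 1 else 0)
          \<le> (if \<exists>n. real j < 1 + Y n \<omega> then 1 else 0 :: ennreal)"
        by (auto intro: less_le_trans)
    qed
    then show "(\<integral>\<^sup>+t. W n t * (if ennreal K < W n t then 1 else 0) \<partial>T) \<le> h j + ennreal (real j / K)"
      by (intro order_trans[OF truncated_W_le[of "real j" K n]] add_right_mono) (use that in auto)
  qed
  fix e :: ennreal assume "0 < e"
  then obtain c where c: "0 < c" "c < e" using dense by blast
  then obtain \<delta> where \<delta>: "c = ennreal \<delta>" "0 < \<delta>"
    by (cases c) (auto simp: top_unique)
  have "\<forall>\<^sub>F j in sequentially. h j < ennreal (\<delta> / 2)"
    using h \<delta> by (intro order_tendstoD(2)) auto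
  then obtain j where j: "h j < ennreal (\<delta> / 2)"
    by (metis eventually_sequentially order_refl)
  show "\<forall>\<^sub>F K in at_top. W_tail K < e"
    unfolding eventually_at_top_linorder
  proof (intro exI allI impI)
    fix K assume K: "max 1 (2 * real j / \<delta>) \<le> K"
    then have "0 < K" by linarith
    have "2 * real j \<le> K * \<delta>" using K \<delta> by (simp add: pos_divide_le_eq)
    then have jK: "real j / K \<le> \<delta> / 2" using \<open>0 < K\<close> by (simp add: pos_divide_le_eq mult.commute)
    have "W_tail K \<le> ennreal (\<delta> / 2) + ennreal (\<delta> / 2)"
      using j by (intro order_trans[OF tail[OF \<open>0 < K\<close>, of j]] add_mono ennreal_leI jK) auto
    also have "\<dots> = c" using \<delta> by (simp flip: ennreal_plus)
    finally show "W_tail K < e" using c by simp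
  qed
qed simp

text \<open>First \<open>K'\<close> is chosen so that the tail beyond \<open>K'\<close> is small,
  then \<open>K\<close> so large that \<open>K' / K\<close> is small. The bound of
  \<open>spine_maximum_le\<close> is then uniform in \<open>n\<close> and passes to the supremum by
  monotone convergence.\<close>

lemma spine_supremum_tight:
  assumes ui: "(W_tail \<longlongrightarrow> 0) at_top" and \<epsilon>: "0 < \<epsilon>"
  shows "\<exists>K0. \<forall>K\<ge>K0. (\<integral>\<^sup>+\<omega>. (if \<exists>k. K < spine_term k \<omega> then 1 else 0) \<partial>Spine) < ennreal \<epsilon>"
proof -
  have "\<forall>\<^sub>F K in at_top. W_tail K < ennreal (\<epsilon> / 2)"
    using ui \<epsilon> by (intro order_tendstoD(2)) auto
  then obtain K1 where K1: "\<And>K. K1 \<le> K \<Longrightarrow> W_tail K < ennreal (\<epsilon> / 2)"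
    unfolding eventually_at_top_linorder by blast
  define K' where "K' = max 0 K1"
  have K': "0 \<le> K'" "W_tail K' < ennreal (\<epsilon> / 2)" using K1[of K'] by (auto simp: K'_def)
  show ?thesis
  proof (intro exI allI impI)
    fix K assume K: "max 1 (2 * K' / \<epsilon>) \<le> K"
    then have "0 < K" by linarith
    have "2 * K' \<le> K * \<epsilon>" using K \<epsilon> by (simp add: pos_divide_le_eq)
    then have K'K: "K' / K \<le> \<epsilon> / 2" using \<open>0 < K\<close> by (simp add: pos_divide_le_eq mult.commute)
    let ?E = "\<lambda>k \<omega>. K < spine_term k \<omega>"
    have "(\<integral>\<^sup>+\<omega>. (if \<exists>k. ?E k \<omega> then 1 else 0) \<partial>Spine) = (\<integral>\<^sup>+\<omega>. (SUP n. if \<exists>k<n. ?E k \<omega> then 1 else 0) \<partial>Spine)"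
    proof (rule nn_integral_cong)
      fix \<omega>
      show "(if \<exists>k. ?E k \<omega> then 1 else 0 :: ennreal) = (SUP n. if \<exists>k<n. ?E k \<omega> then 1 else 0)"
      proof (cases "\<exists>k. ?E k \<omega>")
        case True
        then obtain m where m: "?E m \<omega>" by auto
        have "(if \<exists>k<Suc m. ?E k \<omega> then 1 else 0) \<le> (SUP n. if \<exists>k<n. ?E k \<omega> then 1 else 0 :: ennreal)"
          by (rule SUP_upper) simp
        moreover have "\<exists>k<Suc m. ?E k \<omega>" using m by blast
        ultimately have "1 \<le> (SUP n. if \<exists>k<n. ?E k \<omega> then 1 else 0 :: ennreal)"
          by (simp only: if_True)
        moreover have "(SUP n. if \<exists>k<n. ?E k \<omega> then 1 else 0 :: ennreal) \<le> 1" by (rule SUP_least) auto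
        ultimately show ?thesis using True by (simp add: antisym)
      qed simp
    qed
    also have "\<dots> = (SUP n. \<integral>\<^sup>+\<omega>. (if \<exists>k<n. ?E k \<omega> then 1 else 0) \<partial>Spine)"
    proof (rule nn_integral_monotone_convergence_SUP)
      show "incseq (\<lambda>n \<omega>. if \<exists>k<n. ?E k \<omega> then 1 else 0 :: ennreal)"
        by (auto simp: incseq_def le_fun_def intro: less_le_trans)
    qed measurable
    also have "\<dots> \<le> W_tail K' + ennreal (K' / K)"
    proof (rule SUP_least)
      fix n
      have "(\<integral>\<^sup>+\<omega>. (if \<exists>k<n. ?E k \<omega> then 1 else 0) \<partial>Spine)
          = (\<integral>\<^sup>+\<omega>. (if K < fst (spine_max n \<omega>) then 1 else 0) \<partial>Spine)"
      proof (rule nn_integral_cong_AE, use AE_spine_steps in eventually_elim)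
        fix \<omega> :: "nat \<Rightarrow> 'r \<times> nat" assume "step_consistent \<omega>"
        then have "K < fst (spine_max n \<omega>) \<longleftrightarrow> (\<exists>k<n. ?E k \<omega>)"
          using \<open>0 < K\<close> by (intro fold_path_max_iff) auto
        then show "(if \<exists>k<n. ?E k \<omega> then 1 else 0) = (if K < fst (spine_max n \<omega>) then 1 else 0 :: ennreal)"
          by simp
      qed
      also have "\<dots> \<le> (\<integral>\<^sup>+t. W n t * (if ennreal K' < W n t then 1 else 0) \<partial>T) + ennreal (K' / K)"
        by (rule spine_maximum_le) fact+
      also have "\<dots> \<le> W_tail K' + ennreal (K' / K)"
        unfolding W_tail_def by (intro add_right_mono SUP_upper) auto
      finally show "(\<integral>\<^sup>+\<omega>. (if \<exists>k<n. ?E k \<omega> then 1 else 0) \<partial>Spine) \<le> W_tail K' + ennreal (K' / K)" .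
    qed
    also have "\<dots> \<le> ennreal (\<epsilon> / 2) + W_tail K'"
      using K'K by (subst add.commute) (intro add_right_mono ennreal_leI)
    also have "\<dots> < ennreal (\<epsilon> / 2) + ennreal (\<epsilon> / 2)"
      using K'(2) by (subst ennreal_add_left_cancel_less) auto
    also have "\<dots> = ennreal \<epsilon>" using \<epsilon> by (simp flip: ennreal_plus)
    finally show "(\<integral>\<^sup>+\<omega>. (if \<exists>k. ?E k \<omega> then 1 else 0) \<partial>Spine) < ennreal \<epsilon>" .
  qed
qed

text \<open>A spine child weighs at most as much as its generation, so
  \<open>exp (- psum step (Suc k) \<omega>)\<close> is at most \<open>spine_term k \<omega>\<close>,
  whose supremum over \<open>k\<close> is almost surely finite by tightness.\<close>

lemma spine_walk_bounded_below:
  assumes ui: "(W_tail \<longlongrightarrow> 0) at_top"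
  shows "AE \<omega> in Spine. \<exists>c. \<forall>n. c \<le> psum step n \<omega>"
proof -
  let ?E = "\<lambda>K k \<omega>. K < spine_term k \<omega>"
  let ?N = "\<lambda>\<omega>. if \<forall>j::nat. \<exists>k. ?E (real j) k \<omega> then 1 else 0 :: ennreal"
  have small: "(\<integral>\<^sup>+\<omega>. ?N \<omega> \<partial>Spine) \<le> ennreal \<epsilon>" if \<epsilon>: "0 < \<epsilon>" for \<epsilon>
  proof -
    obtain K0 where K0: "\<And>K. K \<ge> K0 \<Longrightarrow> (\<integral>\<^sup>+\<omega>. (if \<exists>k. ?E K k \<omega> then 1 else 0) \<partial>Spine) < ennreal \<epsilon>"
      using spine_supremum_tight[OF ui \<epsilon>] by blast
    obtain j :: nat where j: "K0 \<le> real j" using real_arch_simple by blast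
    have "(\<integral>\<^sup>+\<omega>. ?N \<omega> \<partial>Spine) \<le> (\<integral>\<^sup>+\<omega>. (if \<exists>k. ?E (real j) k \<omega> then 1 else 0) \<partial>Spine)"
      by (intro nn_integral_mono) auto
    also have "\<dots> \<le> ennreal \<epsilon>" using K0[OF j] by simp
    finally show ?thesis .
  qed
  have "(\<integral>\<^sup>+\<omega>. ?N \<omega> \<partial>Spine) \<le> 0"
  proof (rule ennreal_le_epsilon)
    fix e :: real assume "0 < e"
    then show "(\<integral>\<^sup>+\<omega>. ?N \<omega> \<partial>Spine) \<le> 0 + ennreal e" by (simp only: add_0 small)
  qed
  then have "(\<integral>\<^sup>+\<omega>. ?N \<omega> \<partial>Spine) = 0"
    by (simp only: le_zero_eq)
  moreover have "?N \<in> borel_measurable Spine" by measurable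
  ultimately have "AE \<omega> in Spine. ?N \<omega> = 0"
    by (simp only: nn_integral_0_iff_AE)
  then show ?thesis
    using AE_spine_steps
  proof eventually_elim
    case (elim \<omega>)
    then obtain j :: nat where j: "\<And>k. spine_term k \<omega> \<le> real j"
      by (auto simp: not_less split: if_splits)
    \<comment> \<open>\<open>Suc j\<close> instead of \<open>j\<close> makes the bound nonpositive,
      as time 0 requires.\<close>
    have "- ln (real (Suc j)) \<le> psum step n \<omega>" for n
    proof (cases n)
      case (Suc k)
      have "exp (- psum step (Suc k) \<omega>) = exp (- psum step k \<omega>) * exp (- step (\<omega> k))"
        by (simp add: psum_Suc exp_add[symmetric])
      also have "\<dots> \<le> spine_term k \<omega>"
        by (rule mult_left_mono) (use elim(2) in blast, simp)
      also have "\<dots> \<le> real (Suc j)" using j[of k] by simp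
      finally have "- psum step (Suc k) \<omega> \<le> ln (real (Suc j))" by (subst ln_ge_iff) auto
      then show ?thesis using Suc by simp
    qed simp
    then show ?case by blast
  qed
qed

theorem W_tail_tendsto_0_iff:
  assumes nontrivial: "\<not> (AE e in size_biased. l (snd e) (fst e) = 1)"
  shows "(W_tail \<longlongrightarrow> 0) at_top \<longleftrightarrow> spine.drifts_to_infinity \<and>
    log_moment < \<infinity>"
proof
  assume ui: "(W_tail \<longlongrightarrow> 0) at_top"
  have "\<not> (AE e in size_biased. step e = 0)"
  proof
    assume "AE e in size_biased. step e = 0"
    with AE_spine_step have "AE e in size_biased. l (snd e) (fst e) = 1" by eventually_elim simp
    with nontrivial show False by simp
  qed
  with spine_walk_bounded_below[OF ui] have drift: "spine.drifts_to_infinity"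
    by (rule spine.drifts_if_bounded_below)
  \<comment> \<open>Tightness is used with \<open>\<epsilon> = 1\<close>: an exceedance probability
    below 1 is what the moment theorem asks for.\<close>
  obtain K0 where K0: "\<And>K. K \<ge> K0 \<Longrightarrow> (\<integral>\<^sup>+\<omega>. (if \<exists>k. K < spine_term k \<omega> then 1 else 0) \<partial>Spine) < ennreal 1"
    using spine_supremum_tight[OF ui, of 1] by auto
  \<comment> \<open>The lower bound 2 makes the shift \<open>ln K\<close> positive.\<close>
  define K where "K = max 2 K0"
  have K: "2 \<le> K" "K0 \<le> K" by (auto simp: K_def)
  have "(\<integral>\<^sup>+\<omega>. (if \<exists>n. psum step n \<omega> + ln K < ln (root_weight (fst (\<omega> n))) then 1 else 0) \<partial>Spine)
      \<le> (\<integral>\<^sup>+\<omega>. (if \<exists>k. K < spine_term k \<omega> then 1 else 0) \<partial>Spine)"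
  proof (rule nn_integral_mono_AE, use AE_spine_steps in eventually_elim)
    fix \<omega> :: "nat \<Rightarrow> 'r \<times> nat" assume \<omega>: "step_consistent \<omega>"
    have "K < spine_term n \<omega>"
      if "psum step n \<omega> + ln K < ln (root_weight (fst (\<omega> n)))" for n
    proof -
      have pos: "0 < root_weight (fst (\<omega> n))" using \<omega> by (meson exp_gt_zero less_le_trans)
      have "ln K < - psum step n \<omega> + ln (root_weight (fst (\<omega> n)))" using that by simp
      then have "exp (ln K) < exp (- psum step n \<omega> + ln (root_weight (fst (\<omega> n))))" by (simp only: exp_less_cancel_iff)
      then show ?thesis using pos K by (simp only: exp_add) simp
    qed
    then show "(if \<exists>n. psum step n \<omega> + ln K < ln (root_weight (fst (\<omega> n))) then 1 else 0)
        \<le> (if \<exists>k. K < spine_term k \<omega> then 1 else 0 :: ennreal)"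
      by auto
  qed
  also have "\<dots> < 1" using K0[OF K(2)] by simp
  finally have "log_moment < \<infinity>"
    using K by (intro spine.positive_part_moment_finite[OF drift, of _ "ln K"]) auto
  with drift show "spine.drifts_to_infinity \<and>
    log_moment < \<infinity>" by simp
qed (use W_tail_tendsto_0 in blast)

end

section \<open>The intrinsic martingale of a branching random walk\<close>

lemma distr_PiM_map:
  fixes M :: "'a measure" and N :: "'b measure"
  assumes M: "prob_space M" and f [measurable]: "f \<in> M \<rightarrow>\<^sub>M N"
  shows "distr (\<Pi>\<^sub>M i\<in>(UNIV :: 'i set). M) (\<Pi>\<^sub>M i\<in>UNIV. N) (\<lambda>\<omega> i. f (\<omega> i)) = (\<Pi>\<^sub>M i\<in>UNIV. distr M N f)"
proof (rule measure_eqI_PiM_infinite[symmetric])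
  interpret M: prob_space M by fact
  have D: "prob_space (distr M N f)" by (rule M.prob_space_distr) fact
  show "finite_measure (\<Pi>\<^sub>M i\<in>UNIV. distr M N f)"
    by (rule prob_space.finite_measure) (rule prob_space_PiM, rule D)
  show "sets (distr (\<Pi>\<^sub>M i\<in>UNIV. M) (\<Pi>\<^sub>M i\<in>UNIV. N) (\<lambda>\<omega> i. f (\<omega> i))) = sets (\<Pi>\<^sub>M i\<in>UNIV. N)"
    by simp
  show "sets (\<Pi>\<^sub>M i\<in>UNIV. distr M N f) = sets (\<Pi>\<^sub>M i\<in>UNIV. N)"
    by (intro sets_PiM_cong) auto
  have mf: "(\<lambda>\<omega> i. f (\<omega> i)) \<in> (\<Pi>\<^sub>M i\<in>UNIV. M) \<rightarrow>\<^sub>M (\<Pi>\<^sub>M i\<in>UNIV. N)"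
    by (rule measurable_PiM_single') (auto simp: space_PiM PiE_def Pi_iff measurable_space[OF f])
  fix A :: "'i \<Rightarrow> 'b set" and J :: "'i set"
  assume J: "finite J" "J \<subseteq> UNIV" and A: "\<And>i. i \<in> J \<Longrightarrow> A i \<in> sets N"
  have "emeasure (\<Pi>\<^sub>M i\<in>UNIV. distr M N f) (prod_emb UNIV (\<lambda>_. N) J (Pi\<^sub>E J A))
      = emeasure (\<Pi>\<^sub>M i\<in>UNIV. distr M N f) (prod_emb UNIV (\<lambda>_. distr M N f) J (Pi\<^sub>E J A))"
    by (simp add: prod_emb_def)
  also have "\<dots> = (\<Prod>i\<in>J. emeasure (distr M N f) (A i))"
    using J A by (intro emeasure_PiM_emb D) auto
  also have "\<dots> = (\<Prod>i\<in>J. emeasure M (f -` A i \<inter> space M))"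
    using A by (intro prod.cong) (auto simp: emeasure_distr)
  also have "\<dots> = emeasure (\<Pi>\<^sub>M i\<in>UNIV. M) (prod_emb UNIV (\<lambda>_. M) J (\<Pi>\<^sub>E i\<in>J. f -` A i \<inter> space M))"
    using J A by (intro emeasure_PiM_emb[symmetric] M) (auto simp: measurable_sets[OF f])
  also have "prod_emb UNIV (\<lambda>_. M) J (\<Pi>\<^sub>E i\<in>J. f -` A i \<inter> space M)
      = (\<lambda>\<omega> i. f (\<omega> i)) -` prod_emb UNIV (\<lambda>_. N) J (Pi\<^sub>E J A) \<inter> space (\<Pi>\<^sub>M i\<in>UNIV. M)"
    using measurable_space[OF f] by (auto simp: prod_emb_def space_PiM PiE_def Pi_iff)
  also have "emeasure (\<Pi>\<^sub>M i\<in>UNIV. M) \<dots>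
      = emeasure (distr (\<Pi>\<^sub>M i\<in>UNIV. M) (\<Pi>\<^sub>M i\<in>UNIV. N) (\<lambda>\<omega> i. f (\<omega> i))) (prod_emb UNIV (\<lambda>_. N) J (Pi\<^sub>E J A))"
    using J A by (intro emeasure_distr[symmetric] mf sets_PiM_I) auto
  finally show "emeasure (\<Pi>\<^sub>M i\<in>UNIV. distr M N f) (prod_emb UNIV (\<lambda>_. N) J (Pi\<^sub>E J A)) = \<dots>" .
qed

lemma ennreal_of_enat_le_suminf: "ennreal_of_enat n \<le> (\<Sum>i. if enat i < n then 1 else 0)"
proof (cases n)
  case (enat k)
  have "of_nat k = (\<Sum>i<k. if enat i < n then 1 else 0 :: ennreal)"
    using enat by simp
  also have "\<dots> \<le> (\<Sum>i. if enat i < n then 1 else 0)"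
    by (rule sum_le_suminf) auto
  finally show ?thesis using enat by simp
next
  case infinity
  have "\<not> finite {i::nat. True}" by simp
  then have "(\<Sum>i. if True then 1 else 0 :: ennreal) = \<infinity>"
    using finite_if_suminf_finite[of "\<lambda>_. True"] by blast
  then show ?thesis using infinity by simp
qed

text \<open>Layer-cake formula, which identifies \<open>A\<close> with
  \<open>trunc_mean\<close>.\<close>

lemma nn_integral_min_eq_layers:
  fixes s x :: real
  assumes "0 \<le> x"
  shows "(\<integral>\<^sup>+y\<in>{0..x}. (if y < s then 1 else 0) \<partial>lborel) = ennreal (min (max s 0) x)"
proof -
  have "(\<integral>\<^sup>+y\<in>{0..x}. (if y < s then 1 else 0) \<partial>lborel) = (\<integral>\<^sup>+y. indicator ({0..x} \<inter> {..<s}) y \<partial>lborel)"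
    by (intro nn_integral_cong) (auto simp: indicator_def)
  also have "\<dots> = emeasure lborel ({0..x} \<inter> {..<s})" by simp
  also have "\<dots> = ennreal (min (max s 0) x)"
  proof (cases "x < s")
    case True
    then have "{0..x} \<inter> {..<s} = {0..x}" by auto
    then show ?thesis using True assms by (simp add: min_def)
  next
    case False
    then have "{0..x} \<inter> {..<s} = {0..<s}" by auto
    then show ?thesis using False assms by (cases "0 \<le> s") (auto simp: min_def max_def)
  qed
  finally show ?thesis .
qed

section \<open>From the branching random walk to weighted branching\<close>

definition child_weight :: "real \<Rightarrow> real \<Rightarrow> nat \<Rightarrow> enat \<times> (nat \<Rightarrow> real) \<Rightarrow> real"
  where "child_weight \<gamma> \<mu> i r = (if enat i < fst r then exp (\<gamma> * snd r i) / \<mu> else 0)"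

lemma measurable_child_weight [measurable]: "child_weight \<gamma> \<mu> i \<in> borel_measurable reproduction_space"
  unfolding child_weight_def[abs_def] reproduction_space_def by measurable

lemma child_weight_reproduction:
  "child_weight \<gamma> \<mu> i (reproduction N X v \<omega>) = (if enat i < N v \<omega> then exp (\<gamma> * X v i \<omega>) / \<mu> else 0)"
  by (simp add: child_weight_def reproduction_def)

lemma generation_Suc:
  "generation N (Suc n) \<omega> = (\<lambda>(i, v). i # v) ` (SIGMA i:{i. enat i < N [] \<omega>}. generation (\<lambda>v. N (i # v)) n \<omega>)"
proof (intro set_eqI iffI)
  fix v assume v: "v \<in> generation N (Suc n) \<omega>"
  then obtain i v' where iv: "v = i # v'" by (cases v) (auto simp: generation_def)
  have "enat (v ! k) < N (take k v) \<omega>" if "k < length v" for k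
    using v that by (auto simp: generation_def tree_def)
  from this[of 0] this[of "Suc _"] show "v \<in> (\<lambda>(i, v). i # v) ` (SIGMA i:{i. enat i < N [] \<omega>}. generation (\<lambda>v. N (i # v)) n \<omega>)"
    using v unfolding iv by (auto simp: generation_def tree_def image_iff)
next
  fix v assume "v \<in> (\<lambda>(i, v). i # v) ` (SIGMA i:{i. enat i < N [] \<omega>}. generation (\<lambda>v. N (i # v)) n \<omega>)"
  then obtain i v' where iv: "v = i # v'" "enat i < N [] \<omega>" "v' \<in> generation (\<lambda>v. N (i # v)) n \<omega>" by auto
  then show "v \<in> generation N (Suc n) \<omega>"
    by (auto simp: generation_def tree_def nth_Cons split: nat.split)
qed

lemma nn_integral_generation_Suc:
  "(\<integral>\<^sup>+v. f v \<partial>count_space (generation N (Suc n) \<omega>))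
    = (\<Sum>i. if enat i < N [] \<omega> then \<integral>\<^sup>+v. f (i # v) \<partial>count_space (generation (\<lambda>v. N (i # v)) n \<omega>) else 0)"
proof -
  let ?S = "SIGMA i:{i. enat i < N [] \<omega>}. generation (\<lambda>v. N (i # v)) n \<omega>"
  have "bij_betw (\<lambda>(i, v). i # v) ?S (generation N (Suc n) \<omega>)"
    unfolding generation_Suc by (auto simp: bij_betw_def inj_on_def)
  then have "(\<integral>\<^sup>+v. f v \<partial>count_space (generation N (Suc n) \<omega>))
      = (\<integral>\<^sup>+p. f (case p of (i, v) \<Rightarrow> i # v) \<partial>count_space ?S)"
    by (rule nn_integral_bij_count_space[symmetric])
  also have "\<dots> = (\<integral>\<^sup>+p. f (case p of (i, v) \<Rightarrow> i # v) * indicator ?S p \<partial>count_space UNIV)"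
    by (rule nn_integral_count_space_indicator) simp
  also have "\<dots> = (\<integral>\<^sup>+i. \<integral>\<^sup>+v. f (i # v) * indicator ?S (i, v) \<partial>count_space UNIV \<partial>count_space UNIV)"
    by (subst nn_integral_fst_count_space[symmetric]) simp
  also have "\<dots> = (\<Sum>i. \<integral>\<^sup>+v. f (i # v) * indicator ?S (i, v) \<partial>count_space UNIV)"
    by (rule nn_integral_count_space_nat)
  also have "\<dots> = (\<Sum>i. if enat i < N [] \<omega> then \<integral>\<^sup>+v. f (i # v) \<partial>count_space (generation (\<lambda>v. N (i # v)) n \<omega>) else 0)"
  proof (rule suminf_cong)
    fix i
    show "(\<integral>\<^sup>+v. f (i # v) * indicator ?S (i, v) \<partial>count_space UNIV)
      = (if enat i < N [] \<omega> then \<integral>\<^sup>+v. f (i # v) \<partial>count_space (generation (\<lambda>v. N (i # v)) n \<omega>) else 0)"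
      by (subst nn_integral_count_space_indicator) (auto simp: indicator_def intro!: nn_integral_cong)
  qed
  finally show ?thesis .
qed

lemma generation_0: "generation N 0 \<omega> = {[]}"
  by (auto simp: generation_def tree_def)

lemma position_Cons: "position X (i # v) \<omega> = X [] i \<omega> + position (\<lambda>v. X (i # v)) v \<omega>"
  by (simp add: position_def sum.lessThan_Suc_shift del: sum.lessThan_Suc)

lemma nn_integral_generation_1:
  "(\<integral>\<^sup>+v. f v \<partial>count_space (generation N 1 \<omega>)) = (\<Sum>i. if enat i < N [] \<omega> then f [i] else 0)"
proof -
  have "(\<integral>\<^sup>+v. f (i # v) \<partial>count_space {[]}) = f [i]" for i
    by (subst nn_integral_count_space_finite) auto
  then show ?thesis
    unfolding One_nat_def nn_integral_generation_Suc generation_0 by (simp only:)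
qed

text \<open>A pointwise identity: the subtree of child \<open>i\<close> is described by
  \<open>N (i # v)\<close> and \<open>X (i # v)\<close>, so the induction runs over all
  \<open>N\<close> and \<open>X\<close>.\<close>

lemma W_eq_generation_sum:
  assumes wb: "weighted_branching R (child_weight \<gamma> \<mu>)" and \<mu>: "0 < \<mu>"
  shows "weighted_branching.W (child_weight \<gamma> \<mu>) n (\<lambda>v. reproduction N X v \<omega>)
    = (\<integral>\<^sup>+v. ennreal (exp (\<gamma> * position X v \<omega>) / \<mu> ^ length v) \<partial>count_space (generation N n \<omega>))"
proof (induction n arbitrary: N X)
  case 0
  interpret wb: weighted_branching R "child_weight \<gamma> \<mu>" by fact
  show ?case by (simp add: generation_0 nn_integral_count_space_finite position_def)
next
  case (Suc n)
  interpret wb: weighted_branching R "child_weight \<gamma> \<mu>" by fact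
  have "wb.W (Suc n) (\<lambda>v. reproduction N X v \<omega>)
      = (\<Sum>i. ennreal (child_weight \<gamma> \<mu> i (reproduction N X [] \<omega>)) * wb.W n (\<lambda>v. reproduction (\<lambda>v. N (i # v)) (\<lambda>v. X (i # v)) v \<omega>))"
    by (simp add: subtree_def reproduction_def)
  also have "\<dots> = (\<Sum>i. if enat i < N [] \<omega> then
      \<integral>\<^sup>+v. ennreal (exp (\<gamma> * position X (i # v) \<omega>) / \<mu> ^ length (i # v)) \<partial>count_space (generation (\<lambda>v. N (i # v)) n \<omega>) else 0)"
  proof (rule suminf_cong)
    fix i
    have "ennreal (exp (\<gamma> * X [] i \<omega>) / \<mu>) * ennreal (exp (\<gamma> * position (\<lambda>v. X (i # v)) v \<omega>) / \<mu> ^ length v)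
        = ennreal (exp (\<gamma> * position X (i # v) \<omega>) / \<mu> ^ length (i # v))" for v
      using \<mu> by (simp add: ennreal_mult[symmetric] position_Cons distrib_left exp_add)
    then show "ennreal (child_weight \<gamma> \<mu> i (reproduction N X [] \<omega>)) * wb.W n (\<lambda>v. reproduction (\<lambda>v. N (i # v)) (\<lambda>v. X (i # v)) v \<omega>)
      = (if enat i < N [] \<omega> then
        \<integral>\<^sup>+v. ennreal (exp (\<gamma> * position X (i # v) \<omega>) / \<mu> ^ length (i # v)) \<partial>count_space (generation (\<lambda>v. N (i # v)) n \<omega>) else 0)"
      by (simp add: Suc child_weight_reproduction nn_integral_cmult[symmetric])
  qed
  also have "\<dots> = (\<integral>\<^sup>+v. ennreal (exp (\<gamma> * position X v \<omega>) / \<mu> ^ length v) \<partial>count_space (generation N (Suc n) \<omega>))"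
    by (rule nn_integral_generation_Suc[symmetric])
  finally show ?case .
qed

locale intrinsic_martingale = branching_random_walk P N X
  for P :: "'a measure" and N :: "nat list \<Rightarrow> 'a \<Rightarrow> enat" and X :: "nat list \<Rightarrow> nat \<Rightarrow> 'a \<Rightarrow> real" +
  fixes \<gamma> :: real
  assumes m_pos: "0 < m P N X \<gamma>" and m_finite: "m P N X \<gamma> < \<infinity>"
begin

definition \<mu> :: real where "\<mu> = enn2real (m P N X \<gamma>)"

definition root_law :: "(enat \<times> (nat \<Rightarrow> real)) measure"
  where "root_law = distr P reproduction_space (reproduction N X [])"

abbreviation weight :: "nat \<Rightarrow> enat \<times> (nat \<Rightarrow> real) \<Rightarrow> real"
  where "weight \<equiv> child_weight \<gamma> \<mu>"

lemma \<mu>_pos: "0 < \<mu>"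
  using m_pos m_finite by (simp add: \<mu>_def enn2real_positive_iff)

lemma measurable_reproduction [measurable]: "reproduction N X v \<in> P \<rightarrow>\<^sub>M reproduction_space"
  using indep_reproduction by (simp add: indep_vars_def)

lemma nn_integral_root_law:
  assumes [measurable]: "f \<in> borel_measurable reproduction_space"
  shows "(\<integral>\<^sup>+r. f r \<partial>root_law) = (\<integral>\<^sup>+\<omega>. f (reproduction N X [] \<omega>) \<partial>P)"
  unfolding root_law_def by (rule nn_integral_distr) measurable

lemma sets_root_law [measurable_cong]: "sets root_law = sets reproduction_space"
  by (simp add: root_law_def)

lemma mean_weight: "(\<integral>\<^sup>+r. (\<Sum>i. ennreal (weight i r)) \<partial>root_law) = 1"
proof -
  have m: "(\<integral>\<^sup>+x. ennreal (exp (\<gamma> * x)) \<partial>point_process N X [] \<omega>)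
      = ennreal \<mu> * (\<Sum>i. ennreal (weight i (reproduction N X [] \<omega>)))" for \<omega>
  proof -
    have "(\<integral>\<^sup>+x. ennreal (exp (\<gamma> * x)) \<partial>point_process N X [] \<omega>)
        = (\<integral>\<^sup>+i. ennreal (exp (\<gamma> * X [] i \<omega>)) \<partial>count_space {i. enat i < N [] \<omega>})"
      unfolding point_process_def by (subst nn_integral_distr) auto
    also have "\<dots> = (\<integral>\<^sup>+i. ennreal \<mu> * ennreal (weight i (reproduction N X [] \<omega>)) \<partial>count_space UNIV)"
      using \<mu>_pos
      by (subst nn_integral_count_space_indicator)
        (auto simp: child_weight_reproduction indicator_def ennreal_mult[symmetric] simp del: ennreal_mult'' intro!: nn_integral_cong)
    finally show ?thesis by (simp add: nn_integral_count_space_nat)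
  qed
  have "ennreal \<mu> = m P N X \<gamma>" using m_finite by (simp add: \<mu>_def)
  also have "\<dots> = (\<integral>\<^sup>+\<omega>. ennreal \<mu> * (\<Sum>i. ennreal (weight i (reproduction N X [] \<omega>))) \<partial>P)"
    unfolding m_def m ..
  also have "\<dots> = ennreal \<mu> * (\<integral>\<^sup>+\<omega>. (\<Sum>i. ennreal (weight i (reproduction N X [] \<omega>))) \<partial>P)"
    by (rule nn_integral_cmult) measurable
  also have "(\<integral>\<^sup>+\<omega>. (\<Sum>i. ennreal (weight i (reproduction N X [] \<omega>))) \<partial>P)
      = (\<integral>\<^sup>+r. (\<Sum>i. ennreal (weight i r)) \<partial>root_law)"
    by (rule nn_integral_root_law[symmetric]) measurable
  finally have "ennreal \<mu> * 1 = ennreal \<mu> * (\<integral>\<^sup>+r. (\<Sum>i. ennreal (weight i r)) \<partial>root_law)" by simp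
  then show ?thesis using \<mu>_pos by (simp only: ennreal_mult_cancel_left) auto
qed

sublocale wb: weighted_branching root_law weight
proof (intro weighted_branching.intro weighted_branching_axioms.intro)
  show "prob_space root_law" unfolding root_law_def by (rule prob_space_distr) measurable
  show "weight i \<in> borel_measurable root_law" for i by measurable
  show "0 \<le> weight i r" for i r using \<mu>_pos by (simp add: child_weight_def)
qed (rule mean_weight)

lemma distr_labelled_tree:
  "distr P (\<Pi>\<^sub>M v\<in>UNIV. reproduction_space) (\<lambda>\<omega> v. reproduction N X v \<omega>) = wb.T"
proof -
  have "distr P (\<Pi>\<^sub>M v\<in>UNIV. reproduction_space) (\<lambda>\<omega>. \<lambda>v\<in>UNIV. reproduction N X v \<omega>)
      = (\<Pi>\<^sub>M v\<in>UNIV. distr P reproduction_space (reproduction N X v))"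
    using indep_reproduction by (subst (asm) indep_vars_iff_distr_eq_PiM) auto
  also have "(\<lambda>v. distr P reproduction_space (reproduction N X v)) = (\<lambda>v. root_law)"
    unfolding root_law_def by (rule ext) (rule identically_distributed)
  finally show ?thesis by (simp add: restrict_UNIV)
qed

lemma measurable_labelled_tree [measurable]: "(\<lambda>\<omega> v. reproduction N X v \<omega>) \<in> P \<rightarrow>\<^sub>M wb.T"
proof -
  have "(\<lambda>\<omega> v. reproduction N X v \<omega>) \<in> P \<rightarrow>\<^sub>M (\<Pi>\<^sub>M v\<in>UNIV. reproduction_space)"
    by (rule measurable_PiM_single') (auto dest: measurable_space[OF measurable_reproduction])
  also have "\<dots> = (P \<rightarrow>\<^sub>M wb.T)"
    by (intro measurable_cong_sets sets_PiM_cong) (auto simp: sets_root_law)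
  finally show ?thesis .
qed

lemma nn_integral_labelled_tree:
  assumes [measurable]: "f \<in> borel_measurable wb.T"
  shows "(\<integral>\<^sup>+\<omega>. f (\<lambda>v. reproduction N X v \<omega>) \<partial>P) = (\<integral>\<^sup>+t. f t \<partial>wb.T)"
proof -
  have "distr P wb.T (\<lambda>\<omega> v. reproduction N X v \<omega>)
      = distr P (\<Pi>\<^sub>M v\<in>UNIV. reproduction_space) (\<lambda>\<omega> v. reproduction N X v \<omega>)"
    by (intro distr_cong sets_PiM_cong) (auto simp: sets_root_law)
  then have "(\<integral>\<^sup>+t. f t \<partial>wb.T) = (\<integral>\<^sup>+t. f t \<partial>distr P wb.T (\<lambda>\<omega> v. reproduction N X v \<omega>))"
    by (simp only: distr_labelled_tree)
  then show ?thesis by (simp add: nn_integral_distr)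
qed

lemma W_eq: "W P N X \<gamma> n \<omega> = wb.W n (\<lambda>v. reproduction N X v \<omega>)"
  unfolding W_def L_def \<mu>_def[symmetric]
  by (rule W_eq_generation_sum[OF wb.weighted_branching_axioms \<mu>_pos, symmetric])

lemma W_1_eq: "W P N X \<gamma> 1 \<omega> = wb.total_weight (reproduction N X [] \<omega>)"
  unfolding W_eq by (simp add: wb.total_weight_def)

lemma uniformly_integrable_iff:
  "uniformly_integrable P (W P N X \<gamma>) UNIV \<longleftrightarrow> (wb.W_tail \<longlongrightarrow> 0) at_top"
proof -
  have meas: "W P N X \<gamma> n \<in> borel_measurable P" for n
    unfolding W_eq[abs_def] by measurable
  have "(\<integral>\<^sup>+\<omega>. W P N X \<gamma> n \<omega> * indicator {\<omega>. W P N X \<gamma> n \<omega> > ennreal K} \<omega> \<partial>P)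
      = (\<integral>\<^sup>+t. wb.W n t * (if ennreal K < wb.W n t then 1 else 0) \<partial>wb.T)" for n K
    by (subst nn_integral_labelled_tree[symmetric]) (auto simp: W_eq indicator_def intro!: nn_integral_cong)
  then show ?thesis
    unfolding uniformly_integrable_def wb.W_tail_def[abs_def] using meas by simp
qed

text \<open>If every child had weight 1, the number of children would be at most the total weight,
  whose mean is 1, against supercriticality.\<close>

lemma nontrivial_weight: "\<not> (AE e in wb.size_biased. weight (snd e) (fst e) = 1)"
proof
  assume "AE e in wb.size_biased. weight (snd e) (fst e) = 1"
  then have "(\<integral>\<^sup>+e. (if weight (snd e) (fst e) = 1 then 0 else 1) \<partial>wb.size_biased) = (\<integral>\<^sup>+e. 0 \<partial>wb.size_biased)"
    by (intro nn_integral_cong_AE) (auto elim: eventually_mono)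
  moreover have [measurable]: "(\<lambda>e. if weight (snd e) (fst e) = 1 then 0 else 1 :: ennreal)
      \<in> borel_measurable (root_law \<Otimes>\<^sub>M count_space UNIV)"
    by measurable
  ultimately have "(\<integral>\<^sup>+r. (\<Sum>i. ennreal (weight i r) * (if weight i r = 1 then 0 else 1)) \<partial>root_law) = 0"
    by (simp add: wb.nn_integral_size_biased)
  then have "AE r in root_law. (\<Sum>i. ennreal (weight i r) * (if weight i r = 1 then 0 else 1)) = 0"
    by (subst (asm) nn_integral_0_iff_AE) auto
  then have "AE r in root_law. ennreal_of_enat (fst r) \<le> (\<Sum>i. ennreal (weight i r))"
  proof eventually_elim
    case (elim r)
    have one: "weight i r = 1" if "enat i < fst r" for i
    proof (rule ccontr)
      assume "weight i r \<noteq> 1"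
      then have "ennreal (weight i r) = (\<Sum>i\<in>{i}. ennreal (weight i r) * (if weight i r = 1 then 0 else 1))" by simp
      also have "\<dots> \<le> (\<Sum>i. ennreal (weight i r) * (if weight i r = 1 then 0 else 1))"
        by (rule sum_le_suminf) auto
      finally have "ennreal (weight i r) \<le> 0" using elim by simp
      then show False using that \<mu>_pos by (simp add: child_weight_def divide_le_0_iff not_le)
    qed
    have "ennreal_of_enat (fst r) \<le> (\<Sum>i. if enat i < fst r then 1 else 0)" by (rule ennreal_of_enat_le_suminf)
    also have "\<dots> \<le> (\<Sum>i. ennreal (weight i r))"
      using one by (intro suminf_le) auto
    finally show ?case .
  qed
  then have "(\<integral>\<^sup>+r. ennreal_of_enat (fst r) \<partial>root_law) \<le> 1"
    using nn_integral_mono_AE mean_weight by metis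
  moreover have "(\<integral>\<^sup>+r. ennreal_of_enat (fst r) \<partial>root_law) = (\<integral>\<^sup>+\<omega>. ennreal_of_enat (N [] \<omega>) \<partial>P)"
  proof -
    have "(\<lambda>r. ennreal_of_enat (fst r)) \<in> borel_measurable reproduction_space"
      unfolding reproduction_space_def by measurable
    then show ?thesis by (subst nn_integral_root_law) (auto simp: reproduction_def)
  qed
  ultimately show False using supercritical by simp
qed

end

section \<open>The associated multiplicative walk as the spine\<close>

locale martingale_with_walk = intrinsic_martingale P N X \<gamma> + walk: associated_multiplicative_walk Q P N X \<gamma> M Ms
  for P :: "'a measure" and N X \<gamma> and Q :: "'b measure" and M Ms
begin

abbreviation spine_weight :: "(enat \<times> (nat \<Rightarrow> real)) \<times> nat \<Rightarrow> real"
  where "spine_weight e \<equiv> weight (snd e) (fst e)"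

lemma L_child: "L P N X \<gamma> [i] \<omega> = exp (\<gamma> * X [] i \<omega>) / \<mu>"
  by (simp add: L_def \<mu>_def position_def)

lemma emeasure_M:
  assumes [measurable]: "B \<in> sets borel"
  shows "emeasure Q {\<omega> \<in> space Q. M \<omega> \<in> B} = (\<integral>\<^sup>+e. indicator B (spine_weight e) \<partial>wb.size_biased)"
proof -
  have "emeasure Q {\<omega> \<in> space Q. M \<omega> \<in> B} = associated_mass P N X \<gamma> B"
    by (rule walk.M_law) simp
  also have "\<dots> = (\<integral>\<^sup>+\<omega>. (\<lambda>r. \<Sum>i. ennreal (weight i r) * indicator B (weight i r)) (reproduction N X [] \<omega>) \<partial>P)"
    unfolding associated_mass_def nn_integral_generation_1
    by (intro nn_integral_cong suminf_cong) (auto simp: L_child child_weight_reproduction intro!: suminf_cong)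
  also have "\<dots> = (\<integral>\<^sup>+r. (\<Sum>i. ennreal (weight i r) * indicator B (weight i r)) \<partial>root_law)"
    by (rule nn_integral_root_law[symmetric]) measurable
  also have "\<dots> = (\<integral>\<^sup>+e. indicator B (spine_weight e) \<partial>wb.size_biased)"
    by (subst wb.nn_integral_size_biased) auto
  finally show ?thesis .
qed

lemma distr_M: "distr Q borel M = distr wb.size_biased borel spine_weight"
proof (rule measure_eqI)
  fix B assume "B \<in> sets (distr Q borel M)"
  then have B [measurable]: "B \<in> sets borel" by simp
  have "emeasure (distr Q borel M) B = emeasure Q {\<omega> \<in> space Q. M \<omega> \<in> B}"
    using walk.M_random_variable B by (subst emeasure_distr) (auto intro!: arg_cong[where f = "emeasure Q"])
  also have "\<dots> = (\<integral>\<^sup>+x. indicator B x \<partial>distr wb.size_biased borel spine_weight)"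
    unfolding emeasure_M[OF B] by (rule nn_integral_distr[symmetric]) measurable
  also have "\<dots> = emeasure (distr wb.size_biased borel spine_weight) B" by simp
  finally show "emeasure (distr Q borel M) B = emeasure (distr wb.size_biased borel spine_weight) B" .
qed simp

lemma A_eq:
  assumes "0 \<le> x"
  shows "A Q M x = wb.spine.trunc_mean x"
proof -
  interpret PS: pair_sigma_finite wb.size_biased lborel
    by (intro pair_sigma_finite.intro lborel.sigma_finite_measure_axioms wb.spine.M.sigma_finite_measure_axioms)
  have "A Q M x = (\<integral>\<^sup>+y\<in>{0..x}. (\<integral>\<^sup>+e. (if y < wb.step e then 1 else 0) \<partial>wb.size_biased) \<partial>lborel)"
  proof -
    have "emeasure Q {\<omega> \<in> space Q. - ln (M \<omega>) > y} = (\<integral>\<^sup>+e. (if y < wb.step e then 1 else 0) \<partial>wb.size_biased)" for y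
    proof -
      have "{z :: real. - ln z > y} \<in> sets borel" by measurable
      from emeasure_M[OF this] show ?thesis by (simp add: wb.step_def indicator_def of_bool_def)
    qed
    then show ?thesis unfolding A_def by simp
  qed
  also have "\<dots> = (\<integral>\<^sup>+y. \<integral>\<^sup>+e. (if y < wb.step e then 1 else 0) * indicator {0..x} y \<partial>wb.size_biased \<partial>lborel)"
    by (intro nn_integral_cong nn_integral_multc[symmetric]) measurable
  also have "\<dots> = (\<integral>\<^sup>+e. \<integral>\<^sup>+y. (if y < wb.step e then 1 else 0) * indicator {0..x} y \<partial>lborel \<partial>wb.size_biased)"
    by (rule PS.Fubini') measurable
  also have "\<dots> = wb.spine.trunc_mean x"
    unfolding wb.spine.trunc_mean_def nn_integral_min_eq_layers[OF assms, symmetric] ..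
  finally show ?thesis .
qed

text \<open>Convergence to 0 is an event of the sequence of factors, and
  \<open>Ms 1, Ms 2, ...\<close> has the same joint law as the weights along the spine; the shift to
  \<open>Ms (Suc k)\<close> aligns the indices.\<close>

lemma mult_walk_tendsto_0_iff:
  "(AE \<omega> in Q. (\<lambda>n. mult_walk Ms n \<omega>) \<longlonglongrightarrow> 0) \<longleftrightarrow> wb.spine.drifts_to_infinity"
proof -
  let ?B = "\<Pi>\<^sub>M k\<in>(UNIV :: nat set). (borel :: real measure)"
  let ?\<Lambda> = "distr Q borel M"
  let ?P = "\<lambda>x :: nat \<Rightarrow> real. (\<lambda>n. \<Prod>k<n. x k) \<longlonglongrightarrow> 0"
  have M [measurable]: "M \<in> borel_measurable Q" by (rule walk.M_random_variable)
  have Ms: "Ms k \<in> borel_measurable Q" if "k \<ge> 1" for k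
    using walk.Ms_indep that by (simp add: walk.indep_vars_def)
  have [measurable]: "Measurable.pred ?B ?P" by measurable
  have \<Lambda>: "prob_space ?\<Lambda>" by (rule walk.prob_space_distr) measurable
  have "distr Q ?B (\<lambda>\<omega> k. Ms (Suc k) \<omega>) = (\<Pi>\<^sub>M k\<in>UNIV. ?\<Lambda>)"
  proof -
    have D: "distr Q (\<Pi>\<^sub>M i\<in>{1..}. borel) (\<lambda>\<omega>. \<lambda>i\<in>{1..}. Ms i \<omega>) = (\<Pi>\<^sub>M i\<in>{1..}. ?\<Lambda>)"
    proof -
      have "distr Q (\<Pi>\<^sub>M i\<in>{1..}. borel) (\<lambda>\<omega>. \<lambda>i\<in>{1..}. Ms i \<omega>) = (\<Pi>\<^sub>M i\<in>{1..}. distr Q borel (Ms i))"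
        using walk.Ms_indep Ms by (subst (asm) walk.indep_vars_iff_distr_eq_PiM') auto
      also have "\<dots> = (\<Pi>\<^sub>M i\<in>{1..}. ?\<Lambda>)"
        by (intro PiM_cong) (auto simp: walk.Ms_copies)
      finally show ?thesis .
    qed
    have meas: "(\<lambda>\<omega>. \<lambda>n\<in>UNIV. \<omega> (Suc n)) \<in> (\<Pi>\<^sub>M i\<in>{1..}. borel) \<rightarrow>\<^sub>M ?B"
      by (intro measurable_restrict measurable_component_singleton) auto
    have meas': "(\<lambda>\<omega>. \<lambda>i\<in>{1..}. Ms i \<omega>) \<in> Q \<rightarrow>\<^sub>M (\<Pi>\<^sub>M i\<in>{1..}. borel)"
      using Ms by (intro measurable_restrict) auto
    have "distr Q ?B (\<lambda>\<omega> k. Ms (Suc k) \<omega>)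
        = distr (distr Q (\<Pi>\<^sub>M i\<in>{1..}. borel) (\<lambda>\<omega>. \<lambda>i\<in>{1..}. Ms i \<omega>)) ?B (\<lambda>\<omega>. \<lambda>n\<in>UNIV. \<omega> (Suc n))"
      by (subst distr_distr[OF meas meas']) (auto simp: comp_def intro!: distr_cong)
    also have "\<dots> = distr (\<Pi>\<^sub>M i\<in>{1..}. ?\<Lambda>) (\<Pi>\<^sub>M n\<in>UNIV. ?\<Lambda>) (\<lambda>\<omega>. \<lambda>n\<in>UNIV. \<omega> (Suc n))"
      unfolding D by (intro distr_cong sets_PiM_cong) auto
    also have "\<dots> = (\<Pi>\<^sub>M n\<in>UNIV. ?\<Lambda>)"
      by (rule distr_PiM_reindex[where M = "\<lambda>_. ?\<Lambda>" and K = "{1..}"]) (use \<Lambda> in auto)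
    finally show ?thesis .
  qed
  moreover have "distr wb.Spine ?B (\<lambda>\<omega> k. spine_weight (\<omega> k)) = (\<Pi>\<^sub>M k\<in>UNIV. ?\<Lambda>)"
    unfolding distr_M by (rule distr_PiM_map[OF wb.prob_space_size_biased]) measurable
  ultimately have eq: "distr Q ?B (\<lambda>\<omega> k. Ms (Suc k) \<omega>) = distr wb.Spine ?B (\<lambda>\<omega> k. spine_weight (\<omega> k))"
    by simp
  have m1: "(\<lambda>\<omega> k. Ms (Suc k) \<omega>) \<in> Q \<rightarrow>\<^sub>M ?B"
    using Ms by (intro measurable_PiM_single') auto
  have m2: "(\<lambda>\<omega> k. spine_weight (\<omega> k)) \<in> wb.Spine \<rightarrow>\<^sub>M ?B"
    by (rule measurable_PiM_single') auto
  have P_sets: "{x \<in> space ?B. ?P x} \<in> sets ?B" by measurable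
  have "(AE \<omega> in Q. (\<lambda>n. mult_walk Ms n \<omega>) \<longlonglongrightarrow> 0) \<longleftrightarrow> (AE x in distr Q ?B (\<lambda>\<omega> k. Ms (Suc k) \<omega>). ?P x)"
    by (subst AE_distr_iff[OF m1 P_sets]) (simp add: mult_walk_def prod.atLeast1_atMost_eq)
  also have "\<dots> \<longleftrightarrow> (AE \<omega> in wb.Spine. (\<lambda>n. \<Prod>k<n. spine_weight (\<omega> k)) \<longlonglongrightarrow> 0)"
    unfolding eq by (rule AE_distr_iff[OF m2 P_sets])
  also have "\<dots> \<longleftrightarrow> wb.spine.drifts_to_infinity"
  proof -
    have "AE \<omega> in wb.Spine. (\<lambda>n. \<Prod>k<n. spine_weight (\<omega> k)) \<longlonglongrightarrow> 0
      \<longleftrightarrow> filterlim (\<lambda>n. psum wb.step n \<omega>) at_top sequentially"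
      using wb.AE_spine_steps
    proof eventually_elim
      case (elim \<omega>)
      have "(\<Prod>k<n. spine_weight (\<omega> k)) = exp (- psum wb.step n \<omega>)" for n
        using elim by (simp add: psum_def exp_sum sum_negf[symmetric])
      then show ?case by (simp add: exp_uminus_tendsto_0_iff)
    qed
    then show ?thesis by (auto elim: AE_mp)
  qed
  finally show ?thesis .
qed

text \<open>The factor \<open>W P N X \<gamma> 1 \<omega>\<close> is the size-biasing density of the
  root label, so the expectation becomes an integral over \<open>wb.size_biased\<close>. It differs
  from \<open>wb.log_moment\<close> only where the logarithm is not positive, by at most
  \<open>1 / p\<close>, and the drift makes \<open>p\<close> positive.\<close>

lemma J_moment_finite_iff:
  assumes drift: "wb.spine.drifts_to_infinity"
  shows "(\<integral>\<^sup>+\<omega>. W P N X \<gamma> 1 \<omega> * J Q M (log_plus (W P N X \<gamma> 1 \<omega>)) \<partial>P) < \<infinity> \<longleftrightarrow>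
    wb.log_moment < \<infinity>"
proof -
  define p where "p = emeasure Q {\<omega> \<in> space Q. M \<omega> < 1}"
  let ?x = "\<lambda>e :: (enat \<times> (nat \<Rightarrow> real)) \<times> nat. max 0 (ln (wb.root_weight (fst e)))"
  let ?g = "\<lambda>x. ennreal x / wb.spine.trunc_mean x"
  let ?j = "\<lambda>x. if 0 < x then ?g x else 1 / p"
  have lp: "log_plus w = max 0 (ln (enn2real w))" for w
    by (simp add: log_plus_def max.commute)
  have J_eq: "J Q M x = ?j x" if "0 \<le> x" for x
    using that by (simp add: J_def A_eq p_def)
  have "(\<integral>\<^sup>+\<omega>. W P N X \<gamma> 1 \<omega> * J Q M (log_plus (W P N X \<gamma> 1 \<omega>)) \<partial>P)
      = (\<integral>\<^sup>+\<omega>. (\<lambda>r. wb.total_weight r * ?j (max 0 (ln (wb.root_weight r)))) (reproduction N X [] \<omega>) \<partial>P)"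
    unfolding W_1_eq lp wb.root_weight_def[symmetric] by (simp add: J_eq)
  also have "\<dots> = (\<integral>\<^sup>+r. wb.total_weight r * ?j (max 0 (ln (wb.root_weight r))) \<partial>root_law)"
    by (rule nn_integral_root_law[symmetric]) measurable
  also have "\<dots> = (\<integral>\<^sup>+e. ?j (?x e) \<partial>wb.size_biased)"
  proof -
    have "(\<lambda>e. ?j (?x e)) \<in> borel_measurable (root_law \<Otimes>\<^sub>M count_space UNIV)" by measurable
    then show ?thesis
      by (subst wb.nn_integral_size_biased) (simp_all only: wb.total_weight_def fst_conv ennreal_suminf_multc)
  qed
  finally have eq: "(\<integral>\<^sup>+\<omega>. W P N X \<gamma> 1 \<omega> * J Q M (log_plus (W P N X \<gamma> 1 \<omega>)) \<partial>P) = (\<integral>\<^sup>+e. ?j (?x e) \<partial>wb.size_biased)" .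
  have p: "p \<noteq> 0"
  proof
    assume "p = 0"
    then have "(\<integral>\<^sup>+e. indicator {..<1} (spine_weight e) \<partial>wb.size_biased) = 0"
      using emeasure_M[of "{..<1}"] by (simp add: p_def)
    then have "AE e in wb.size_biased. indicator {..<1} (spine_weight e) = (0 :: ennreal)"
      by (subst (asm) nn_integral_0_iff_AE) auto
    with wb.AE_spine_step have "AE e in wb.size_biased. wb.step e \<le> 0"
    proof eventually_elim
      case (elim e)
      then have "1 \<le> exp (- wb.step e)" by (auto simp: indicator_def split: if_splits)
      then show ?case by simp
    qed
    with wb.spine.not_AE_nonpos_if_drifts[OF drift] show False by simp
  qed
  \<comment> \<open>In \<open>ennreal\<close> the quotient \<open>?g 0\<close> is 0, whereas
    \<open>?j 0\<close> is \<open>1 / p\<close>.\<close>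
  have "?g x \<le> ?j x" if "0 \<le> x" for x using that by (cases "x = 0") auto
  then have "(\<integral>\<^sup>+e. ?g (?x e) \<partial>wb.size_biased) \<le> (\<integral>\<^sup>+e. ?j (?x e) \<partial>wb.size_biased)"
    by (intro nn_integral_mono) (simp only: max.cobounded1)
  moreover have "(\<integral>\<^sup>+e. ?j (?x e) \<partial>wb.size_biased) \<le> (\<integral>\<^sup>+e. ?g (?x e) \<partial>wb.size_biased) + 1 / p"
  proof -
    have "(\<integral>\<^sup>+e. ?j (?x e) \<partial>wb.size_biased) \<le> (\<integral>\<^sup>+e. ?g (?x e) + 1 / p \<partial>wb.size_biased)"
      by (intro nn_integral_mono) auto
    also have "\<dots> = (\<integral>\<^sup>+e. ?g (?x e) \<partial>wb.size_biased) + 1 / p"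
      by (subst nn_integral_add) (auto simp: wb.spine.M.emeasure_space_1)
    finally show ?thesis .
  qed
  moreover have "1 / p < \<infinity>" using p by (simp add: less_top[symmetric] ennreal_divide_eq_top_iff)
  ultimately show ?thesis
    unfolding eq by (auto intro: le_less_trans)
qed

end

theorem theorem1p3:
  fixes P :: "'a measure" and Q :: "'b measure"
    and N :: "nat list \<Rightarrow> 'a \<Rightarrow> enat"
    and X :: "nat list \<Rightarrow> nat \<Rightarrow> 'a \<Rightarrow> real"
    and \<gamma> :: real
    and M :: "'b \<Rightarrow> real" and Ms :: "nat \<Rightarrow> 'b \<Rightarrow> real"
  assumes brw: "branching_random_walk P N X"
    and gamma_pos: "\<gamma> > 0"
    and m_pos: "0 < m P N X \<gamma>" and m_finite: "m P N X \<gamma> < \<infinity>"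
    and walk: "associated_multiplicative_walk Q P N X \<gamma> M Ms"
  shows "uniformly_integrable P (W P N X \<gamma>) UNIV \<longleftrightarrow>
    (AE \<omega> in Q. (\<lambda>n. mult_walk Ms n \<omega>) \<longlonglongrightarrow> 0) \<and>
    (\<integral>\<^sup>+\<omega>. W P N X \<gamma> 1 \<omega> * J Q M (log_plus (W P N X \<gamma> 1 \<omega>)) \<partial>P) < \<infinity>"
proof -
  interpret intrinsic_martingale P N X \<gamma>
    using brw m_pos m_finite by (intro intrinsic_martingale.intro intrinsic_martingale_axioms.intro)
  interpret martingale_with_walk P N X \<gamma> Q M Ms
    using walk by (intro martingale_with_walk.intro intrinsic_martingale_axioms)
  show ?thesis
    \<comment> \<open>The two moment conditions are equivalent only under the drift, which is the
      first conjunct on both sides.\<close>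
    unfolding uniformly_integrable_iff wb.W_tail_tendsto_0_iff[OF nontrivial_weight] mult_walk_tendsto_0_iff
    using J_moment_finite_iff by blast
qed

end
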